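(* Consider the DSCMD-N iteration described in the context, and suppose that the network, stochastic-subgradient, noise and mirror-map assumptions listed in the context hold. Let $\alpha_t=\frac{1}{(t+1)^{\kappa_1}}$ and $r_t=\frac1{(t+1)^{\kappa_2}}$ for all $t\ge 0$, where $0<\kappa_1<\kappa_2\le1$ and $2\kappa_2-\kappa_1\ne1$. Let $l\in\mathcal V$ and $\hat x_l^T=\frac1T\sum_{t=1}^Tx_l^t$, and let $C_1,\dots,C_6$ be the constants defined in the context. (i) If $\kappa_1\in(0,1)$ and $\kappa_2\in(0,1)$, then for every integer $T\ge1$, $$\mathbb E[F(\hat x_l^T)]-F(x^* )\le\Big(C_1+\Big|\tfrac{1-2(2\kappa_2-\kappa_1)}{1-(2\kappa_2-\kappa_1)}\Big|C_6\Big)\frac1T+2^{\kappa_1}C_2\frac1{T^{1-\kappa_1}}+\frac{2^{1-\kappa_1}C_3}{1-\kappa_1}\frac1{T^{\kappa_1}}+\frac{2^{1-\kappa_2}C_4}{1-\kappa_2}\frac1{T^{\kappa_2}}+\frac{2^{1-(\kappa_2-\kappa_1)}C_5}{1-(\kappa_2-\kappa_1)}\frac1{T^{\kappa_2-\kappa_1}}+\frac{C_6}{|1-(2\kappa_2-\kappa_1)|}\frac1{T^{2\kappa_2-\kappa_1}}.$$ (ii) If $\kappa_1\in(0,1)$ and $\kappa_2=1$, then for every integer $T\ge3$, $$\mathbb E[F(\hat x_l^T)]-F(x^* )\le\Big(C_1+\frac{2-\kappa_1}{1-\kappa_1}C_6\Big)\frac1T+\Big(2^{\kappa_1}C_2+\frac{2^{\kappa_1}C_5}{\kappa_1}\Big)\frac1{T^{1-\kappa_1}}+\frac{2^{1-\kappa_1}C_3}{1-\kappa_1}\frac1{T^{\kappa_1}}+4C_4\frac{\ln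 T}{T}.$$
   Context: Problem. $\mathcal V=\{1,\dots,N\}$ is a set of agents; $\mathcal X\subseteq\mathbb R^n$ is nonempty, convex and compact; $f_i,\chi_i:\mathbb R^n\to\mathbb R$ ($i\in\mathcal V$) are convex, possibly nonsmooth; $F_i=f_i+\chi_i$, $F=\sum_{i=1}^N F_i$. The problem is to minimize $F$ over $\mathcal X$; $\mathcal X^*$ is the set of minimizers and $x^*\in\mathcal X^*$. $\|\cdot\|$ is the Euclidean norm. $G_\chi=\max_{i\in\mathcal V}\sup\{\|g\|:g\in\partial\chi_i(x),\,x\in\mathcal X\}$. Mirror map. $\Phi:\mathbb R^n\to\mathbb R$ is continuously differentiable and $\sigma_\Phi$-strongly convex ($\sigma_\Phi>0$): $\Phi(x)\ge\Phi(y)+\langle\nabla\Phi(y),x-y\rangle+\frac{\sigma_\Phi}{2}\|x-y\|^2$. Its Bregman divergence is $D_\Phi(x,y)=\Phi(x)-\Phi(y)-\langle\nabla\Phi(y),x-y\rangle$, and $D_{\Phi,\mathcal X}^2=\sup_{x,y\in\mathcal X}D_\Phi(x,y)$ with $D_{\Phi,\mathcal X}\ge 0$. DSCMD-N. Starting from deterministic $x_i^0\in\mathcal X$, with stepsizes $\alpha_t>0$ and noise magnitudes $r_t>0$, for $t=0,1,2,\dots$ and $i\in\mathcal V$: $$y_i^t=\sum_{j=1}^N[P^t]_{ij}(x_j^t+r_t\xi_{ij}^t),\qquad x_i^{t+1}=\arg\min_{x\in\mathcal X}\Big\{\langle\tilde g_i^t,x\rangle+\frac1{\alpha_t}D_\Phi(x,y_i^t)+\chi_i(x)\Big\}.$$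 Here $P^t$ is an $N\times N$ weight matrix, $\xi_{ij}^t$ is a random vector in $\mathbb R^n$, and $\tilde g_i^t=\tilde g_i(y_i^t)$ is a stochastic subgradient of $f_i$ queried at $y_i^t$. $\mathcal F_t$ is the $\sigma$-algebra of the history up to time $t$ ($\mathcal F_{-1}$ trivial); all processes are adapted, the noises and stochastic subgradients of time $t$ being $\mathcal F_t$-measurable. Network assumption. Each $P^t$ is doubly stochastic with nonnegative entries; $E^t=\{(i,j):[P^t]_{ij}>0\}$; there is an integer $B\ge1$ such that the graph $(\mathcal V,\bigcup_{t=sB+1}^{(s+1)B}E^t)$ is strongly connected for every $s\ge0$; there is $\theta\in(0,1)$ with $[P^t]_{ii}\ge\theta$ for all $i,t$ and $[P^t]_{ij}\ge\theta$ whenever $(j,i)\in E^t$. Stochastic-subgradient assumption. There is $G_f\ge0$ such that at any $x\in\mathcal X$, $\mathbb E[\tilde g_i(x)\mid\mathcal F_{t-1}]=g_i(x)\in\partial f_i(x)$ and $\mathbb E[\|\tilde g_i(x)\|^2\mid\mathcal F_{t-1}]\le G_f^2$; the same holds at the query points: conditionally on $\mathcal F_{t-1}$ and the time-$t$ noises, $\tilde g_i^t$ has mean $g_i(y_i^t)\in\partial f_i(y_i^t)$ and second moment (of the norm) at most $G_f^2$. Noise assumption. At each time $t$, the noise on link $(i,j)$ is independent of the noise on link $(i',j')$ for $i\ne i'$, $j\neq j'$; and $\mathbb E[\|\xi_{ij}^t\|^2\mid\mathcal F_{t-1}]\le\nu$ for all $i,j\in\mathcal V$ and $t$. Mirror-map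 assumption. $\|\nabla\Phi(x)-\nabla\Phi(y)\|\le L_\Phi\|x-y\|$ for all $x,y\in\mathbb R^n$; and $D_\Phi(a,\sum_{i=1}^N\nu_ib_i)\le\sum_{i=1}^N\nu_iD_\Phi(a,b_i)$ for all $a,b_1,\dots,b_N\in\mathbb R^n$ and $\nu_i\in[0,1]$ with $\sum_i\nu_i=1$. Constants. With $\omega=(1-\frac{\theta}{4N^2})^{-2}$ and $\gamma=(1-\frac{\theta}{4N^2})^{1/B}$: $C_1=\frac{2N\omega}{1-\gamma}[(N+1)G_f+NG_\chi]\sum_{j=1}^N\|x_j^0\|$; $C_2=ND_{\Phi,\mathcal X}^2$; $C_3=\big((4N+\frac{2N^2\omega}{1-\gamma})[(N+1)G_f+NG_\chi]+NG_\chi\big)\frac{G_f+G_\chi}{\sigma_\Phi}+\frac{NG_f^2}{2\sigma_\Phi}$; $C_4=(4N+\frac{2N^2\omega}{1-\gamma})[(N+1)G_f+NG_\chi]N\sqrt\nu+(G_f+G_\chi)N^2\sqrt\nu$; $C_5=\sqrt{2/\sigma_\Phi}\,D_{\Phi,\mathcal X}L_\Phi N\sqrt\nu$; $C_6=NL_\Phi\nu$. *)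

theory Defs
  imports "HOL-Probability.Probability" "Graph_Theory.Digraph_Component"
begin

section \<open>Convex analysis and mirror maps\<close>

definition subdifferential :: "('a::real_inner \<Rightarrow> real) \<Rightarrow> 'a \<Rightarrow> 'a set" where
  "subdifferential f x = {g. \<forall>y. f y \<ge> f x + g \<bullet> (y - x)}"

definition max_subgrad_norm :: "nat \<Rightarrow> 'a::real_inner set \<Rightarrow> (nat \<Rightarrow> 'a \<Rightarrow> real) \<Rightarrow> real" where
  "max_subgrad_norm N X chi =
     Max ((\<lambda>i. Sup {norm g | g x. x \<in> X \<and> g \<in> subdifferential (chi i) x}) ` {1..N})"

text \<open>Throughout, \<open>\<Phi>'\<close> stands for the gradient of \<open>\<Phi>\<close>; it is tied to \<open>\<Phi>\<close> by \<open>mirror_map\<close>.\<close>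

definition mirror_map :: "('a::real_inner \<Rightarrow> real) \<Rightarrow> ('a \<Rightarrow> 'a) \<Rightarrow> real \<Rightarrow> bool" where
  "mirror_map \<Phi> \<Phi>' \<sigma> \<longleftrightarrow>
     (\<forall>x. GDERIV \<Phi> x :> \<Phi>' x) \<and> continuous_on UNIV \<Phi>' \<and> \<sigma> > 0 \<and>
     (\<forall>x y. \<Phi> x \<ge> \<Phi> y + \<Phi>' y \<bullet> (x - y) + \<sigma> / 2 * (norm (x - y))\<^sup>2)"

definition bregman :: "('a::real_inner \<Rightarrow> real) \<Rightarrow> ('a \<Rightarrow> 'a) \<Rightarrow> 'a \<Rightarrow> 'a \<Rightarrow> real" where
  "bregman \<Phi> \<Phi>' x y = \<Phi> x - \<Phi> y - \<Phi>' y \<bullet> (x - y)"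

text \<open>The square of this quantity is the supremum of the divergence over \<open>X\<close>.\<close>

definition bregman_diam :: "('a::real_inner \<Rightarrow> real) \<Rightarrow> ('a \<Rightarrow> 'a) \<Rightarrow> 'a set \<Rightarrow> real" where
  "bregman_diam \<Phi> \<Phi>' X = sqrt (SUP (x, y)\<in>X \<times> X. bregman \<Phi> \<Phi>' x y)"

definition mirror_map_assumption ::
    "nat \<Rightarrow> ('a::real_inner \<Rightarrow> real) \<Rightarrow> ('a \<Rightarrow> 'a) \<Rightarrow> real \<Rightarrow> bool" where
  "mirror_map_assumption N \<Phi> \<Phi>' L \<longleftrightarrow>
     (\<forall>x y. norm (\<Phi>' x - \<Phi>' y) \<le> L * norm (x - y)) \<and>
     (\<forall>a b w. (\<forall>i\<in>{1..N}. w i \<in> {0..1}) \<and> (\<Sum>i=1..N. w i) = 1 \<longrightarrow>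
        bregman \<Phi> \<Phi>' a (\<Sum>i=1..N. w i *\<^sub>R b i) \<le> (\<Sum>i=1..N. w i * bregman \<Phi> \<Phi>' a (b i)))"


section \<open>Network\<close>

definition doubly_stochastic :: "nat \<Rightarrow> (nat \<Rightarrow> nat \<Rightarrow> real) \<Rightarrow> bool" where
  "doubly_stochastic N A \<longleftrightarrow>
     (\<forall>i\<in>{1..N}. \<forall>j\<in>{1..N}. 0 \<le> A i j) \<and>
     (\<forall>i\<in>{1..N}. (\<Sum>j=1..N. A i j) = 1) \<and>
     (\<forall>j\<in>{1..N}. (\<Sum>i=1..N. A i j) = 1)"

definition weight_edges :: "nat \<Rightarrow> (nat \<Rightarrow> nat \<Rightarrow> real) \<Rightarrow> (nat \<times> nat) set" where
  "weight_edges N A = {(i, j). i \<in> {1..N} \<and> j \<in> {1..N} \<and> A i j > 0}"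

text \<open>Because of the orientation \<open>(j, i)\<close>, the last condition makes the support of every \<open>P t\<close> symmetric.\<close>

definition network_assumption ::
    "nat \<Rightarrow> (nat \<Rightarrow> nat \<Rightarrow> nat \<Rightarrow> real) \<Rightarrow> nat \<Rightarrow> real \<Rightarrow> bool" where
  "network_assumption N P B \<theta> \<longleftrightarrow>
     (\<forall>t. doubly_stochastic N (P t)) \<and>
     B \<ge> 1 \<and>
     (\<forall>s. strongly_connected
        (with_proj \<lparr>pverts = {1..N}, parcs = (\<Union>t\<in>{s * B + 1..(s + 1) * B}. weight_edges N (P t))\<rparr>)) \<and>
     0 < \<theta> \<and> \<theta> < 1 \<and>
     (\<forall>t. \<forall>i\<in>{1..N}. P t i i \<ge> \<theta>) \<and>
     (\<forall>t. \<forall>i\<in>{1..N}. \<forall>j\<in>{1..N}. (j, i) \<in> weight_edges N (P t) \<longrightarrow> P t i j \<ge> \<theta>)"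


section \<open>The iteration\<close>

text \<open>
  Time is the first argument of every process and the agent the second. The value \<open>sg t i z \<omega>\<close> is
  the stochastic subgradient of the function of agent \<open>i\<close> drawn at time \<open>t\<close> when the query
  point is \<open>z\<close>, so that the subgradient used by the iteration is \<open>sg t i (y t i \<omega>) \<omega>\<close>.
\<close>

definition noisy_mix ::
    "nat \<Rightarrow> (nat \<Rightarrow> nat \<Rightarrow> nat \<Rightarrow> real) \<Rightarrow> (nat \<Rightarrow> real) \<Rightarrow> (nat \<Rightarrow> nat \<Rightarrow> nat \<Rightarrow> 'w \<Rightarrow> 'a::real_vector)
      \<Rightarrow> (nat \<Rightarrow> nat \<Rightarrow> 'w \<Rightarrow> 'a) \<Rightarrow> nat \<Rightarrow> nat \<Rightarrow> 'w \<Rightarrow> 'a" where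
  "noisy_mix N P r \<xi> x t i \<omega> = (\<Sum>j=1..N. P t i j *\<^sub>R (x t j \<omega> + r t *\<^sub>R \<xi> t i j \<omega>))"

definition dscmd_n ::
    "'w measure \<Rightarrow> nat \<Rightarrow> 'a::real_inner set \<Rightarrow> (nat \<Rightarrow> 'a \<Rightarrow> real) \<Rightarrow> ('a \<Rightarrow> real) \<Rightarrow> ('a \<Rightarrow> 'a)
      \<Rightarrow> (nat \<Rightarrow> real) \<Rightarrow> (nat \<Rightarrow> nat \<Rightarrow> 'a \<Rightarrow> 'w \<Rightarrow> 'a)
      \<Rightarrow> (nat \<Rightarrow> 'a) \<Rightarrow> (nat \<Rightarrow> nat \<Rightarrow> 'w \<Rightarrow> 'a) \<Rightarrow> (nat \<Rightarrow> nat \<Rightarrow> 'w \<Rightarrow> 'a) \<Rightarrow> bool" where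
  "dscmd_n M N X chi \<Phi> \<Phi>' \<alpha> sg x0 x y \<longleftrightarrow>
     (\<forall>i\<in>{1..N}. x0 i \<in> X \<and> (\<forall>\<omega>\<in>space M. x 0 i \<omega> = x0 i)) \<and>
     (\<forall>t. \<forall>i\<in>{1..N}. \<forall>\<omega>\<in>space M.
        is_arg_min
          (\<lambda>z. sg t i (y t i \<omega>) \<omega> \<bullet> z + 1 / \<alpha> t * bregman \<Phi> \<Phi>' z (y t i \<omega>) + chi i z)
          (\<lambda>z. z \<in> X) (x (Suc t) i \<omega>))"


section \<open>Histories and stochastic assumptions\<close>

text \<open>The history strictly before time \<open>t\<close>; it is the trivial sigma-algebra for \<open>t = 0\<close>.\<close>

definition past :: "'w measure \<Rightarrow> (nat \<Rightarrow> 'w measure) \<Rightarrow> nat \<Rightarrow> 'w measure" where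
  "past M F t = (case t of 0 \<Rightarrow> sigma (space M) {} | Suc s \<Rightarrow> F s)"

definition past_and_noise ::
    "'w measure \<Rightarrow> (nat \<Rightarrow> 'w measure) \<Rightarrow> nat \<Rightarrow> (nat \<Rightarrow> nat \<Rightarrow> nat \<Rightarrow> 'w \<Rightarrow> 'a::topological_space)
      \<Rightarrow> nat \<Rightarrow> 'w measure" where
  "past_and_noise M F N \<xi> t = sigma (space M)
     (sets (past M F t) \<union>
      {\<xi> t i j -` A \<inter> space M | i j A. i \<in> {1..N} \<and> j \<in> {1..N} \<and> A \<in> sets borel})"

definition adapted_history ::
    "'w measure \<Rightarrow> (nat \<Rightarrow> 'w measure) \<Rightarrow> nat \<Rightarrow> (nat \<Rightarrow> nat \<Rightarrow> nat \<Rightarrow> 'w \<Rightarrow> 'a::euclidean_space)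
      \<Rightarrow> (nat \<Rightarrow> nat \<Rightarrow> 'a \<Rightarrow> 'w \<Rightarrow> 'a) \<Rightarrow> (nat \<Rightarrow> nat \<Rightarrow> 'w \<Rightarrow> 'a) \<Rightarrow> (nat \<Rightarrow> nat \<Rightarrow> 'w \<Rightarrow> 'a) \<Rightarrow> bool" where
  "adapted_history M F N \<xi> sg x y \<longleftrightarrow>
     filtration (space M) F \<and> (\<forall>t. subalgebra M (F t)) \<and>
     (\<forall>t. \<forall>i\<in>{1..N}.
        x t i \<in> borel_measurable (past M F t) \<and>
        (\<forall>j\<in>{1..N}. \<xi> t i j \<in> borel_measurable (F t)) \<and>
        (\<lambda>\<omega>. sg t i (y t i \<omega>) \<omega>) \<in> borel_measurable (F t))"

text \<open>
  The random vector \<open>Z\<close> has conditional mean \<open>m\<close> (coordinatewise, as \<open>real_cond_exp\<close> is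
  real-valued) and conditional second moment at most \<open>c\<close> given \<open>G\<close>. The second moment is
  taken in \<open>ennreal\<close>, so the bound also yields the integrability of \<open>Z\<close>.
\<close>

definition cond_mean_moment2 ::
    "'w measure \<Rightarrow> 'w measure \<Rightarrow> ('w \<Rightarrow> 'a::euclidean_space) \<Rightarrow> ('w \<Rightarrow> 'a) \<Rightarrow> real \<Rightarrow> bool" where
  "cond_mean_moment2 M G Z m c \<longleftrightarrow>
     Z \<in> borel_measurable M \<and>
     (\<forall>b\<in>Basis. AE \<omega> in M. real_cond_exp M G (\<lambda>\<omega>. Z \<omega> \<bullet> b) \<omega> = m \<omega> \<bullet> b) \<and>
     (AE \<omega> in M. nn_cond_exp M G (\<lambda>\<omega>. ennreal ((norm (Z \<omega>))\<^sup>2)) \<omega> \<le> ennreal c)"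

definition stochastic_subgradient_assumption ::
    "'w measure \<Rightarrow> (nat \<Rightarrow> 'w measure) \<Rightarrow> nat \<Rightarrow> 'a::euclidean_space set \<Rightarrow> (nat \<Rightarrow> 'a \<Rightarrow> real)
      \<Rightarrow> (nat \<Rightarrow> nat \<Rightarrow> nat \<Rightarrow> 'w \<Rightarrow> 'a) \<Rightarrow> (nat \<Rightarrow> nat \<Rightarrow> 'a \<Rightarrow> 'w \<Rightarrow> 'a) \<Rightarrow> (nat \<Rightarrow> 'a \<Rightarrow> 'a)
      \<Rightarrow> (nat \<Rightarrow> nat \<Rightarrow> 'w \<Rightarrow> 'a) \<Rightarrow> real \<Rightarrow> bool" where
  "stochastic_subgradient_assumption M F N X f \<xi> sg g y G\<^sub>f \<longleftrightarrow>
     G\<^sub>f \<ge> 0 \<and>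
     (\<forall>t. \<forall>i\<in>{1..N}.
        (\<forall>z\<in>X. g i z \<in> subdifferential (f i) z \<and>
           cond_mean_moment2 M (past M F t) (sg t i z) (\<lambda>\<omega>. g i z) (G\<^sub>f\<^sup>2)) \<and>
        (AE \<omega> in M. g i (y t i \<omega>) \<in> subdifferential (f i) (y t i \<omega>)) \<and>
        cond_mean_moment2 M (past_and_noise M F N \<xi> t)
          (\<lambda>\<omega>. sg t i (y t i \<omega>) \<omega>) (\<lambda>\<omega>. g i (y t i \<omega>)) (G\<^sub>f\<^sup>2))"

definition noise_assumption ::
    "'w measure \<Rightarrow> (nat \<Rightarrow> 'w measure) \<Rightarrow> nat \<Rightarrow> (nat \<Rightarrow> nat \<Rightarrow> nat \<Rightarrow> 'w \<Rightarrow> 'a::euclidean_space)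
      \<Rightarrow> real \<Rightarrow> bool" where
  "noise_assumption M F N \<xi> \<nu> \<longleftrightarrow>
     (\<forall>t. \<forall>i\<in>{1..N}. \<forall>j\<in>{1..N}. \<forall>i'\<in>{1..N}. \<forall>j'\<in>{1..N}. i \<noteq> i' \<and> j \<noteq> j' \<longrightarrow>
        prob_space.indep_var M borel (\<xi> t i j) borel (\<xi> t i' j')) \<and>
     \<nu> \<ge> 0 \<and>
     (\<forall>t. \<forall>i\<in>{1..N}. \<forall>j\<in>{1..N}.
        AE \<omega> in M. nn_cond_exp M (past M F t) (\<lambda>\<omega>. ennreal ((norm (\<xi> t i j \<omega>))\<^sup>2)) \<omega> \<le> ennreal \<nu>)"


section \<open>Constants of the rate\<close>

definition rate_omega :: "nat \<Rightarrow> real \<Rightarrow> real" where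
  "rate_omega N \<theta> = 1 / (1 - \<theta> / (4 * (real N)\<^sup>2))\<^sup>2"

definition rate_gamma :: "nat \<Rightarrow> nat \<Rightarrow> real \<Rightarrow> real" where
  "rate_gamma N B \<theta> = (1 - \<theta> / (4 * (real N)\<^sup>2)) powr (1 / real B)"

definition rate_C1 :: "nat \<Rightarrow> nat \<Rightarrow> real \<Rightarrow> real \<Rightarrow> real \<Rightarrow> (nat \<Rightarrow> 'a::real_normed_vector) \<Rightarrow> real" where
  "rate_C1 N B \<theta> G\<^sub>f G\<^sub>\<chi> x0 =
     2 * real N * rate_omega N \<theta> / (1 - rate_gamma N B \<theta>) *
     ((real N + 1) * G\<^sub>f + real N * G\<^sub>\<chi>) * (\<Sum>j=1..N. norm (x0 j))"

definition rate_C2 :: "nat \<Rightarrow> real \<Rightarrow> real" where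
  "rate_C2 N D = real N * D\<^sup>2"

definition rate_C3 :: "nat \<Rightarrow> nat \<Rightarrow> real \<Rightarrow> real \<Rightarrow> real \<Rightarrow> real \<Rightarrow> real" where
  "rate_C3 N B \<theta> G\<^sub>f G\<^sub>\<chi> \<sigma> =
     ((4 * real N + 2 * (real N)\<^sup>2 * rate_omega N \<theta> / (1 - rate_gamma N B \<theta>)) *
        ((real N + 1) * G\<^sub>f + real N * G\<^sub>\<chi>) + real N * G\<^sub>\<chi>) * ((G\<^sub>f + G\<^sub>\<chi>) / \<sigma>) +
     real N * G\<^sub>f\<^sup>2 / (2 * \<sigma>)"

definition rate_C4 :: "nat \<Rightarrow> nat \<Rightarrow> real \<Rightarrow> real \<Rightarrow> real \<Rightarrow> real \<Rightarrow> real" where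
  "rate_C4 N B \<theta> G\<^sub>f G\<^sub>\<chi> \<nu> =
     (4 * real N + 2 * (real N)\<^sup>2 * rate_omega N \<theta> / (1 - rate_gamma N B \<theta>)) *
       ((real N + 1) * G\<^sub>f + real N * G\<^sub>\<chi>) * real N * sqrt \<nu> +
     (G\<^sub>f + G\<^sub>\<chi>) * (real N)\<^sup>2 * sqrt \<nu>"

definition rate_C5 :: "nat \<Rightarrow> real \<Rightarrow> real \<Rightarrow> real \<Rightarrow> real \<Rightarrow> real" where
  "rate_C5 N \<sigma> D L \<nu> = sqrt (2 / \<sigma>) * D * L * real N * sqrt \<nu>"

definition rate_C6 :: "nat \<Rightarrow> real \<Rightarrow> real \<Rightarrow> real" where
  "rate_C6 N L \<nu> = real N * L * \<nu>"

end

theory Submission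
  imports Defs
begin

text \<open>
  The optimality condition of the mirror step, tested against the minimizer, yields a telescoping
  descent inequality for the expected divergence; separate convexity and smoothness of the mirror
  map turn the noise into the terms with \<open>C5\<close> and \<open>C6\<close>. It remains to control the
  disagreement of the agents. The unperturbed mixing contracts their dispersion by
  \<open>1 - \<theta> / (4 N\<^sup>2)\<close> per window of length \<open>B\<close>, and the perturbation in step \<open>t\<close>
  is at most \<open>(\<alpha> G + L r sqrt \<nu>) / \<sigma>\<close> on average, where \<open>G = G\<^sub>f + G\<^sub>\<chi>\<close>; the noise
  carries the factor \<open>L / \<sigma>\<close> because the noisy query point lies outside \<open>X\<close> and
  the Bregman projection need not be nonexpansive.

  This factor does not occur in \<open>C4\<close>, so the noise in the perturbation is absorbed by a case
  distinction. As long as \<open>\<alpha> G \<le> L r sqrt \<nu>\<close>, the trivial bound \<open>N G diam X\<close> on the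
  error is already below \<open>C5 r / \<alpha>\<close>; since \<open>r / \<alpha>\<close> decreases, these times form an
  initial segment. Afterwards the perturbation is at most \<open>2 \<alpha> G / \<sigma>\<close>, and restarting
  the consensus estimate costs a multiple of \<open>diam X\<close> once. This cost fits into the slack
  of \<open>C3\<close> unless \<open>diam X\<close> is so large that the term with \<open>C2\<close> alone exceeds the
  trivial bound.
\<close>

section \<open>Mixing\<close>

text \<open>A query point \<open>y\<close> may leave \<open>X\<close>, so its distances to points of
  \<open>X\<close> are not bounded by the diameter. Function values and disagreement are therefore
  measured at the noise-free mixture \<open>z\<close>, which stays in \<open>X\<close> by convexity,
  and the noise enters only through \<open>y - z\<close>. Differences of function values are always
  estimated by a subgradient at the point whose value counts positively; this point is chosen in
  \<open>X\<close>, so the bounds \<open>Gf\<close> and \<open>Gchi\<close> for subgradients over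
  \<open>X\<close> suffice.

  The slack of \<open>C3\<close> is only just large enough. The disagreement enters with the factor
  \<open>2 * (N - 1) * G\<close>; the case distinction doubles the perturbation, and the restart
  cost at most doubles the result again, because outside the trivial case \<open>R\<close> is
  bounded by \<open>2 * G / \<sigma>\<close> times the sum of the stepsizes. What is left is
  \<open>4 * N * (N - 1) \<le> N ^ 3\<close>, an equality for two agents.\<close>

lemma doubly_stochasticD:
  assumes "doubly_stochastic N A"
  shows "i \<in> {1..N} \<Longrightarrow> j \<in> {1..N} \<Longrightarrow> 0 \<le> A i j"
    and "i \<in> {1..N} \<Longrightarrow> (\<Sum>j=1..N. A i j) = 1"
    and "j \<in> {1..N} \<Longrightarrow> (\<Sum>i=1..N. A i j) = 1"
  using assms by (auto simp: doubly_stochastic_def)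

section \<open>Loss of variance over one window of mixing\<close>

lemma sum_doubly_stochastic:
  fixes h :: "nat \<Rightarrow> 'a::real_vector"
  assumes "doubly_stochastic N A"
  shows "(\<Sum>i=1..N. \<Sum>j=1..N. A i j *\<^sub>R h j) = (\<Sum>j=1..N. h j)"
proof -
  have "(\<Sum>i=1..N. \<Sum>j=1..N. A i j *\<^sub>R h j) = (\<Sum>j=1..N. (\<Sum>i=1..N. A i j) *\<^sub>R h j)"
    by (subst sum.swap) (simp add: scaleR_left.sum)
  also have "\<dots> = (\<Sum>j=1..N. h j)"
    using doubly_stochasticD(3)[OF assms] by (intro sum.cong) auto
  finally show ?thesis .
qed

text \<open>A row of \<open>A\<close> is a probability vector, so each inner sum on the right is a
  variance, that is, second moment minus squared mean; by the column sums the second moments add up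
  to the sum of squares of \<open>v\<close>.\<close>

lemma doubly_stochastic_variance_drop:
  fixes v :: "nat \<Rightarrow> real"
  assumes "doubly_stochastic N A"
  shows "(\<Sum>i=1..N. (v i)\<^sup>2) - (\<Sum>i=1..N. (\<Sum>j=1..N. A i j * v j)\<^sup>2) =
    (\<Sum>i=1..N. \<Sum>j=1..N. A i j * (v j - (\<Sum>k=1..N. A i k * v k))\<^sup>2)"
proof -
  have "(\<Sum>j=1..N. A i j * (v j - (\<Sum>k=1..N. A i k * v k))\<^sup>2) =
      (\<Sum>j=1..N. A i j * (v j)\<^sup>2) - (\<Sum>j=1..N. A i j * v j)\<^sup>2" if "i \<in> {1..N}" for i
  proof -
    define m where "m = (\<Sum>k=1..N. A i k * v k)"
    have "(\<Sum>j=1..N. A i j * (v j - m)\<^sup>2) =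
        (\<Sum>j=1..N. A i j * (v j)\<^sup>2) - 2 * m * (\<Sum>j=1..N. A i j * v j) + m\<^sup>2 * (\<Sum>j=1..N. A i j)"
      unfolding sum_distrib_left sum_subtractf[symmetric] sum.distrib[symmetric]
      by (intro sum.cong) (auto simp: power2_eq_square algebra_simps)
    also have "\<dots> = (\<Sum>j=1..N. A i j * (v j)\<^sup>2) - m\<^sup>2"
      using doubly_stochasticD(2)[OF assms that] by (simp add: m_def power2_eq_square)
    finally show ?thesis by (simp add: m_def)
  qed
  then have "(\<Sum>i=1..N. \<Sum>j=1..N. A i j * (v j - (\<Sum>k=1..N. A i k * v k))\<^sup>2) =
      (\<Sum>i=1..N. (\<Sum>j=1..N. A i j * (v j)\<^sup>2) - (\<Sum>j=1..N. A i j * v j)\<^sup>2)"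
    by (intro sum.cong) auto
  also have "\<dots> = (\<Sum>i=1..N. (v i)\<^sup>2) - (\<Sum>i=1..N. (\<Sum>j=1..N. A i j * v j)\<^sup>2)"
    using sum_doubly_stochastic[OF assms, of "\<lambda>j. (v j)\<^sup>2"] by (simp add: sum_subtractf)
  finally show ?thesis by simp
qed

text \<open>Whatever the centre \<open>m\<close>, the squared deviations of two points add up to at
  least half of their squared distance. In a row of a weight matrix the two indices will be the
  diagonal one and a neighbour.\<close>

lemma weighted_square_ge_gap:
  fixes a v :: "nat \<Rightarrow> real"
  assumes "finite I" "i \<in> I" "j \<in> I" "\<And>k. k \<in> I \<Longrightarrow> 0 \<le> a k" "\<theta> \<le> a i" "\<theta> \<le> a j" "0 \<le> \<theta>"
  shows "\<theta> / 2 * (v j - v i)\<^sup>2 \<le> (\<Sum>k\<in>I. a k * (v k - m)\<^sup>2)"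
proof (cases "i = j")
  case True
  then show ?thesis using assms by (auto intro!: sum_nonneg)
next
  case False
  have "(v j - v i)\<^sup>2 \<le> 2 * ((v i - m)\<^sup>2 + (v j - m)\<^sup>2)"
    using zero_le_power2[of "v i + v j - 2 * m"] by (simp add: power2_eq_square algebra_simps)
  then have "\<theta> / 2 * (v j - v i)\<^sup>2 \<le> \<theta> * (v i - m)\<^sup>2 + \<theta> * (v j - m)\<^sup>2"
    using mult_left_mono[of _ _ "\<theta> / 2"] \<open>0 \<le> \<theta>\<close> by (fastforce simp: algebra_simps)
  also have "\<dots> \<le> a i * (v i - m)\<^sup>2 + a j * (v j - m)\<^sup>2"
    using assms by (intro add_mono mult_right_mono) auto
  also have "\<dots> = (\<Sum>k\<in>{i, j}. a k * (v k - m)\<^sup>2)" using False by simp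
  also have "\<dots> \<le> (\<Sum>k\<in>I. a k * (v k - m)\<^sup>2)"
    using assms by (intro sum_mono2) auto
  finally show ?thesis .
qed

lemma row_variance_ge_gap:
  fixes v :: "nat \<Rightarrow> real"
  assumes "doubly_stochastic N A" "i \<in> {1..N}" "j \<in> {1..N}" "\<theta> \<le> A i i" "\<theta> \<le> A i j" "0 < \<theta>"
  shows "\<theta> / 2 * (v j - v i)\<^sup>2 \<le> (\<Sum>k=1..N. A i k * (v k - (\<Sum>l=1..N. A i l * v l))\<^sup>2)"
  by (rule weighted_square_ge_gap) (use assms doubly_stochasticD(1)[OF assms(1,2)] in simp_all)

text \<open>For nonnegative increments the Euclidean norm is at most the sum, and the increments
  missing from \<open>D\<close> may be added before telescoping.\<close>

lemma sum_squares_increments_le: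
  fixes x :: "nat \<Rightarrow> real"
  assumes mono: "\<And>d. d \<in> {a..b} \<Longrightarrow> x d \<le> x (Suc d)" and D: "D \<subseteq> {a..b}" "D \<noteq> {}"
  shows "(\<Sum>d\<in>D. (x (Suc d) - x d)\<^sup>2) \<le> (x (Suc b) - x a)\<^sup>2"
proof -
  have "a \<le> b" using D by auto
  have nn: "0 \<le> x (Suc d) - x d" if "d \<in> {a..b}" for d using mono that by simp
  have "sqrt (\<Sum>d\<in>D. (x (Suc d) - x d)\<^sup>2) \<le> (\<Sum>d\<in>D. x (Suc d) - x d)"
    unfolding L2_set_def[symmetric] using nn D by (intro L2_set_le_sum) blast
  also have "\<dots> \<le> (\<Sum>d=a..b. x (Suc d) - x d)"
    using D nn by (intro sum_mono2) auto
  also have "\<dots> = x (Suc b) - x a"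
    using \<open>a \<le> b\<close> by (simp add: sum_Suc_diff)
  finally show ?thesis
    by (metis real_sqrt_le_iff real_sqrt_unique sqrt_le_D)
qed

text \<open>
  Every gap between consecutive initial values is bridged, at the first time at which an edge
  crosses the corresponding cut, by a single row of the current matrix; a row bridging several
  gaps has a variance at least \<open>\<theta> / 2\<close> times the square of their sum.
\<close>

lemma window_gap_drop:
  fixes v :: "nat \<Rightarrow> nat \<Rightarrow> real" and A :: "nat \<Rightarrow> nat \<Rightarrow> nat \<Rightarrow> real"
  assumes ds: "\<And>k. k < B \<Longrightarrow> doubly_stochastic N (A k)"
    and step: "\<And>k i. k < B \<Longrightarrow> i \<in> {1..N} \<Longrightarrow> v (Suc k) i = (\<Sum>j=1..N. A k i j * v k j)"
    and diag: "\<And>k i. k < B \<Longrightarrow> i \<in> {1..N} \<Longrightarrow> \<theta> \<le> A k i i"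
    and lower: "\<And>k i j. k < B \<Longrightarrow> i \<in> {1..N} \<Longrightarrow> j \<in> {1..N} \<Longrightarrow> 0 < A k j i \<Longrightarrow> \<theta> \<le> A k i j"
    and "0 < \<theta>"
    and cross: "\<And>S. S \<subseteq> {1..N} \<Longrightarrow> S \<noteq> {} \<Longrightarrow> S \<noteq> {1..N} \<Longrightarrow>
      \<exists>k<B. \<exists>i\<in>S. \<exists>j\<in>{1..N} - S. 0 < A k i j"
    and s: "sorted_wrt (<) s" "set s = v 0 ` {1..N}"
  shows "\<theta> / 2 * (\<Sum>d<length s - 1. (s ! Suc d - s ! d)\<^sup>2) \<le>
    (\<Sum>i=1..N. (v 0 i)\<^sup>2) - (\<Sum>i=1..N. (v B i)\<^sup>2)"
proof -
  define Drop where "Drop k i = (\<Sum>j=1..N. A k i j * (v k j - (\<Sum>l=1..N. A k i l * v k l))\<^sup>2)" for k i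
  have mono: "s ! d \<le> s ! d'" if "d \<le> d'" "d' < length s" for d d'
    using s(1) that by (simp add: sorted_nth_mono strict_sorted_imp_sorted)
  have ex: "\<exists>k<B. \<exists>i\<in>{1..N}. \<exists>j\<in>{1..N}. 0 < A k i j \<and> v k i \<le> s ! d \<and> s ! Suc d \<le> v k j"
    if d: "d < length s - 1" for d
  proof -
    have d': "Suc d < length s" using d by simp
    have lt: "s ! d < s ! Suc d" using s(1) d by (simp add: sorted_wrt_nth_less)
    \<comment> \<open>The agents below gap \<open>d\<close>. The first time at which an edge leaves
      this set decides which row bridges the gap.\<close>
    define S where "S = {i \<in> {1..N}. v 0 i \<le> s ! d}"
    then have "S \<subseteq> {1..N}" by auto
    have out: "s ! Suc d \<le> v 0 i" if "i \<in> {1..N} - S" for i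
    proof -
      have "v 0 i \<in> set s" using that s by auto
      then obtain e where e: "e < length s" "v 0 i = s ! e" by (auto simp: in_set_conv_nth)
      have "\<not> v 0 i \<le> s ! d" using that by (auto simp: S_def)
      then have "\<not> e \<le> d" using mono[of e d] d' e by auto
      then show ?thesis using mono[of "Suc d" e] e by simp
    qed
    have "s ! d \<in> v 0 ` {1..N}" "s ! Suc d \<in> v 0 ` {1..N}" using d' nth_mem[of d s] nth_mem[of "Suc d" s] s(2) by simp_all
    then obtain p p' where p: "p \<in> {1..N}" "s ! d = v 0 p" "p' \<in> {1..N}" "s ! Suc d = v 0 p'"
      by (elim imageE)
    then have "p \<in> S" "p' \<notin> S" using lt by (auto simp: S_def)
    then have "S \<noteq> {}" "S \<noteq> {1..N}" using p by blast+
    from cross[OF \<open>S \<subseteq> {1..N}\<close> this] have "\<exists>k. k < B \<and> (\<exists>i\<in>S. \<exists>j\<in>{1..N} - S. 0 < A k i j)" .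
    then obtain k where k: "k < B" "\<exists>i\<in>S. \<exists>j\<in>{1..N} - S. 0 < A k i j"
      and least: "\<And>k'. k' < k \<Longrightarrow> \<not> (k' < B \<and> (\<exists>i\<in>S. \<exists>j\<in>{1..N} - S. 0 < A k' i j))"
      using exists_least_iff[of "\<lambda>k. k < B \<and> (\<exists>i\<in>S. \<exists>j\<in>{1..N} - S. 0 < A k i j)"] by blast
    \<comment> \<open>Before the first crossing the matrices decouple along the cut in both
      directions: \<open>lower\<close> turns a positive entry from outside into \<open>S\<close>
      into a positive one from \<open>S\<close> to the outside, which minimality of \<open>k\<close>
      excludes.\<close>
    have zero: "A k' i j = 0" "A k' j i = 0" if "k' < k" "i \<in> S" "j \<in> {1..N} - S" for k' i j
    proof -
      have "i \<in> {1..N}" "j \<in> {1..N}" "k' < B" using that k by (auto simp: S_def)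
      moreover from this have "\<not> 0 < A k' i j" using least that by blast
      moreover from calculation have "\<not> 0 < A k' j i"
        using lower[of k' i j] \<open>0 < \<theta>\<close> by fastforce
      ultimately show "A k' i j = 0" "A k' j i = 0"
        using doubly_stochasticD(1)[OF ds, of k' i j] doubly_stochasticD(1)[OF ds, of k' j i] by auto
    qed
    \<comment> \<open>Up to time \<open>k\<close> each side of the cut averages only its own values,
      so neither side enters the gap.\<close>
    have "(\<forall>i\<in>S. v m i \<le> s ! d) \<and> (\<forall>i\<in>{1..N} - S. s ! Suc d \<le> v m i)" if "m \<le> k" for m
      using that
    proof (induction m)
      case 0
      then show ?case using out by (auto simp: S_def)
    next
      case (Suc m)
      then have m: "m < k" "m < B" using k by auto
      show ?case
      proof (intro conjI ballI)
        fix i assume i: "i \<in> S"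
        then have iN: "i \<in> {1..N}" by (auto simp: S_def)
        have "v (Suc m) i \<le> (\<Sum>j=1..N. A m i j * s ! d)"
          unfolding step[OF m(2) iN]
        proof (rule sum_mono)
          fix j assume j: "j \<in> {1..N}"
          show "A m i j * v m j \<le> A m i j * s ! d"
            using Suc zero(1)[OF m(1) i, of j] j doubly_stochasticD(1)[OF ds[OF m(2)] iN j]
            by (cases "j \<in> S") (auto intro!: mult_left_mono)
        qed
        also have "\<dots> = s ! d"
          using doubly_stochasticD(2)[OF ds[OF m(2)] iN] by (simp flip: sum_distrib_right)
        finally show "v (Suc m) i \<le> s ! d" .
      next
        fix i assume i: "i \<in> {1..N} - S"
        then have iN: "i \<in> {1..N}" by auto
        have "s ! Suc d = (\<Sum>j=1..N. A m i j * s ! Suc d)"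
          using doubly_stochasticD(2)[OF ds[OF m(2)] iN] by (simp flip: sum_distrib_right)
        also have "\<dots> \<le> v (Suc m) i"
          unfolding step[OF m(2) iN]
        proof (rule sum_mono)
          fix j assume j: "j \<in> {1..N}"
          show "A m i j * s ! Suc d \<le> A m i j * v m j"
            using Suc zero(2)[OF m(1) _ i, of j] j doubly_stochasticD(1)[OF ds[OF m(2)] iN j]
            by (cases "j \<in> S") (auto intro!: mult_left_mono)
        qed
        finally show "s ! Suc d \<le> v (Suc m) i" .
      qed
    qed
    from this[of k] have "\<forall>i\<in>S. v k i \<le> s ! d" "\<forall>i\<in>{1..N} - S. s ! Suc d \<le> v k i" by auto
    moreover obtain i j where "i \<in> S" "j \<in> {1..N} - S" "0 < A k i j" using k(2) by blast
    ultimately show ?thesis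
      using k(1) \<open>S \<subseteq> {1..N}\<close> by (intro exI[of _ k] conjI bexI[of _ i] bexI[of _ j]) auto
  qed
  define Q where "Q d p \<longleftrightarrow> (case p of (k, i, j) \<Rightarrow> k < B \<and> i \<in> {1..N} \<and> j \<in> {1..N} \<and>
    0 < A k i j \<and> v k i \<le> s ! d \<and> s ! Suc d \<le> v k j)" for d p
  have Q: "\<exists>p. Q d p" if d: "d < length s - 1" for d
  proof -
    obtain k i j where "k < B" "i \<in> {1..N}" "j \<in> {1..N}" "0 < A k i j" "v k i \<le> s ! d" "s ! Suc d \<le> v k j"
      using ex[OF d] by blast
    then have "Q d (k, i, j)" by (simp add: Q_def)
    then show ?thesis by blast
  qed
  define p where "p d = (SOME p. Q d p)" for d
  have p: "Q d (p d)" if "d < length s - 1" for d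
    unfolding p_def by (rule someI_ex[OF Q[OF that]])
  define K I J where "K d = fst (p d)" and "I d = fst (snd (p d))" and "J d = snd (snd (p d))" for d
  have KIJ: "K d < B" "I d \<in> {1..N}" "J d \<in> {1..N}" "0 < A (K d) (I d) (J d)"
      "v (K d) (I d) \<le> s ! d" "s ! Suc d \<le> v (K d) (J d)" if "d < length s - 1" for d
    using p[OF that] by (simp_all add: Q_def K_def I_def J_def case_prod_beta)
  have group: "(\<Sum>d | d < length s - 1 \<and> (K d, I d) = (k, i). (s ! Suc d - s ! d)\<^sup>2) * (\<theta> / 2) \<le> Drop k i"
    if ki: "k < B" "i \<in> {1..N}" for k i
  proof -
    define D where "D = {d. d < length s - 1 \<and> (K d, I d) = (k, i)}"
    have "(\<Sum>d\<in>D. (s ! Suc d - s ! d)\<^sup>2) * (\<theta> / 2) \<le> Drop k i"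
    proof (cases "D = {}")
      case True
      then show ?thesis
        unfolding Drop_def using doubly_stochasticD(1)[OF ds[OF ki(1)] ki(2)] by (auto intro!: sum_nonneg)
    next
      case False
      have fin: "finite D" by (auto simp: D_def)
      \<comment> \<open>At time \<open>k\<close>, agent \<open>i\<close> sits below the lowest gap
        of its group and its neighbour \<open>J b\<close> above the highest, so this one pair of
        values spans all gaps of the group.\<close>
      define a b where "a = Min D" and "b = Max D"
      have ab: "a \<in> D" "b \<in> D" using fin False by (auto simp: a_def b_def)
      then have ab': "a < length s - 1" "b < length s - 1" "K a = k" "I a = i" "K b = k" "I b = i"
        by (auto simp: D_def)
      have "(\<Sum>d\<in>D. (s ! Suc d - s ! d)\<^sup>2) \<le> (s ! Suc b - s ! a)\<^sup>2"
      proof (rule sum_squares_increments_le)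
        show "D \<subseteq> {a..b}" using fin by (auto simp: a_def b_def)
        show "s ! d \<le> s ! Suc d" if "d \<in> {a..b}" for d
          using that ab' mono[of d "Suc d"] by auto
      qed fact
      also have "\<dots> \<le> (v k (J b) - v k i)\<^sup>2"
      proof (rule power_mono)
        have "a \<le> b" using fin ab by (auto simp: a_def)
        then show "0 \<le> s ! Suc b - s ! a" using mono[of a "Suc b"] ab' by simp
        show "s ! Suc b - s ! a \<le> v k (J b) - v k i"
          using KIJ(6)[OF ab'(2)] KIJ(5)[OF ab'(1)] ab' by simp
      qed
      finally have "(\<Sum>d\<in>D. (s ! Suc d - s ! d)\<^sup>2) * (\<theta> / 2) \<le> \<theta> / 2 * (v k (J b) - v k i)\<^sup>2"
        using \<open>0 < \<theta>\<close> by (simp add: mult.commute)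
      also have "\<dots> \<le> Drop k i"
      proof -
        have J: "J b \<in> {1..N}" "0 < A k i (J b)" using KIJ(3,4)[OF ab'(2)] unfolding ab'(5,6) .
        \<comment> \<open>\<open>lower\<close> reverses the edge. Applying it twice improves mere
          positivity of \<open>A k i (J b)\<close> to the bound \<theta>.\<close>
        have "0 < A k (J b) i"
          using lower[OF ki(1) J(1) ki(2) J(2)] \<open>0 < \<theta>\<close> by (rule less_le_trans[rotated])
        then have "\<theta> \<le> A k i (J b)" by (rule lower[OF ki J(1)])
        then show ?thesis
          unfolding Drop_def by (rule row_variance_ge_gap[OF ds[OF ki(1)] ki(2) J(1) diag[OF ki] _ \<open>0 < \<theta>\<close>])
      qed
      finally show ?thesis .
    qed
    then show ?thesis by (simp add: D_def)
  qed
  have regroup: "(\<Sum>d<length s - 1. (s ! Suc d - s ! d)\<^sup>2) =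
      (\<Sum>p\<in>{..<B} \<times> {1..N}. \<Sum>d\<in>{d \<in> {..<length s - 1}. (K d, I d) = p}. (s ! Suc d - s ! d)\<^sup>2)"
    by (rule sum.group[symmetric]) (use KIJ(1,2) in \<open>simp_all add: image_subset_iff\<close>)
  have "\<theta> / 2 * (\<Sum>d<length s - 1. (s ! Suc d - s ! d)\<^sup>2) \<le> (\<Sum>p\<in>{..<B} \<times> {1..N}. Drop (fst p) (snd p))"
    unfolding regroup mult.commute[of "\<theta> / 2"] sum_distrib_right[of _ _ "\<theta> / 2"]
  proof (rule sum_mono)
    fix p assume "p \<in> {..<B} \<times> {1..N}"
    then have p: "fst p < B" "snd p \<in> {1..N}" by auto
    have "{d \<in> {..<length s - 1}. (K d, I d) = p} = {d. d < length s - 1 \<and> (K d, I d) = (fst p, snd p)}"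
      by simp
    then show "(\<Sum>d\<in>{d \<in> {..<length s - 1}. (K d, I d) = p}. (s ! Suc d - s ! d)\<^sup>2 * (\<theta> / 2)) \<le> Drop (fst p) (snd p)"
      unfolding sum_distrib_right[symmetric] using group[OF p] by (simp only:)
  qed
  also have "\<dots> = (\<Sum>k<B. \<Sum>i=1..N. Drop k i)"
    unfolding sum.cartesian_product case_prod_unfold ..
  also have "\<dots> = (\<Sum>k<B. (\<Sum>i=1..N. (v k i)\<^sup>2) - (\<Sum>i=1..N. (v (Suc k) i)\<^sup>2))"
  proof (rule sum.cong)
    fix k assume "k \<in> {..<B}"
    then have k: "k < B" by simp
    have "(\<Sum>i=1..N. (v (Suc k) i)\<^sup>2) = (\<Sum>i=1..N. (\<Sum>j=1..N. A k i j * v k j)\<^sup>2)"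
      using step[OF k] by (intro sum.cong) auto
    then show "(\<Sum>i=1..N. Drop k i) = (\<Sum>i=1..N. (v k i)\<^sup>2) - (\<Sum>i=1..N. (v (Suc k) i)\<^sup>2)"
      using doubly_stochastic_variance_drop[OF ds[OF k], of "v k"] unfolding Drop_def by simp
  qed simp
  also have "\<dots> = (\<Sum>i=1..N. (v 0 i)\<^sup>2) - (\<Sum>i=1..N. (v B i)\<^sup>2)"
    by (rule sum_lessThan_telescope')
  finally show ?thesis .
qed

text \<open>Mean and initial values lie between the extreme values, so each of the \<open>N\<close>
  squared deviations is at most the squared spread. The spread is a sum of fewer than
  \<open>N\<close> consecutive gaps, and Cauchy-Schwarz costs another factor \<open>N\<close>; the
  squared gaps are controlled by \<open>window_gap_drop\<close>.\<close>

lemma window_variance_contraction: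
  fixes v :: "nat \<Rightarrow> nat \<Rightarrow> real" and A :: "nat \<Rightarrow> nat \<Rightarrow> nat \<Rightarrow> real"
  assumes ds: "\<And>k. k < B \<Longrightarrow> doubly_stochastic N (A k)"
    and step: "\<And>k i. k < B \<Longrightarrow> i \<in> {1..N} \<Longrightarrow> v (Suc k) i = (\<Sum>j=1..N. A k i j * v k j)"
    and diag: "\<And>k i. k < B \<Longrightarrow> i \<in> {1..N} \<Longrightarrow> \<theta> \<le> A k i i"
    and lower: "\<And>k i j. k < B \<Longrightarrow> i \<in> {1..N} \<Longrightarrow> j \<in> {1..N} \<Longrightarrow> 0 < A k j i \<Longrightarrow> \<theta> \<le> A k i j"
    and "0 < \<theta>"
    and cross: "\<And>S. S \<subseteq> {1..N} \<Longrightarrow> S \<noteq> {} \<Longrightarrow> S \<noteq> {1..N} \<Longrightarrow>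
      \<exists>k<B. \<exists>i\<in>S. \<exists>j\<in>{1..N} - S. 0 < A k i j"
    and "1 \<le> N" and m: "m = (\<Sum>i=1..N. v 0 i) / real N"
  shows "(\<Sum>i=1..N. (v B i - m)\<^sup>2) \<le> (1 - \<theta> / (2 * (real N)\<^sup>2)) * (\<Sum>i=1..N. (v 0 i - m)\<^sup>2)"
proof -
  define s where "s = sorted_list_of_set (v 0 ` {1..N})"
  define \<delta> where "\<delta> d = s ! Suc d - s ! d" for d
  have s: "sorted_wrt (<) s" "set s = v 0 ` {1..N}" by (simp_all add: s_def)
  have "v 0 1 \<in> v 0 ` {1..N}" using \<open>1 \<le> N\<close> by auto
  then have pos: "0 < length s" by (metis s(2) length_pos_if_in_set)
  have "length s \<le> N"
    using card_image_le[of "{1..N}" "v 0"] by (simp add: s_def)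
  have avg: "(\<Sum>i=1..N. v k i) = real N * m" if "k \<le> B" for k
    using that
  proof (induction k)
    case 0
    then show ?case using m \<open>1 \<le> N\<close> by simp
  next
    case (Suc k)
    then have "(\<Sum>i=1..N. v (Suc k) i) = (\<Sum>i=1..N. \<Sum>j=1..N. A k i j *\<^sub>R v k j)"
      using step by (intro sum.cong) auto
    then show ?case using Suc sum_doubly_stochastic[OF ds[of k], of "v k"] by simp
  qed
  have var: "(\<Sum>i=1..N. (v k i - m)\<^sup>2) = (\<Sum>i=1..N. (v k i)\<^sup>2) - real N * m\<^sup>2" if "k \<le> B" for k
  proof -
    have "(\<Sum>i=1..N. (v k i - m)\<^sup>2) = (\<Sum>i=1..N. (v k i)\<^sup>2) - 2 * m * (\<Sum>i=1..N. v k i) + (\<Sum>i=1..N. m\<^sup>2)"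
      unfolding sum_distrib_left sum_subtractf[symmetric] sum.distrib[symmetric]
      by (intro sum.cong) (auto simp: power2_eq_square algebra_simps)
    then show ?thesis unfolding avg[OF that] by (simp add: power2_eq_square)
  qed
  define lo hi where "lo = s ! 0" and "hi = s ! (length s - 1)"
  have range: "lo \<le> v 0 i \<and> v 0 i \<le> hi" if "i \<in> {1..N}" for i
  proof -
    have "v 0 i \<in> set s" using that s by auto
    then obtain e where e: "e < length s" "v 0 i = s ! e" by (auto simp: in_set_conv_nth)
    then show ?thesis
      using sorted_nth_mono[OF strict_sorted_imp_sorted[OF s(1)]] pos by (auto simp: lo_def hi_def)
  qed
  have "real N * lo \<le> real N * m" "real N * m \<le> real N * hi"
    using sum_mono[of "{1..N}" "\<lambda>_. lo" "v 0"] sum_mono[of "{1..N}" "v 0" "\<lambda>_. hi"] range avg[of 0]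
    by auto
  then have m_range: "lo \<le> m" "m \<le> hi" using \<open>1 \<le> N\<close> by auto
  have "(\<Sum>i=1..N. (v 0 i - m)\<^sup>2) \<le> (\<Sum>i=1..N. (hi - lo)\<^sup>2)"
  proof (rule sum_mono)
    fix i assume "i \<in> {1..N}"
    then show "(v 0 i - m)\<^sup>2 \<le> (hi - lo)\<^sup>2"
      using range[of i] m_range by (intro power2_le_iff_abs_le[THEN iffD2]) auto
  qed
  also have "\<dots> \<le> real N * ((\<Sum>d<length s - 1. (\<delta> d)\<^sup>2) * real N)"
  proof -
    have "hi - lo = (\<Sum>d<length s - 1. \<delta> d)"
      unfolding \<delta>_def lo_def hi_def by (simp add: sum_lessThan_telescope)
    then have "(hi - lo)\<^sup>2 \<le> (\<Sum>d<length s - 1. (\<delta> d)\<^sup>2) * real (length s - 1)"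
      using sum_squared_le_sum_of_squares[of \<delta> "{..<length s - 1}"] by simp
    also have "\<dots> \<le> (\<Sum>d<length s - 1. (\<delta> d)\<^sup>2) * real N"
      using \<open>length s \<le> N\<close> by (intro mult_left_mono sum_nonneg) auto
    finally show ?thesis by (simp add: mult_left_mono)
  qed
  finally have V: "(\<Sum>i=1..N. (v 0 i - m)\<^sup>2) \<le> (real N)\<^sup>2 * (\<Sum>d<length s - 1. (\<delta> d)\<^sup>2)"
    by (simp add: power2_eq_square mult_ac)
  have "\<theta> / (2 * (real N)\<^sup>2) * (\<Sum>i=1..N. (v 0 i - m)\<^sup>2) \<le>
      \<theta> / (2 * (real N)\<^sup>2) * ((real N)\<^sup>2 * (\<Sum>d<length s - 1. (\<delta> d)\<^sup>2))"
    using V \<open>0 < \<theta>\<close> by (intro mult_left_mono) auto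
  also have "\<dots> = \<theta> / 2 * (\<Sum>d<length s - 1. (\<delta> d)\<^sup>2)" using \<open>1 \<le> N\<close> by simp
  also have "\<dots> \<le> (\<Sum>i=1..N. (v 0 i)\<^sup>2) - (\<Sum>i=1..N. (v B i)\<^sup>2)"
    unfolding \<delta>_def by (rule window_gap_drop[OF ds step diag lower \<open>0 < \<theta>\<close> cross s])
  finally show ?thesis
    using var[of 0] var[of B] by (simp add: algebra_simps)
qed

section \<open>Dispersion of vector-valued configurations\<close>

definition mix :: "nat \<Rightarrow> (nat \<Rightarrow> nat \<Rightarrow> real) \<Rightarrow> (nat \<Rightarrow> 'a::real_vector) \<Rightarrow> nat \<Rightarrow> 'a" where
  "mix N A v i = (\<Sum>j=1..N. A i j *\<^sub>R v j)"

definition average :: "nat \<Rightarrow> (nat \<Rightarrow> 'a::real_vector) \<Rightarrow> 'a" where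
  "average N v = (1 / real N) *\<^sub>R (\<Sum>j=1..N. v j)"

text \<open>A seminorm that, for positive \<open>N\<close>, vanishes exactly at consensus. As a
  seminorm it lets perturbations be treated one by one, and in the Euclidean case its square splits
  into coordinates and so inherits the scalar contraction.\<close>

definition dispersion :: "nat \<Rightarrow> (nat \<Rightarrow> 'a::real_normed_vector) \<Rightarrow> real" where
  "dispersion N v = L2_set (\<lambda>i. norm (v i - average N v)) {1..N}"

lemma mix_add: "mix N A (\<lambda>i. u i + v i) = (\<lambda>i. mix N A u i + mix N A v i)"
  by (simp add: mix_def fun_eq_iff scaleR_add_right sum.distrib)

lemma average_add: "average N (\<lambda>i. u i + v i) = average N u + average N v"
  by (simp add: average_def sum.distrib scaleR_add_right)

lemma average_mix:
  assumes "doubly_stochastic N A"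
  shows "average N (mix N A v) = average N v"
  using sum_doubly_stochastic[OF assms, of v] by (simp add: average_def mix_def)

lemma dispersion_nonneg [simp]: "0 \<le> dispersion N v"
  by (simp add: dispersion_def L2_set_nonneg)

lemma dispersion_add_le: "dispersion N (\<lambda>i. u i + v i) \<le> dispersion N u + dispersion N v"
proof -
  have "dispersion N (\<lambda>i. u i + v i) \<le>
      L2_set (\<lambda>i. norm (u i - average N u) + norm (v i - average N v)) {1..N}"
    unfolding dispersion_def average_add
    by (intro L2_set_mono) (auto simp: add_diff_add norm_triangle_ineq)
  also have "\<dots> \<le> dispersion N u + dispersion N v"
    unfolding dispersion_def by (rule L2_set_triangle_ineq)
  finally show ?thesis .
qed

lemma dispersion_power2:
  fixes v :: "nat \<Rightarrow> 'a::euclidean_space"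
  shows "(dispersion N v)\<^sup>2 = (\<Sum>b\<in>Basis. \<Sum>i=1..N. (v i \<bullet> b - average N v \<bullet> b)\<^sup>2)"
proof -
  have norm2: "(norm x)\<^sup>2 = (\<Sum>b\<in>Basis. (x \<bullet> b)\<^sup>2)" for x :: 'a
    unfolding power2_norm_eq_inner by (subst euclidean_inner) (simp add: power2_eq_square)
  have "(dispersion N v)\<^sup>2 = (\<Sum>i=1..N. (norm (v i - average N v))\<^sup>2)"
    by (simp add: dispersion_def L2_set_def sum_nonneg)
  also have "\<dots> = (\<Sum>i=1..N. \<Sum>b\<in>Basis. (v i \<bullet> b - average N v \<bullet> b)\<^sup>2)"
    by (simp add: norm2 inner_diff_left)
  finally show ?thesis by (simp add: sum.swap[of _ Basis])
qed

text \<open>Centring at the mean does not increase the sum of squared norms, and an L2 norm is at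
  most the L1 norm.\<close>

lemma dispersion_le_sum_norm:
  fixes v :: "nat \<Rightarrow> 'a::real_inner"
  shows "dispersion N v \<le> (\<Sum>i=1..N. norm (v i))"
proof (cases "N = 0")
  case True
  then show ?thesis by (simp add: dispersion_def)
next
  case False
  define m where "m = average N v"
  have m: "(\<Sum>i=1..N. v i) = real N *\<^sub>R m" using False by (simp add: m_def average_def)
  have "(\<Sum>i=1..N. (norm (v i - m))\<^sup>2) =
      (\<Sum>i=1..N. (norm (v i))\<^sup>2) - 2 * ((\<Sum>i=1..N. v i) \<bullet> m) + (\<Sum>i=1..N. m \<bullet> m)"
    unfolding inner_sum_left sum_distrib_left sum_subtractf[symmetric] sum.distrib[symmetric]
    by (intro sum.cong) (auto simp: power2_norm_eq_inner inner_diff inner_commute)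
  then have "(\<Sum>i=1..N. (norm (v i - m))\<^sup>2) \<le> (\<Sum>i=1..N. (norm (v i))\<^sup>2)"
    by (simp add: m[unfolded One_nat_def])
  then have "dispersion N v \<le> L2_set (\<lambda>i. norm (v i)) {1..N}"
    by (simp add: dispersion_def L2_set_def m_def)
  also have "\<dots> \<le> (\<Sum>i=1..N. norm (v i))" by (rule L2_set_le_sum) simp
  finally show ?thesis .
qed

lemma dispersion_le_diameter:
  fixes v :: "nat \<Rightarrow> 'a::real_inner"
  assumes "\<And>i j. i \<in> {1..N} \<Longrightarrow> j \<in> {1..N} \<Longrightarrow> norm (v i - v j) \<le> R"
  shows "dispersion N v \<le> real N * R"
proof -
  have "norm (v i - average N v) \<le> R" if i: "i \<in> {1..N}" for i
  proof -
    have N: "real N \<noteq> 0" using i by auto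
    have "v i - average N v = (1 / real N) *\<^sub>R (\<Sum>j=1..N. v i - v j)"
      using N by (simp add: average_def sum_subtractf scaleR_diff_right sum_constant_scaleR)
    then have "norm (v i - average N v) \<le> (1 / real N) * (\<Sum>j=1..N. norm (v i - v j))"
      by (simp add: norm_sum divide_right_mono)
    also have "\<dots> \<le> (1 / real N) * (\<Sum>j=1..N. R)"
      using assms i by (intro mult_left_mono sum_mono) auto
    finally show ?thesis using N by simp
  qed
  then have "(\<Sum>i=1..N. norm (v i - average N v)) \<le> (\<Sum>i=1..N. R)" by (intro sum_mono)
  then show ?thesis
    unfolding dispersion_def using L2_set_le_sum[of "{1..N}" "\<lambda>i. norm (v i - average N v)"] by simp
qed

lemma norm_diff_le_dispersion:
  assumes "i \<in> {1..N}" "j \<in> {1..N}"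
  shows "norm (v i - v j) \<le> 2 * dispersion N v"
proof -
  have "norm (v k - average N v) \<le> dispersion N v" if "k \<in> {1..N}" for k
    unfolding dispersion_def
    using member_le_L2_set[of "{1..N}" k "\<lambda>i. norm (v i - average N v)"] that by simp
  from this[OF assms(1)] this[OF assms(2)] show ?thesis
    using norm_triangle_ineq4[of "v i - average N v" "v j - average N v"] by simp
qed

text \<open>Mixing keeps the average, so the deviations of every coordinate are mixed by the same
  matrix, and their sum of squares drops by a nonnegative amount.\<close>

lemma dispersion_mix_le:
  fixes v :: "nat \<Rightarrow> 'a::euclidean_space"
  assumes "doubly_stochastic N A"
  shows "dispersion N (mix N A v) \<le> dispersion N v"
proof -
  have "(dispersion N (mix N A v))\<^sup>2 \<le> (dispersion N v)\<^sup>2"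
    unfolding dispersion_power2 average_mix[OF assms]
  proof (rule sum_mono)
    fix b :: 'a assume "b \<in> Basis"
    define w where "w j = v j \<bullet> b - average N v \<bullet> b" for j
    have "mix N A v i \<bullet> b - average N v \<bullet> b = (\<Sum>j=1..N. A i j * w j)" if "i \<in> {1..N}" for i
      using doubly_stochasticD(2)[OF assms that]
      by (simp add: mix_def w_def inner_sum_left right_diff_distrib sum_subtractf flip: sum_distrib_right)
    then have "(\<Sum>i=1..N. (mix N A v i \<bullet> b - average N v \<bullet> b)\<^sup>2) = (\<Sum>i=1..N. (\<Sum>j=1..N. A i j * w j)\<^sup>2)"
      by simp
    also have "\<dots> \<le> (\<Sum>i=1..N. (w i)\<^sup>2)"
      using doubly_stochastic_variance_drop[OF assms, of w] doubly_stochasticD(1)[OF assms]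
      by (smt (verit) mult_nonneg_nonneg sum_nonneg zero_le_power2)
    finally show "(\<Sum>i=1..N. (mix N A v i \<bullet> b - average N v \<bullet> b)\<^sup>2) \<le> (\<Sum>i=1..N. (v i \<bullet> b - average N v \<bullet> b)\<^sup>2)"
      by (simp add: w_def)
  qed
  then show ?thesis by (simp add: power2_le_iff_abs_le)
qed

section \<open>Geometric decay of the dispersion along the network\<close>

primrec evolve :: "nat \<Rightarrow> (nat \<Rightarrow> nat \<Rightarrow> nat \<Rightarrow> real) \<Rightarrow> nat \<Rightarrow> nat \<Rightarrow> (nat \<Rightarrow> 'a::real_vector) \<Rightarrow> nat \<Rightarrow> 'a" where
  "evolve N P a 0 v = v"
| "evolve N P a (Suc m) v = mix N (P (a + m)) (evolve N P a m v)"

lemma evolve_add_steps: "evolve N P a (m + k) v = evolve N P (a + m) k (evolve N P a m v)"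
  by (induction k) (simp_all add: add.assoc)

text \<open>\<open>evolve\<close> applies the matrices from time \<open>a\<close> on with the latest
  one outermost; the perturbed dynamics needs the earliest one split off instead.\<close>

lemma evolve_Suc_left: "evolve N P a (Suc m) v = evolve N P (Suc a) m (mix N (P a) v)"
  using evolve_add_steps[of N P a 1 m v] by simp

lemma evolve_add: "evolve N P a m (\<lambda>i. u i + v i) = (\<lambda>i. evolve N P a m u i + evolve N P a m v i)"
  by (induction m) (simp_all add: mix_add)

lemma dispersion_evolve_le:
  fixes v :: "nat \<Rightarrow> 'a::euclidean_space"
  assumes "\<And>t. doubly_stochastic N (P t)"
  shows "dispersion N (evolve N P a m v) \<le> dispersion N v"
  by (induction m) (auto intro: order_trans[OF dispersion_mix_le] assms)

text \<open>A path from a vertex of \<open>S\<close> to a vertex outside leaves \<open>S\<close>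
  along one of its arcs. The offset \<open>Suc (s * B)\<close> appears because windows start at time
  \<open>s * B + 1\<close>.\<close>

lemma network_crossing:
  assumes net: "network_assumption N P B \<theta>"
    and S: "S \<subseteq> {1..N}" "S \<noteq> {}" "S \<noteq> {1..N}"
  shows "\<exists>k<B. \<exists>i\<in>S. \<exists>j\<in>{1..N} - S. 0 < P (Suc (s * B) + k) i j"
proof -
  define G where "G = with_proj \<lparr>pverts = {1..N}, parcs = (\<Union>t\<in>{s * B + 1..(s + 1) * B}. weight_edges N (P t))\<rparr>"
  have sc: "strongly_connected G" using net by (auto simp: network_assumption_def G_def)
  obtain u w where uw: "u \<in> S" "w \<in> {1..N} - S" using S by blast
  then have "u \<in> verts G" "w \<in> verts G" using S by (auto simp: G_def)
  then have "(u, w) \<in> rtrancl_on (verts G) (arcs_ends G)"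
    using sc by (auto simp: strongly_connected_def reachable_def)
  then have "w \<notin> S \<longrightarrow> (\<exists>(i, j)\<in>arcs_ends G. i \<in> S \<and> j \<in> verts G - S)"
    using uw(1) by (induction) auto
  then obtain i j where ij: "(i, j) \<in> arcs_ends G" "i \<in> S" "j \<in> {1..N} - S"
    using uw by (auto simp: G_def)
  then obtain t where t: "s * B + 1 \<le> t" "t \<le> (s + 1) * B" "0 < P t i j"
    by (auto simp: G_def arcs_ends_def arc_to_ends_def weight_edges_def)
  then show ?thesis
    using ij by (intro exI[of _ "t - Suc (s * B)"] conjI bexI[of _ i] bexI[of _ j]) auto
qed

text \<open>Every coordinate obeys the scalar contraction, so the squared dispersion loses the
  fraction \<open>2 * u\<close> with \<open>u = \<theta> / (4 * N ^ 2)\<close>. By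
  \<open>1 - 2 * u \<le> (1 - u) ^ 2\<close> the dispersion itself loses the fraction
  \<open>u\<close>; this is where the 4 comes from.\<close>

lemma dispersion_window:
  fixes v :: "nat \<Rightarrow> 'a::euclidean_space"
  assumes net: "network_assumption N P B \<theta>" and "1 \<le> N"
  shows "dispersion N (evolve N P (Suc (s * B)) B v) \<le> (1 - \<theta> / (4 * (real N)\<^sup>2)) * dispersion N v"
proof -
  define q where "q = 1 - \<theta> / (4 * (real N)\<^sup>2)"
  have \<theta>: "0 < \<theta>" "\<theta> < 1" using net by (auto simp: network_assumption_def)
  have ds: "doubly_stochastic N (P t)" for t using net by (auto simp: network_assumption_def)
  define u where "u k = evolve N P (Suc (s * B)) k v" for k
  have avg: "average N (u k) = average N v" for k
    by (induction k) (simp_all add: u_def average_mix ds)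
  have "\<theta> / (4 * (real N)\<^sup>2) \<le> 1"
  proof -
    have "\<theta> \<le> 1 * 1" using \<theta> by simp
    also have "\<dots> \<le> 4 * (real N)\<^sup>2" using \<open>1 \<le> N\<close> by (intro mult_mono) auto
    finally show ?thesis using \<open>1 \<le> N\<close> by (simp add: divide_le_eq)
  qed
  then have "0 \<le> q" by (simp add: q_def)
  have "(dispersion N (u B))\<^sup>2 \<le> (1 - \<theta> / (2 * (real N)\<^sup>2)) * (dispersion N (u 0))\<^sup>2"
    unfolding dispersion_power2 sum_distrib_left avg
  proof (subst sum_distrib_left[symmetric], rule sum_mono)
    fix b :: 'a assume "b \<in> Basis"
    show "(\<Sum>i=1..N. (u B i \<bullet> b - average N v \<bullet> b)\<^sup>2) \<le>
        (1 - \<theta> / (2 * (real N)\<^sup>2)) * (\<Sum>i=1..N. (u 0 i \<bullet> b - average N v \<bullet> b)\<^sup>2)"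
    proof (rule window_variance_contraction[where A = "\<lambda>k. P (Suc (s * B) + k)"])
      show "u (Suc k) i \<bullet> b = (\<Sum>j=1..N. P (Suc (s * B) + k) i j * (u k j \<bullet> b))" for k i
        by (simp add: u_def mix_def inner_sum_left)
      show "\<theta> \<le> P (Suc (s * B) + k) i j" if "i \<in> {1..N}" "j \<in> {1..N}" "0 < P (Suc (s * B) + k) j i" for k i j
        using net that by (auto simp: network_assumption_def weight_edges_def)
      show "average N v \<bullet> b = (\<Sum>i=1..N. u 0 i \<bullet> b) / real N"
        by (simp add: average_def u_def inner_sum_left)
    qed (use net ds \<theta> \<open>1 \<le> N\<close> network_crossing[OF net] in \<open>auto simp: network_assumption_def\<close>)
  qed
  also have "\<dots> \<le> q\<^sup>2 * (dispersion N (u 0))\<^sup>2"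
    by (intro mult_right_mono) (auto simp: q_def power2_eq_square algebra_simps)
  finally have "(dispersion N (u B))\<^sup>2 \<le> (q * dispersion N v)\<^sup>2"
    by (simp add: power_mult_distrib u_def)
  then show ?thesis
    using \<open>0 \<le> q\<close> by (simp add: power2_le_iff_abs_le u_def q_def)
qed

lemma dispersion_windows:
  fixes v :: "nat \<Rightarrow> 'a::euclidean_space"
  assumes net: "network_assumption N P B \<theta>" and "1 \<le> N"
    and q: "q = 1 - \<theta> / (4 * (real N)\<^sup>2)" "0 \<le> q"
  shows "dispersion N (evolve N P (Suc (s * B)) (n * B) v) \<le> q ^ n * dispersion N v"
proof (induction n)
  case (Suc n)
  have "dispersion N (evolve N P (Suc (s * B)) (Suc n * B) v) =
      dispersion N (evolve N P (Suc ((s + n) * B)) B (evolve N P (Suc (s * B)) (n * B) v))"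
    using evolve_add_steps[of N P "Suc (s * B)" "n * B" B v] by (simp add: algebra_simps)
  also have "\<dots> \<le> q * dispersion N (evolve N P (Suc (s * B)) (n * B) v)"
    using dispersion_window[OF net \<open>1 \<le> N\<close>] q by simp
  also have "\<dots> \<le> q * (q ^ n * dispersion N v)" using Suc q by (intro mult_left_mono) auto
  finally show ?case by (simp add: mult.assoc)
qed simp

text \<open>
  An interval of \<open>m\<close> times contains at least \<open>m / B - 2\<close> complete windows, whence the
  factor \<open>rate_omega = q powr (- 2)\<close>.
\<close>

lemma dispersion_evolve_rate:
  fixes v :: "nat \<Rightarrow> 'a::euclidean_space"
  assumes net: "network_assumption N P B \<theta>" and "1 \<le> N"
  shows "dispersion N (evolve N P a m v) \<le> rate_omega N \<theta> * rate_gamma N B \<theta> ^ m * dispersion N v"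
proof -
  define q where "q = 1 - \<theta> / (4 * (real N)\<^sup>2)"
  have \<theta>: "0 < \<theta>" "\<theta> < 1" and "1 \<le> B" using net by (auto simp: network_assumption_def)
  have ds: "doubly_stochastic N (P t)" for t using net by (auto simp: network_assumption_def)
  have "1 * 1 \<le> (real N)\<^sup>2" using \<open>1 \<le> N\<close> by simp
  then have "\<theta> < 4 * (real N)\<^sup>2" using \<theta> by linarith
  then have q: "0 < q" "q < 1" using \<theta> \<open>1 \<le> N\<close> by (auto simp: q_def)
  have rate: "rate_omega N \<theta> * rate_gamma N B \<theta> ^ m = q powr (real m / real B - 2)"
  proof -
    have "rate_omega N \<theta> = q powr (- 2)"
      using q by (simp add: rate_omega_def q_def powr_minus powr_numeral inverse_eq_divide)
    moreover have "rate_gamma N B \<theta> ^ m = q powr (real m / real B)"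
    proof -
      have "rate_gamma N B \<theta> ^ m = (q powr (1 / real B)) ^ m" by (simp add: rate_gamma_def q_def)
      also have "\<dots> = q powr (real m * (1 / real B))" using q by (intro powr_power) simp
      finally show ?thesis by simp
    qed
    ultimately show ?thesis using q by (simp flip: powr_add)
  qed
  \<comment> \<open>The first window that starts at time \<open>a\<close> or later, a quotient
    rounded up. For \<open>a = 0\<close> truncated subtraction gives \<open>s = 0\<close>, whose
    window starts at time 1; thus the delay \<open>d\<close> is at most \<open>B\<close> in every
    case.\<close>
  define s where "s = (a - 1 + (B - 1)) div B"
  have "a \<le> Suc (s * B)"
  proof -
    have "a - 1 + (B - 1) < B * Suc s"
      using dividend_less_times_div[of B "a - 1 + (B - 1)"] \<open>1 \<le> B\<close> by (simp add: s_def)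
    then show ?thesis using \<open>1 \<le> B\<close> by (simp add: mult.commute)
  qed
  have sB: "s * B \<le> a - 1 + (B - 1)" by (simp add: s_def)
  define d where "d = Suc (s * B) - a"
  define n where "n = (m - d) div B"
  have "real m / real B - 2 \<le> real n"
  proof -
    have "m - d < B * Suc n"
      using dividend_less_times_div[of B "m - d"] \<open>1 \<le> B\<close> by (simp add: n_def)
    moreover have "d \<le> B"
      using sB \<open>1 \<le> B\<close> by (simp add: d_def)
    ultimately have "m \<le> B * (n + 2)" by simp
    then have "real m \<le> real B * (real n + 2)"
      by (metis of_nat_add of_nat_le_iff of_nat_mult of_nat_numeral)
    then show ?thesis using \<open>1 \<le> B\<close> by (simp add: divide_le_eq algebra_simps)
  qed
  then have pow: "q ^ n \<le> q powr (real m / real B - 2)"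
    using q powr_mono'[of "real m / real B - 2" "real n" q] by (simp add: powr_realpow)
  show ?thesis
  proof (cases "d \<le> m")
    case True
    define k where "k = (m - d) mod B"
    have m: "m = d + (n * B + k)" using True by (simp add: n_def k_def)
    have "a + d = Suc (s * B)" using \<open>a \<le> Suc (s * B)\<close> by (simp add: d_def)
    then have "evolve N P a m v =
        evolve N P (Suc (s * B) + n * B) k (evolve N P (Suc (s * B)) (n * B) (evolve N P a d v))"
      by (simp only: m evolve_add_steps)
    then have "dispersion N (evolve N P a m v) \<le> dispersion N (evolve N P (Suc (s * B)) (n * B) (evolve N P a d v))"
      using dispersion_evolve_le[of N P, OF ds] by simp
    also have "\<dots> \<le> q ^ n * dispersion N (evolve N P a d v)"
      using q by (intro dispersion_windows[OF net \<open>1 \<le> N\<close>]) (auto simp: q_def)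
    also have "\<dots> \<le> q powr (real m / real B - 2) * dispersion N v"
      using pow q by (intro mult_mono dispersion_evolve_le ds) auto
    finally show ?thesis by (simp add: rate)
  next
    case False
    \<comment> \<open>No window can even start within the \<open>m\<close> steps, so
      \<open>n = 0\<close>, and \<open>pow\<close> shows that the claimed factor is at least
      1.\<close>
    then have "1 \<le> q powr (real m / real B - 2)" using pow by (simp add: n_def)
    then have "1 * dispersion N v \<le> q powr (real m / real B - 2) * dispersion N v"
      by (intro mult_right_mono) auto
    then show ?thesis
      using dispersion_evolve_le[of N P a m v, OF ds] by (simp add: rate)
  qed
qed

lemma rate_gamma_omega:
  assumes net: "network_assumption N P B \<theta>" and "1 \<le> N"
  shows "0 < rate_gamma N B \<theta>" "rate_gamma N B \<theta> < 1" "0 < rate_omega N \<theta>"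
proof -
  have \<theta>: "0 < \<theta>" "\<theta> < 1" and "1 \<le> B" using net by (auto simp: network_assumption_def)
  have "1 * 1 \<le> (real N)\<^sup>2" using \<open>1 \<le> N\<close> by simp
  then have "\<theta> < 4 * (real N)\<^sup>2" using \<theta> by linarith
  then have "0 < 1 - \<theta> / (4 * (real N)\<^sup>2)" "1 - \<theta> / (4 * (real N)\<^sup>2) < 1" using \<theta> \<open>1 \<le> N\<close> by auto
  then show "0 < rate_gamma N B \<theta>" "rate_gamma N B \<theta> < 1" "0 < rate_omega N \<theta>"
    using \<open>1 \<le> B\<close> powr_less_mono2[of "1 / real B" "1 - \<theta> / (4 * (real N)\<^sup>2)" 1]
    by (auto simp: rate_gamma_def rate_omega_def)
qed

text \<open>Each perturbation decays geometrically from the time at which it enters, so its total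
  contribution over all later times is a geometric series. The scalar recursion \<open>h\<close>
  majorizes the superposition of these decaying contributions.\<close>

lemma sum_dispersion_perturbed_le:
  fixes v e :: "nat \<Rightarrow> nat \<Rightarrow> 'a::euclidean_space"
  assumes net: "network_assumption N P B \<theta>" and "1 \<le> N"
    and step: "\<And>t i. a \<le> t \<Longrightarrow> v (Suc t) = (\<lambda>i. mix N (P t) (v t) i + e t i)"
  shows "(\<Sum>t\<in>{a..<b}. dispersion N (v t)) \<le>
    rate_omega N \<theta> / (1 - rate_gamma N B \<theta>) * (dispersion N (v a) + (\<Sum>t\<in>{a..<b}. dispersion N (e t)))"
proof -
  define \<omega> \<gamma> where "\<omega> = rate_omega N \<theta>" and "\<gamma> = rate_gamma N B \<theta>"
  have \<gamma>: "0 < \<gamma>" "\<gamma> < 1" and "0 < \<omega>" using rate_gamma_omega[OF net \<open>1 \<le> N\<close>] by (auto simp: \<omega>_def \<gamma>_def)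
  define h where "h = rec_nat (\<omega> * dispersion N (v a)) (\<lambda>k r. \<gamma> * r + \<omega> * dispersion N (e (a + k)))"
  have h: "h 0 = \<omega> * dispersion N (v a)" "h (Suc k) = \<gamma> * h k + \<omega> * dispersion N (e (a + k))" for k
    by (simp_all add: h_def)
  \<comment> \<open>The claim covers all further noise-free steps \<open>m\<close> at once: the
    factor \<omega> is then paid once per perturbation, whereas an induction over single steps would
    pay it at every time.\<close>
  have bound: "dispersion N (evolve N P (a + k) m (v (a + k))) \<le> \<gamma> ^ m * h k" for k m
  proof (induction k arbitrary: m)
    case 0
    show ?case using dispersion_evolve_rate[OF net \<open>1 \<le> N\<close>, of a m "v a"] by (simp add: h \<omega>_def \<gamma>_def mult_ac)
  next
    case (Suc k)
    have "dispersion N (evolve N P (a + Suc k) m (v (a + Suc k))) \<le>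
        dispersion N (evolve N P (a + k) (Suc m) (v (a + k))) + dispersion N (evolve N P (Suc (a + k)) m (e (a + k)))"
      unfolding evolve_Suc_left using dispersion_add_le by (simp add: step evolve_add)
    also have "\<dots> \<le> \<gamma> ^ Suc m * h k + \<omega> * \<gamma> ^ m * dispersion N (e (a + k))"
      unfolding \<omega>_def \<gamma>_def
      by (intro add_mono Suc[unfolded \<gamma>_def] dispersion_evolve_rate[OF net \<open>1 \<le> N\<close>])
    finally show ?case by (simp add: h algebra_simps)
  qed
  have h_nonneg: "0 \<le> h k" for k
    using \<gamma> \<open>0 < \<omega>\<close> by (induction k) (simp_all add: h)
  have sum_h: "(1 - \<gamma>) * (\<Sum>k<n. h k) \<le> \<omega> * (dispersion N (v a) + (\<Sum>k<n. dispersion N (e (a + k))))" for n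
  proof -
    have "(1 - \<gamma>) * (\<Sum>k<n. h k) + h n = \<omega> * (dispersion N (v a) + (\<Sum>k<n. dispersion N (e (a + k))))"
    proof (induction n)
      case (Suc n)
      have "(1 - \<gamma>) * (\<Sum>k<Suc n. h k) + h (Suc n) =
          ((1 - \<gamma>) * (\<Sum>k<n. h k) + h n) + \<omega> * dispersion N (e (a + n))"
        by (simp add: h algebra_simps)
      then show ?case unfolding Suc by (simp add: algebra_simps)
    qed (simp add: h)
    then show ?thesis using h_nonneg[of n] by linarith
  qed
  have shift: "(\<Sum>t\<in>{a..<b}. f t) = (\<Sum>k<b - a. f (a + k))" for f :: "nat \<Rightarrow> real"
    by (rule sum.reindex_bij_witness[of _ "\<lambda>k. a + k" "\<lambda>t. t - a"]) auto
  have "(\<Sum>t\<in>{a..<b}. dispersion N (v t)) \<le> (\<Sum>k<b - a. h k)"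
    unfolding shift using bound[of _ 0] by (intro sum_mono) auto
  also have "\<dots> \<le> \<omega> / (1 - \<gamma>) * (dispersion N (v a) + (\<Sum>k<b - a. dispersion N (e (a + k))))"
    using sum_h[of "b - a"] \<gamma> by (simp add: pos_le_divide_eq mult.commute)
  finally show ?thesis by (simp add: shift \<omega>_def \<gamma>_def)
qed

section \<open>Convex functions and the mirror step\<close>

text \<open>The strict epigraph, shifted so that the graph point over \<open>x\<close> becomes the
  origin, is convex and misses the origin. The normal of a separating hyperplane yields the
  subgradient.\<close>

lemma subdifferential_nonempty:
  fixes f :: "'a::euclidean_space \<Rightarrow> real"
  assumes "convex_on UNIV f"
  shows "\<exists>g. g \<in> subdifferential f x"
proof -
  define T where "T = {p :: 'a \<times> real. f (x + fst p) < f x + snd p}"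
  have "convex T"
  proof (rule convexI)
    fix p q :: "'a \<times> real" and u v :: real
    assume pq: "p \<in> T" "q \<in> T" and uv: "0 \<le> u" "0 \<le> v" "u + v = 1"
    have "x + fst (u *\<^sub>R p + v *\<^sub>R q) = u *\<^sub>R (x + fst p) + v *\<^sub>R (x + fst q)"
      using uv(3) by (simp add: algebra_simps flip: scaleR_add_left)
    then have "f (x + fst (u *\<^sub>R p + v *\<^sub>R q)) \<le> u * f (x + fst p) + v * f (x + fst q)"
      using assms uv by (simp add: convex_on_def)
    also have "\<dots> < u * (f x + snd p) + v * (f x + snd q)"
    proof (cases "u = 0")
      case True
      then show ?thesis using pq uv by (simp add: T_def)
    next
      case False
      then show ?thesis
        using pq uv by (intro add_less_le_mono mult_strict_left_mono mult_left_mono) (auto simp: T_def)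
    qed
    also have "\<dots> = (u + v) * f x + snd (u *\<^sub>R p + v *\<^sub>R q)" by (simp add: algebra_simps)
    finally show "u *\<^sub>R p + v *\<^sub>R q \<in> T" using uv by (simp add: T_def)
  qed
  moreover have "0 \<notin> T" by (simp add: T_def)
  ultimately have "\<exists>c. c \<noteq> 0 \<and> (\<forall>p\<in>T. 0 \<le> c \<bullet> p)" by (rule separating_hyperplane_set_0)
  then obtain c where c: "c \<noteq> 0" "\<And>p. p \<in> T \<Longrightarrow> 0 \<le> c \<bullet> p" by blast
  obtain a b where ab: "c = (a, b)" by (cases c)
  have sep: "0 \<le> a \<bullet> z + b * s" if "f (x + z) - f x < s" for z s
    using c(2)[of "(z, s)"] that by (simp add: T_def ab inner_prod_def)
  have "0 \<le> b" using sep[of 0 1] by simp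
  \<comment> \<open>A vertical hyperplane is impossible because \<open>f\<close> is finite at
    \<open>x - a\<close>, so that the epigraph also has points in the direction
    \<open>- a\<close>.\<close>
  moreover have "b \<noteq> 0"
  proof
    assume "b = 0"
    then have "0 \<le> a \<bullet> (- a)" using sep[of "- a" "f (x - a) - f x + 1"] by simp
    then show False using c(1) ab \<open>b = 0\<close> inner_gt_zero_iff[of a] by (simp add: zero_prod_def del: inner_gt_zero_iff)
  qed
  ultimately have "0 < b" by simp
  have "f x + (- (1 / b) *\<^sub>R a) \<bullet> (y - x) \<le> f y" for y
  proof -
    \<comment> \<open>Separation is available strictly above the graph only; the graph itself is
      reached by letting \<open>s\<close> decrease to \<open>f y - f x\<close>.\<close>
    have "- (a \<bullet> (y - x)) / b \<le> f y - f x"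
    proof (rule dense_ge)
      fix s assume "f y - f x < s"
      then have "0 \<le> a \<bullet> (y - x) + b * s" using sep[of "y - x" s] by simp
      then have "- (a \<bullet> (y - x)) \<le> s * b" by (simp add: mult.commute)
      then show "- (a \<bullet> (y - x)) / b \<le> s" using \<open>0 < b\<close> by (simp only: pos_divide_le_eq)
    qed
    then show ?thesis by simp
  qed
  then have "- (1 / b) *\<^sub>R a \<in> subdifferential f x" unfolding subdifferential_def by blast
  then show ?thesis ..
qed

text \<open>Moving a unit distance along a subgradient increases \<open>f\<close> by at least the
  norm of the subgradient, while \<open>f\<close> is bounded on the closed unit neighbourhood of
  \<open>X\<close>.\<close>

lemma subdifferential_bounded:
  fixes f :: "'a::euclidean_space \<Rightarrow> real"
  assumes "convex_on UNIV f" "compact X"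
  shows "\<exists>C. \<forall>x\<in>X. \<forall>g\<in>subdifferential f x. norm g \<le> C"
proof -
  define K where "K = {u + v | u v. u \<in> X \<and> v \<in> cball 0 1}"
  have "compact K" unfolding K_def by (intro compact_sums assms compact_cball)
  moreover have "continuous_on K f"
    using convex_on_continuous[OF open_UNIV assms(1)] continuous_on_subset by blast
  ultimately have "bounded (f ` K)" by (intro compact_imp_bounded compact_continuous_image)
  then obtain C where C: "\<And>z. z \<in> K \<Longrightarrow> \<bar>f z\<bar> \<le> C" by (auto simp: bounded_iff)
  have "norm g \<le> 2 * C" if "x \<in> X" "g \<in> subdifferential f x" for x g
  proof -
    have xK: "x \<in> K" using that by (force simp: K_def)
    have yK: "x + sgn g \<in> K" unfolding K_def mem_Collect_eq
      by (rule exI[of _ x], rule exI[of _ "sgn g"]) (use that in \<open>simp add: norm_sgn\<close>)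
    have "f x + g \<bullet> (x + sgn g - x) \<le> f (x + sgn g)"
      using that by (simp only: subdifferential_def mem_Collect_eq)
    moreover have "g \<bullet> sgn g = norm g"
      by (cases "g = 0") (simp_all add: sgn_div_norm power2_norm_eq_inner[symmetric] power2_eq_square)
    ultimately show ?thesis using C[OF xK] C[OF yK] by (simp add: abs_le_iff)
  qed
  then show ?thesis by blast
qed

text \<open>A real \<open>Sup\<close> bounds the elements of a set only if the set is bounded above,
  which compactness of \<open>X\<close> provides.\<close>

lemma norm_subgradient_le_max:
  fixes chi :: "nat \<Rightarrow> 'a::euclidean_space \<Rightarrow> real"
  assumes "i \<in> {1..N}" "convex_on UNIV (chi i)" "compact X" "x \<in> X" "g \<in> subdifferential (chi i) x"
  shows "norm g \<le> max_subgrad_norm N X chi"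
proof -
  let ?S = "\<lambda>i. {norm g | g x. x \<in> X \<and> g \<in> subdifferential (chi i) x}"
  obtain C where "\<And>x g. x \<in> X \<Longrightarrow> g \<in> subdifferential (chi i) x \<Longrightarrow> norm g \<le> C"
    using subdifferential_bounded[OF assms(2,3)] by blast
  then have bdd: "bdd_above (?S i)" by (intro bdd_aboveI[of _ C]) blast
  have "norm g \<in> ?S i" using assms(4,5) by blast
  then have "norm g \<le> Sup (?S i)" using bdd by (rule cSup_upper)
  also have "\<dots> \<le> max_subgrad_norm N X chi"
    unfolding max_subgrad_norm_def using assms(1) by (intro Max_ge) auto
  finally show ?thesis .
qed

text \<open>The estimate is one-sided: the subgradient is taken at \<open>u\<close>, so
  \<open>v\<close> may lie outside \<open>X\<close>.\<close>

lemma max_subgrad_norm_lipschitz: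
  fixes chi :: "nat \<Rightarrow> 'a::euclidean_space \<Rightarrow> real"
  assumes "i \<in> {1..N}" "convex_on UNIV (chi i)" "compact X" "u \<in> X"
  shows "chi i u - chi i v \<le> max_subgrad_norm N X chi * norm (u - v)"
    and "0 \<le> max_subgrad_norm N X chi"
proof -
  obtain g where g: "g \<in> subdifferential (chi i) u" using subdifferential_nonempty[OF assms(2)] by blast
  have "norm g \<le> max_subgrad_norm N X chi" using norm_subgradient_le_max[of i N chi X u g] assms g by blast
  then show "0 \<le> max_subgrad_norm N X chi" using norm_ge_zero order_trans by blast
  have "chi i v \<ge> chi i u + g \<bullet> (v - u)" using g by (simp add: subdifferential_def)
  then have "chi i u - chi i v \<le> g \<bullet> (u - v)" by (simp add: inner_diff_right)
  also have "\<dots> \<le> norm g * norm (u - v)" by (rule norm_cauchy_schwarz)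
  also have "\<dots> \<le> max_subgrad_norm N X chi * norm (u - v)" by (intro mult_right_mono norm_ge_zero) fact
  finally show "chi i u - chi i v \<le> max_subgrad_norm N X chi * norm (u - v)" .
qed

section \<open>Bregman divergences\<close>

lemma mirror_mapD:
  assumes "mirror_map \<Phi> \<Phi>' \<sigma>"
  shows "0 < \<sigma>" "continuous_on A \<Phi>'" "continuous_on A \<Phi>"
    and "\<sigma> / 2 * (norm (x - y))\<^sup>2 \<le> bregman \<Phi> \<Phi>' x y" "0 \<le> bregman \<Phi> \<Phi>' x y"
proof -
  have *: "\<And>x. (\<Phi> has_derivative (\<lambda>h. h \<bullet> \<Phi>' x)) (at x)" "continuous_on UNIV \<Phi>'" "0 < \<sigma>"
    "\<And>x y. \<Phi> x \<ge> \<Phi> y + \<Phi>' y \<bullet> (x - y) + \<sigma> / 2 * (norm (x - y))\<^sup>2"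
    using assms by (auto simp: mirror_map_def gderiv_def)
  show "0 < \<sigma>" by fact
  show "continuous_on A \<Phi>'" using *(2) continuous_on_subset by blast
  show "continuous_on A \<Phi>"
    using *(1) by (intro has_derivative_continuous_on) (blast intro: has_derivative_at_withinI)
  show strong: "\<sigma> / 2 * (norm (x - y))\<^sup>2 \<le> bregman \<Phi> \<Phi>' x y"
    using *(4)[of y x] by (simp add: bregman_def)
  have "0 \<le> \<sigma> / 2 * (norm (x - y))\<^sup>2" using *(3) by simp
  with strong show "0 \<le> bregman \<Phi> \<Phi>' x y" by linarith
qed

lemma bregman_three_point:
  "(\<Phi>' p - \<Phi>' y) \<bullet> (z - p) = bregman \<Phi> \<Phi>' z y - bregman \<Phi> \<Phi>' z p - bregman \<Phi> \<Phi>' p y"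
  by (simp add: bregman_def inner_diff_left inner_diff_right algebra_simps)

text \<open>Adding the reversed divergence, which is nonnegative, produces a plain inner product.
  The constant \<open>L\<close>, twice the one that integration along the segment would give, is the
  one in \<open>C6\<close>.\<close>

lemma bregman_le_lipschitz:
  assumes "mirror_map \<Phi> \<Phi>' \<sigma>" "\<And>x y. norm (\<Phi>' x - \<Phi>' y) \<le> L * norm (x - y)"
  shows "bregman \<Phi> \<Phi>' x y \<le> L * (norm (x - y))\<^sup>2"
proof -
  have "bregman \<Phi> \<Phi>' x y \<le> bregman \<Phi> \<Phi>' x y + bregman \<Phi> \<Phi>' y x"
    using mirror_mapD(5)[OF assms(1)] by simp
  also have "\<dots> = (\<Phi>' x - \<Phi>' y) \<bullet> (x - y)"
    by (simp add: bregman_def inner_diff_left inner_diff_right algebra_simps)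
  also have "\<dots> \<le> norm (\<Phi>' x - \<Phi>' y) * norm (x - y)" by (rule norm_cauchy_schwarz)
  also have "\<dots> \<le> L * norm (x - y) * norm (x - y)" by (intro mult_right_mono assms) simp
  finally show ?thesis by (simp add: power2_eq_square mult.assoc)
qed

text \<open>The three-point identity at \<open>b\<close> separates a linear from a quadratic effect
  of \<open>h\<close>; with \<open>h\<close> the scaled noise, the linear part leads to
  \<open>C5\<close> and the quadratic part to \<open>C6\<close>.\<close>

lemma bregman_perturb_le:
  assumes "mirror_map \<Phi> \<Phi>' \<sigma>" "\<And>x y. norm (\<Phi>' x - \<Phi>' y) \<le> L * norm (x - y)"
  shows "bregman \<Phi> \<Phi>' a (b + h) \<le>
    bregman \<Phi> \<Phi>' a b + L * norm h * norm (a - b) + L * (norm h)\<^sup>2"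
proof -
  have "bregman \<Phi> \<Phi>' a (b + h) = bregman \<Phi> \<Phi>' a b + bregman \<Phi> \<Phi>' b (b + h) + (\<Phi>' b - \<Phi>' (b + h)) \<bullet> (a - b)"
    by (simp add: bregman_def inner_diff_left inner_diff_right inner_add_right algebra_simps)
  moreover have "(\<Phi>' b - \<Phi>' (b + h)) \<bullet> (a - b) \<le> L * norm h * norm (a - b)"
  proof -
    have "(\<Phi>' b - \<Phi>' (b + h)) \<bullet> (a - b) \<le> norm (\<Phi>' b - \<Phi>' (b + h)) * norm (a - b)"
      by (rule norm_cauchy_schwarz)
    also have "\<dots> \<le> L * norm (b - (b + h)) * norm (a - b)" by (intro mult_right_mono assms) simp
    finally show ?thesis by simp
  qed
  moreover have "bregman \<Phi> \<Phi>' b (b + h) \<le> L * (norm h)\<^sup>2"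
    using bregman_le_lipschitz[OF assms, of b "b + h"] by simp
  ultimately show ?thesis by simp
qed

text \<open>Continuity and compactness make the supremum finite, so that it is an upper bound;
  strong convexity then converts divergence into distance, whence the factor
  \<open>sqrt (2 / \<sigma>)\<close> in \<open>C5\<close>.\<close>

lemma bregman_diam:
  fixes \<Phi> :: "'a::euclidean_space \<Rightarrow> real"
  assumes "mirror_map \<Phi> \<Phi>' \<sigma>" "compact X" "u \<in> X" "v \<in> X"
  shows "bregman \<Phi> \<Phi>' u v \<le> (bregman_diam \<Phi> \<Phi>' X)\<^sup>2" "0 \<le> bregman_diam \<Phi> \<Phi>' X"
    and "norm (u - v) \<le> sqrt (2 / \<sigma>) * bregman_diam \<Phi> \<Phi>' X"
proof -
  define d where "d p = bregman \<Phi> \<Phi>' (fst p) (snd p)" for p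
  have "continuous_on (X \<times> X) (\<lambda>p. \<Phi> (fst p))"
    by (rule continuous_on_compose2[OF mirror_mapD(3)[OF assms(1), of UNIV]]) (intro continuous_intros, simp)
  moreover have "continuous_on (X \<times> X) (\<lambda>p. \<Phi> (snd p))"
    by (rule continuous_on_compose2[OF mirror_mapD(3)[OF assms(1), of UNIV]]) (intro continuous_intros, simp)
  moreover have "continuous_on (X \<times> X) (\<lambda>p. \<Phi>' (snd p))"
    by (rule continuous_on_compose2[OF mirror_mapD(2)[OF assms(1), of UNIV]]) (intro continuous_intros, simp)
  ultimately have "continuous_on (X \<times> X) d"
    unfolding d_def bregman_def by (intro continuous_intros)
  then have "compact (d ` (X \<times> X))"
    by (rule compact_continuous_image) (intro compact_Times assms)
  then have bdd: "bdd_above (d ` (X \<times> X))" by (intro bounded_imp_bdd_above compact_imp_bounded)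
  have diam: "bregman_diam \<Phi> \<Phi>' X = sqrt (Sup (d ` (X \<times> X)))"
    by (simp add: bregman_diam_def d_def case_prod_unfold)
  have "d (u, v) \<in> d ` (X \<times> X)" using assms by (intro imageI) simp
  then have "d (u, v) \<le> Sup (d ` (X \<times> X))" using bdd by (rule cSup_upper)
  then have le: "bregman \<Phi> \<Phi>' u v \<le> Sup (d ` (X \<times> X))" by (simp add: d_def)
  then have nonneg: "0 \<le> Sup (d ` (X \<times> X))"
    using mirror_mapD(5)[OF assms(1), of u v] by linarith
  then have "(bregman_diam \<Phi> \<Phi>' X)\<^sup>2 = Sup (d ` (X \<times> X))" unfolding diam by (rule real_sqrt_pow2)
  then show sq: "bregman \<Phi> \<Phi>' u v \<le> (bregman_diam \<Phi> \<Phi>' X)\<^sup>2" using le by (simp only:)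
  show diam_nonneg: "0 \<le> bregman_diam \<Phi> \<Phi>' X" unfolding diam using nonneg by (rule real_sqrt_ge_zero)
  have "0 < \<sigma>" using mirror_mapD(1)[OF assms(1)] .
  have "\<sigma> / 2 * (norm (u - v))\<^sup>2 \<le> (bregman_diam \<Phi> \<Phi>' X)\<^sup>2"
    using mirror_mapD(4)[OF assms(1), of u v] sq by linarith
  then have "2 / \<sigma> * (\<sigma> / 2 * (norm (u - v))\<^sup>2) \<le> 2 / \<sigma> * (bregman_diam \<Phi> \<Phi>' X)\<^sup>2"
    using \<open>0 < \<sigma>\<close> by (intro mult_left_mono) simp_all
  also have "2 / \<sigma> * (\<sigma> / 2 * (norm (u - v))\<^sup>2) = (norm (u - v))\<^sup>2" using \<open>0 < \<sigma>\<close> by simp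
  also have "2 / \<sigma> * (bregman_diam \<Phi> \<Phi>' X)\<^sup>2 = (sqrt (2 / \<sigma>) * bregman_diam \<Phi> \<Phi>' X)\<^sup>2"
    using \<open>0 < \<sigma>\<close> by (simp add: power_mult_distrib)
  finally show "norm (u - v) \<le> sqrt (2 / \<sigma>) * bregman_diam \<Phi> \<Phi>' X"
    by (rule power2_le_imp_le) (use diam_nonneg \<open>0 < \<sigma>\<close> in simp)
qed

text \<open>
  The first-order optimality condition, obtained by comparing the minimizer with nearby points of
  the segment towards \<open>z\<close>; no subgradient of \<open>h\<close> has to be selected.
\<close>

lemma prox_optimality:
  fixes h :: "'a::euclidean_space \<Rightarrow> real"
  assumes \<Phi>: "mirror_map \<Phi> \<Phi>' \<sigma>" and L: "\<And>x y. norm (\<Phi>' x - \<Phi>' y) \<le> L * norm (x - y)"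
    and "convex X" "convex_on UNIV h" "0 < a"
    and p: "is_arg_min (\<lambda>z. g \<bullet> z + 1 / a * bregman \<Phi> \<Phi>' z y + h z) (\<lambda>z. z \<in> X) p"
    and "z \<in> X"
  shows "a * (g \<bullet> (p - z) + h p - h z) \<le> (\<Phi>' p - \<Phi>' y) \<bullet> (z - p)"
proof -
  have "p \<in> X" using p by (simp add: is_arg_min_def)
  define b where "b = a * (g \<bullet> (p - z) + h p - h z) - (\<Phi>' p - \<Phi>' y) \<bullet> (z - p)"
  have main: "b \<le> s * (L * (norm (z - p))\<^sup>2)" if s: "0 < s" "s \<le> 1" for s
  proof -
    define w where "w = p + s *\<^sub>R (z - p)"
    have w: "w = (1 - s) *\<^sub>R p + s *\<^sub>R z" by (simp add: w_def algebra_simps)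
    have "w \<in> X"
      unfolding w using \<open>convex X\<close> \<open>p \<in> X\<close> \<open>z \<in> X\<close> s by (intro convexD) auto
    then have "g \<bullet> p + 1 / a * bregman \<Phi> \<Phi>' p y + h p \<le> g \<bullet> w + 1 / a * bregman \<Phi> \<Phi>' w y + h w"
      using p by (auto simp: is_arg_min_def not_less)
    then have "a * (g \<bullet> p + 1 / a * bregman \<Phi> \<Phi>' p y + h p) \<le> a * (g \<bullet> w + 1 / a * bregman \<Phi> \<Phi>' w y + h w)"
      using \<open>0 < a\<close> by simp
    then have 1: "a * (g \<bullet> p + h p) + bregman \<Phi> \<Phi>' p y \<le> a * (g \<bullet> w + h w) + bregman \<Phi> \<Phi>' w y"
      using \<open>0 < a\<close> by (simp add: algebra_simps)
    have "h w \<le> (1 - s) * h p + s * h z"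
      unfolding w using \<open>convex_on UNIV h\<close> s by (simp add: convex_on_def)
    then have 2: "a * h w \<le> a * ((1 - s) * h p + s * h z)" using \<open>0 < a\<close> by simp
    \<comment> \<open>The divergence of \<open>p\<close> from \<open>w\<close> is dropped, and the
      remaining gradient difference is split at \<open>p\<close>: the part between \<open>w\<close>
      and \<open>p\<close> is of order \<open>s\<close> by the Lipschitz bound and disappears in the
      limit.\<close>
    have "bregman \<Phi> \<Phi>' w y - bregman \<Phi> \<Phi>' p y = (\<Phi>' w - \<Phi>' y) \<bullet> (w - p) - bregman \<Phi> \<Phi>' p w"
      by (simp add: bregman_def inner_diff_left inner_diff_right algebra_simps)
    also have "\<dots> \<le> (\<Phi>' w - \<Phi>' y) \<bullet> (w - p)" using mirror_mapD(5)[OF \<Phi>] by simp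
    also have "\<dots> = s * ((\<Phi>' w - \<Phi>' p) \<bullet> (z - p) + (\<Phi>' p - \<Phi>' y) \<bullet> (z - p))"
      by (simp add: w_def inner_diff_left algebra_simps)
    finally have 3: "bregman \<Phi> \<Phi>' w y - bregman \<Phi> \<Phi>' p y \<le>
      s * ((\<Phi>' w - \<Phi>' p) \<bullet> (z - p) + (\<Phi>' p - \<Phi>' y) \<bullet> (z - p))" .
    have "a * (g \<bullet> w) = a * (g \<bullet> p - s * (g \<bullet> (p - z)))"
      by (simp add: w_def inner_diff_right inner_add_right algebra_simps)
    then have "s * (a * (g \<bullet> (p - z) + h p - h z)) \<le>
        s * ((\<Phi>' w - \<Phi>' p) \<bullet> (z - p) + (\<Phi>' p - \<Phi>' y) \<bullet> (z - p))"
      using 1 2 3 by (simp add: algebra_simps)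
    then have "b \<le> (\<Phi>' w - \<Phi>' p) \<bullet> (z - p)" using s by (simp add: b_def)
    also have "\<dots> \<le> norm (\<Phi>' w - \<Phi>' p) * norm (z - p)" by (rule norm_cauchy_schwarz)
    also have "\<dots> \<le> L * norm (w - p) * norm (z - p)" by (intro mult_right_mono L) simp
    finally show ?thesis using s by (simp add: w_def power2_eq_square mult_ac)
  qed
  have "((\<lambda>s. s * (L * (norm (z - p))\<^sup>2)) \<longlongrightarrow> 0 * (L * (norm (z - p))\<^sup>2)) (at_right 0)"
    by (intro tendsto_intros)
  moreover have "\<forall>\<^sub>F s in at_right (0::real). b \<le> s * (L * (norm (z - p))\<^sup>2)"
    unfolding eventually_at_right_field using main by (intro exI[of _ 1]) auto
  ultimately have "b \<le> 0"
    using tendsto_lowerbound[of _ "0 * (L * (norm (z - p))\<^sup>2)" "at_right (0::real)" b] by simp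
  then show ?thesis by (simp add: b_def)
qed

text \<open>Strong convexity bounds the symmetrized divergence of \<open>p\<close> and
  \<open>z\<close> below by \<open>\<sigma> * norm (p - z) ^ 2\<close>. The optimality condition
  bounds it above; it concerns the centre \<open>y\<close>, and replacing \<Phi>' at
  \<open>y\<close> by \<Phi>' at \<open>z\<close> costs the term with \<open>L\<close>.\<close>

lemma prox_displacement_le:
  fixes h :: "'a::euclidean_space \<Rightarrow> real"
  assumes \<Phi>: "mirror_map \<Phi> \<Phi>' \<sigma>" and L: "\<And>x y. norm (\<Phi>' x - \<Phi>' y) \<le> L * norm (x - y)"
    and "convex X" "convex_on UNIV h" "0 < a"
    and p: "is_arg_min (\<lambda>z. g \<bullet> z + 1 / a * bregman \<Phi> \<Phi>' z y + h z) (\<lambda>z. z \<in> X) p"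
    and "z \<in> X" "0 \<le> G" and lip: "h z - h p \<le> G * norm (z - p)"
  shows "norm (p - z) \<le> (a * (norm g + G) + L * norm (y - z)) / \<sigma>"
proof (cases "p = z")
  case True
  have "0 \<le> L"
    using L[of "SOME b. b \<in> Basis" 0] norm_ge_zero[of "\<Phi>' (SOME b. b \<in> Basis) - \<Phi>' 0"] norm_some_Basis
    by (metis diff_zero mult.right_neutral order_trans)
  then show ?thesis
    using True mirror_mapD(1)[OF \<Phi>] \<open>0 < a\<close> \<open>0 \<le> G\<close> by simp
next
  case False
  have "\<sigma> * (norm (p - z))\<^sup>2 \<le> bregman \<Phi> \<Phi>' p z + bregman \<Phi> \<Phi>' z p"
    using mirror_mapD(4)[OF \<Phi>, of p z] mirror_mapD(4)[OF \<Phi>, of z p] by (simp add: norm_minus_commute)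
  also have "\<dots> = (\<Phi>' y - \<Phi>' z) \<bullet> (p - z) - (\<Phi>' p - \<Phi>' y) \<bullet> (z - p)"
    by (simp add: bregman_def inner_diff_left inner_diff_right algebra_simps)
  also have "\<dots> \<le> L * norm (y - z) * norm (p - z) + a * (norm g + G) * norm (p - z)"
  proof -
    have "(\<Phi>' y - \<Phi>' z) \<bullet> (p - z) \<le> norm (\<Phi>' y - \<Phi>' z) * norm (p - z)" by (rule norm_cauchy_schwarz)
    also have "\<dots> \<le> L * norm (y - z) * norm (p - z)" by (intro mult_right_mono L) simp
    finally have 1: "(\<Phi>' y - \<Phi>' z) \<bullet> (p - z) \<le> L * norm (y - z) * norm (p - z)" .
    have "g \<bullet> (z - p) \<le> norm g * norm (z - p)" by (rule norm_cauchy_schwarz)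
    then have "g \<bullet> (z - p) + (h z - h p) \<le> (norm g + G) * norm (p - z)"
      using lip by (simp add: norm_minus_commute algebra_simps)
    then have "a * (g \<bullet> (z - p) + (h z - h p)) \<le> a * ((norm g + G) * norm (p - z))"
      using \<open>0 < a\<close> by simp
    then show ?thesis
      using 1 prox_optimality[OF assms(1-7)] by (simp add: inner_diff_right algebra_simps)
  qed
  finally have "norm (p - z) * (\<sigma> * norm (p - z)) \<le> norm (p - z) * (a * (norm g + G) + L * norm (y - z))"
    by (simp add: power2_eq_square algebra_simps)
  then have "\<sigma> * norm (p - z) \<le> a * (norm g + G) + L * norm (y - z)" using False by simp
  then show ?thesis using mirror_mapD(1)[OF \<Phi>] by (simp add: pos_le_divide_eq mult.commute)
qed

text \<open>The stochastic subgradient is to be paired with \<open>y - z\<close>, since it belongs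
  to \<open>y\<close>, whereas optimality pairs it with \<open>p - z\<close>. Young's inequality
  pays for \<open>y - p\<close> with the divergence of \<open>p\<close> from \<open>y\<close> that
  the three-point identity leaves over.\<close>

lemma prox_descent:
  fixes h :: "'a::euclidean_space \<Rightarrow> real"
  assumes \<Phi>: "mirror_map \<Phi> \<Phi>' \<sigma>" and L: "\<And>x y. norm (\<Phi>' x - \<Phi>' y) \<le> L * norm (x - y)"
    and "convex X" "convex_on UNIV h" "0 < a"
    and p: "is_arg_min (\<lambda>z. g \<bullet> z + 1 / a * bregman \<Phi> \<Phi>' z y + h z) (\<lambda>z. z \<in> X) p"
    and "z \<in> X"
  shows "a * (g \<bullet> (y - z) + h p - h z) \<le>
    bregman \<Phi> \<Phi>' z y - bregman \<Phi> \<Phi>' z p + a\<^sup>2 * (norm g)\<^sup>2 / (2 * \<sigma>)"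
proof -
  have "0 < \<sigma>" using mirror_mapD(1)[OF \<Phi>] .
  have "a * (g \<bullet> (y - p)) \<le> a * (norm g * norm (y - p))"
    using \<open>0 < a\<close> norm_cauchy_schwarz by (intro mult_left_mono) auto
  also have "\<dots> \<le> \<sigma> / 2 * (norm (p - y))\<^sup>2 + a\<^sup>2 * (norm g)\<^sup>2 / (2 * \<sigma>)"
  proof -
    have "0 \<le> (\<sigma> * norm (p - y) - a * norm g)\<^sup>2 / (2 * \<sigma>)" using \<open>0 < \<sigma>\<close> by simp
    also have "\<dots> = \<sigma> / 2 * (norm (p - y))\<^sup>2 + a\<^sup>2 * (norm g)\<^sup>2 / (2 * \<sigma>) - a * (norm g * norm (y - p))"
      using \<open>0 < \<sigma>\<close> by (simp add: power2_eq_square field_simps norm_minus_commute)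
    finally show ?thesis by simp
  qed
  also have "\<dots> \<le> bregman \<Phi> \<Phi>' p y + a\<^sup>2 * (norm g)\<^sup>2 / (2 * \<sigma>)"
    using mirror_mapD(4)[OF \<Phi>] by simp
  finally have 1: "a * (g \<bullet> (y - p)) \<le> bregman \<Phi> \<Phi>' p y + a\<^sup>2 * (norm g)\<^sup>2 / (2 * \<sigma>)" .
  have "a * (g \<bullet> (p - z) + h p - h z) \<le> bregman \<Phi> \<Phi>' z y - bregman \<Phi> \<Phi>' z p - bregman \<Phi> \<Phi>' p y"
    using prox_optimality[OF assms] bregman_three_point[of \<Phi>' p y z \<Phi>] by simp
  then show ?thesis using 1 by (simp add: inner_diff_right algebra_simps)
qed

section \<open>Conditional moments\<close>

definition square_integrable :: "'w measure \<Rightarrow> ('w \<Rightarrow> 'a::euclidean_space) \<Rightarrow> bool" where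
  "square_integrable M U \<longleftrightarrow> U \<in> borel_measurable M \<and> integrable M (\<lambda>\<omega>. (norm (U \<omega>))\<^sup>2)"

lemma square_integrable_add:
  assumes "square_integrable M U" "square_integrable M V"
  shows "square_integrable M (\<lambda>\<omega>. U \<omega> + V \<omega>)"
proof -
  have [measurable]: "U \<in> borel_measurable M" "V \<in> borel_measurable M"
    using assms by (auto simp: square_integrable_def)
  have "integrable M (\<lambda>\<omega>. 2 * (norm (U \<omega>))\<^sup>2 + 2 * (norm (V \<omega>))\<^sup>2)"
    using assms by (auto simp: square_integrable_def)
  have le: "norm ((norm (U \<omega> + V \<omega>))\<^sup>2) \<le> norm (2 * (norm (U \<omega>))\<^sup>2 + 2 * (norm (V \<omega>))\<^sup>2)" for \<omega>
  proof -
    have "(norm (U \<omega> + V \<omega>))\<^sup>2 \<le> (norm (U \<omega>) + norm (V \<omega>))\<^sup>2"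
      by (intro power_mono norm_triangle_ineq) simp
    also have "\<dots> \<le> 2 * (norm (U \<omega>))\<^sup>2 + 2 * (norm (V \<omega>))\<^sup>2"
      using zero_le_power2[of "norm (U \<omega>) - norm (V \<omega>)"] by (simp add: power2_sum power2_diff)
    finally show ?thesis by simp
  qed
  have "integrable M (\<lambda>\<omega>. (norm (U \<omega> + V \<omega>))\<^sup>2)"
  proof (rule Bochner_Integration.integrable_bound)
    show "integrable M (\<lambda>\<omega>. 2 * (norm (U \<omega>))\<^sup>2 + 2 * (norm (V \<omega>))\<^sup>2)" by fact
    show "AE \<omega> in M. norm ((norm (U \<omega> + V \<omega>))\<^sup>2) \<le> norm (2 * (norm (U \<omega>))\<^sup>2 + 2 * (norm (V \<omega>))\<^sup>2)"
      using le by (rule AE_I2)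
  qed simp
  then show ?thesis by (simp add: square_integrable_def)
qed

lemma square_integrable_scaleR:
  assumes "square_integrable M U"
  shows "square_integrable M (\<lambda>\<omega>. c *\<^sub>R U \<omega>)"
  using assms by (auto simp: square_integrable_def power_mult_distrib)

lemma square_integrable_sum:
  assumes "finite I" "\<And>i. i \<in> I \<Longrightarrow> square_integrable M (U i)"
  shows "square_integrable M (\<lambda>\<omega>. \<Sum>i\<in>I. U i \<omega>)"
  using assms
proof (induction I)
  case empty
  then show ?case by (simp add: square_integrable_def)
next
  case (insert i I)
  then show ?case using square_integrable_add[of M "U i" "\<lambda>\<omega>. \<Sum>i\<in>I. U i \<omega>"] by simp
qed

lemma square_integrable_mult:
  fixes U V :: "'w \<Rightarrow> 'a::euclidean_space"
  assumes "square_integrable M U" "square_integrable M V"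
    and [measurable]: "h \<in> borel_measurable M" and h: "\<And>\<omega>. \<bar>h \<omega>\<bar> \<le> norm (U \<omega>) * norm (V \<omega>)"
  shows "integrable M h"
proof (rule Bochner_Integration.integrable_bound)
  show "integrable M (\<lambda>\<omega>. (norm (U \<omega>))\<^sup>2 + (norm (V \<omega>))\<^sup>2)"
    using assms by (auto simp: square_integrable_def)
  have "\<bar>h \<omega>\<bar> \<le> (norm (U \<omega>))\<^sup>2 + (norm (V \<omega>))\<^sup>2" for \<omega>
    using h[of \<omega>] zero_le_power2[of "norm (U \<omega>) - norm (V \<omega>)"]
      mult_nonneg_nonneg[OF norm_ge_zero[of "U \<omega>"] norm_ge_zero[of "V \<omega>"]]
    unfolding power2_diff by linarith
  then show "AE \<omega> in M. norm (h \<omega>) \<le> norm ((norm (U \<omega>))\<^sup>2 + (norm (V \<omega>))\<^sup>2)" by auto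
qed simp

context prob_space
begin

lemma square_integrable_bounded:
  assumes "U \<in> borel_measurable M" "\<And>\<omega>. \<omega> \<in> space M \<Longrightarrow> norm (U \<omega>) \<le> C"
  shows "square_integrable M U"
  unfolding square_integrable_def
proof
  show "integrable M (\<lambda>\<omega>. (norm (U \<omega>))\<^sup>2)"
  proof (rule integrable_const_bound[where B = "C\<^sup>2"])
    show "AE \<omega> in M. norm ((norm (U \<omega>))\<^sup>2) \<le> C\<^sup>2"
      using assms(2) by (intro AE_I2) (simp add: power_mono)
  qed (use assms(1) in simp)
qed fact

text \<open>Jensen's inequality in the form that a variance is nonnegative.\<close>

lemma expectation_norm_le_sqrt:
  assumes "square_integrable M U" "expectation (\<lambda>\<omega>. (norm (U \<omega>))\<^sup>2) \<le> c"
  shows "integrable M (\<lambda>\<omega>. norm (U \<omega>))" "expectation (\<lambda>\<omega>. norm (U \<omega>)) \<le> sqrt c"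
proof -
  have U: "U \<in> borel_measurable M" "integrable M (\<lambda>\<omega>. (norm (U \<omega>))\<^sup>2)"
    using assms by (auto simp: square_integrable_def)
  show int: "integrable M (\<lambda>\<omega>. norm (U \<omega>))"
    by (rule square_integrable_imp_integrable) (use U in simp_all)
  have "0 \<le> variance (\<lambda>\<omega>. norm (U \<omega>))" by (rule integral_nonneg_AE) simp
  then have "(expectation (\<lambda>\<omega>. norm (U \<omega>)))\<^sup>2 \<le> c"
    using variance_eq[OF int U(2)] assms(2) by linarith
  then show "expectation (\<lambda>\<omega>. norm (U \<omega>)) \<le> sqrt c" by (rule real_le_rsqrt)
qed

text \<open>The tower property, tested with the constant 1. Working with nonnegative integrals first
  makes integrability a conclusion.\<close>

lemma cond_second_moment:
  fixes Z :: "'a \<Rightarrow> 'b::euclidean_space"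
  assumes sub: "subalgebra M G" and Z: "Z \<in> borel_measurable M" and "0 \<le> c"
    and le: "AE \<omega> in M. nn_cond_exp M G (\<lambda>\<omega>. ennreal ((norm (Z \<omega>))\<^sup>2)) \<omega> \<le> ennreal c"
  shows "square_integrable M Z" "expectation (\<lambda>\<omega>. (norm (Z \<omega>))\<^sup>2) \<le> c"
proof -
  interpret G: finite_measure_subalgebra M G by unfold_locales (rule sub)
  note [measurable] = Z
  have "(\<integral>\<^sup>+ \<omega>. ennreal ((norm (Z \<omega>))\<^sup>2) \<partial>M) = (\<integral>\<^sup>+ \<omega>. 1 * ennreal ((norm (Z \<omega>))\<^sup>2) \<partial>M)" by simp
  also have "\<dots> = (\<integral>\<^sup>+ \<omega>. 1 * nn_cond_exp M G (\<lambda>\<omega>. ennreal ((norm (Z \<omega>))\<^sup>2)) \<omega> \<partial>M)"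
    by (rule G.nn_cond_exp_intg[symmetric]) simp_all
  also have "\<dots> \<le> (\<integral>\<^sup>+ \<omega>. ennreal c \<partial>M)"
    using le by (intro nn_integral_mono_AE) simp
  also have "\<dots> = ennreal c" by (simp add: emeasure_space_1)
  finally have *: "(\<integral>\<^sup>+ \<omega>. ennreal ((norm (Z \<omega>))\<^sup>2) \<partial>M) \<le> ennreal c" .
  also have "\<dots> < \<infinity>" by simp
  finally have int: "integrable M (\<lambda>\<omega>. (norm (Z \<omega>))\<^sup>2)"
    by (intro integrableI_bounded) simp_all
  then show "square_integrable M Z" by (simp add: square_integrable_def)
  have "ennreal (expectation (\<lambda>\<omega>. (norm (Z \<omega>))\<^sup>2)) \<le> ennreal c"
    using * nn_integral_eq_integral[OF int] by simp
  then show "expectation (\<lambda>\<omega>. (norm (Z \<omega>))\<^sup>2) \<le> c" using \<open>0 \<le> c\<close> by simp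
qed

text \<open>The mean \<open>m\<close> will be a selection of subgradients along random points, for
  which measurability is not given, so the expectation of
  \<open>m \<omega> \<bullet> U \<omega>\<close> is avoided. The integrable minorant
  \<open>W\<close> takes its place, and the proof integrates the coordinatewise conditional
  expectations instead.\<close>

lemma cond_mean_inner_ge:
  fixes Z U m :: "'a \<Rightarrow> 'b::euclidean_space"
  assumes sub: "subalgebra M G" and cm: "cond_mean_moment2 M G Z m c" and "0 \<le> c"
    and U: "U \<in> borel_measurable G" "square_integrable M U"
    and W: "integrable M W" "AE \<omega> in M. W \<omega> \<le> m \<omega> \<bullet> U \<omega>"
  shows "integrable M (\<lambda>\<omega>. Z \<omega> \<bullet> U \<omega>)" "expectation W \<le> expectation (\<lambda>\<omega>. Z \<omega> \<bullet> U \<omega>)"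
proof -
  interpret G: finite_measure_subalgebra M G by unfold_locales (rule sub)
  have [measurable]: "Z \<in> borel_measurable M" "U \<in> borel_measurable M"
    using cm U by (auto simp: cond_mean_moment2_def square_integrable_def)
  have Z: "square_integrable M Z"
    using cm by (intro cond_second_moment(1)[OF sub _ \<open>0 \<le> c\<close>]) (auto simp: cond_mean_moment2_def)
  show "integrable M (\<lambda>\<omega>. Z \<omega> \<bullet> U \<omega>)"
    by (rule square_integrable_mult[OF Z U(2)]) (simp_all add: Cauchy_Schwarz_ineq2)
  have int: "integrable M (\<lambda>\<omega>. (U \<omega> \<bullet> b) * (Z \<omega> \<bullet> b))" if "b \<in> Basis" for b
  proof (rule square_integrable_mult[OF Z U(2)])
    show "\<bar>(U \<omega> \<bullet> b) * (Z \<omega> \<bullet> b)\<bar> \<le> norm (Z \<omega>) * norm (U \<omega>)" for \<omega>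
      using Basis_le_norm[OF that, of "U \<omega>"] Basis_le_norm[OF that, of "Z \<omega>"]
      by (simp add: abs_mult mult.commute mult_mono)
  qed simp
  have Ub: "(\<lambda>\<omega>. U \<omega> \<bullet> b) \<in> borel_measurable G" for b using U(1) by simp
  note rce = G.real_cond_exp_intg[OF int Ub]
  have rce_int: "integrable M (\<lambda>\<omega>. (U \<omega> \<bullet> b) * real_cond_exp M G (\<lambda>\<omega>. Z \<omega> \<bullet> b) \<omega>)"
    and rce_eq: "expectation (\<lambda>\<omega>. (U \<omega> \<bullet> b) * real_cond_exp M G (\<lambda>\<omega>. Z \<omega> \<bullet> b) \<omega>) = expectation (\<lambda>\<omega>. (U \<omega> \<bullet> b) * (Z \<omega> \<bullet> b))"
    if "b \<in> Basis" for b
    using rce[OF that] by simp_all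
  have "AE \<omega> in M. \<forall>b\<in>Basis. real_cond_exp M G (\<lambda>\<omega>. Z \<omega> \<bullet> b) \<omega> = m \<omega> \<bullet> b"
    using cm unfolding cond_mean_moment2_def by (intro AE_finite_allI) auto
  then have AE: "AE \<omega> in M. W \<omega> \<le> (\<Sum>b\<in>Basis. (U \<omega> \<bullet> b) * real_cond_exp M G (\<lambda>\<omega>. Z \<omega> \<bullet> b) \<omega>)"
    using W(2)
  proof eventually_elim
    case (elim \<omega>)
    have "m \<omega> \<bullet> U \<omega> = (\<Sum>b\<in>Basis. (U \<omega> \<bullet> b) * (m \<omega> \<bullet> b))"
      by (subst euclidean_inner) (simp add: mult.commute)
    then show ?case using elim by simp
  qed
  have "expectation W \<le> expectation (\<lambda>\<omega>. \<Sum>b\<in>Basis. (U \<omega> \<bullet> b) * real_cond_exp M G (\<lambda>\<omega>. Z \<omega> \<bullet> b) \<omega>)"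
    by (rule integral_mono_AE[OF W(1) _ AE]) (intro Bochner_Integration.integrable_sum rce_int)
  also have "\<dots> = (\<Sum>b\<in>Basis. expectation (\<lambda>\<omega>. (U \<omega> \<bullet> b) * (Z \<omega> \<bullet> b)))"
    by (subst Bochner_Integration.integral_sum) (simp_all add: rce_int rce_eq)
  also have "\<dots> = expectation (\<lambda>\<omega>. \<Sum>b\<in>Basis. (U \<omega> \<bullet> b) * (Z \<omega> \<bullet> b))"
    by (rule Bochner_Integration.integral_sum[symmetric]) (rule int)
  also have "\<dots> = expectation (\<lambda>\<omega>. Z \<omega> \<bullet> U \<omega>)"
  proof -
    have "(\<Sum>b\<in>Basis. (U \<omega> \<bullet> b) * (Z \<omega> \<bullet> b)) = Z \<omega> \<bullet> U \<omega>" for \<omega>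
      using euclidean_inner[of "Z \<omega>" "U \<omega>"] by (simp add: mult.commute)
    then show ?thesis by simp
  qed
  finally show "expectation W \<le> expectation (\<lambda>\<omega>. Z \<omega> \<bullet> U \<omega>)" .
qed

end

section \<open>The iteration in expectation\<close>

text \<open>Stepsizes and noise magnitudes stay abstract up to their signs, so that no estimate
  before the final rate refers to a power law.\<close>

locale dscmd =
  fixes M :: "'w measure" and F :: "nat \<Rightarrow> 'w measure"
    and X :: "'a::euclidean_space set"
    and N B :: nat and \<theta> \<sigma> L \<nu> Gf :: real
    and f chi :: "nat \<Rightarrow> 'a \<Rightarrow> real"
    and \<Phi> :: "'a \<Rightarrow> real" and \<Phi>' :: "'a \<Rightarrow> 'a"
    and P :: "nat \<Rightarrow> nat \<Rightarrow> nat \<Rightarrow> real"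
    and \<alpha> r :: "nat \<Rightarrow> real"
    and \<xi> :: "nat \<Rightarrow> nat \<Rightarrow> nat \<Rightarrow> 'w \<Rightarrow> 'a"
    and sg :: "nat \<Rightarrow> nat \<Rightarrow> 'a \<Rightarrow> 'w \<Rightarrow> 'a" and g :: "nat \<Rightarrow> 'a \<Rightarrow> 'a"
    and x0 :: "nat \<Rightarrow> 'a" and x y :: "nat \<Rightarrow> nat \<Rightarrow> 'w \<Rightarrow> 'a"
    and obj :: "'a \<Rightarrow> real" and xstar :: 'a
  assumes prob: "prob_space M"
    and X: "X \<noteq> {}" "convex X" "compact X"
    and convex: "\<forall>i\<in>{1..N}. convex_on UNIV (f i) \<and> convex_on UNIV (chi i)"
    and obj: "\<forall>z. obj z = (\<Sum>i=1..N. f i z + chi i z)"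
    and xstar: "is_arg_min obj (\<lambda>z. z \<in> X) xstar"
    and \<Phi>: "mirror_map \<Phi> \<Phi>' \<sigma>" "mirror_map_assumption N \<Phi> \<Phi>' L"
    and network: "network_assumption N P B \<theta>"
    and y: "y = noisy_mix N P r \<xi> x"
    and iteration: "dscmd_n M N X chi \<Phi> \<Phi>' \<alpha> sg x0 x y"
    and history: "adapted_history M F N \<xi> sg x y"
    and subgradient: "stochastic_subgradient_assumption M F N X f \<xi> sg g y Gf"
    and noise: "noise_assumption M F N \<xi> \<nu>"
    and \<alpha>_pos: "\<And>t. 0 < \<alpha> t" and r_nonneg: "\<And>t. 0 \<le> r t"
    and N: "1 \<le> N"
begin

sublocale prob_space M by (rule prob)

definition "Gchi = max_subgrad_norm N X chi"
text \<open>By strong convexity an upper bound for the diameter of \<open>X\<close>; in terms of it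
  \<open>C5\<close> becomes \<open>N * L * R * sqrt \<nu>\<close>.\<close>

definition "R = sqrt (2 / \<sigma>) * bregman_diam \<Phi> \<Phi>' X"
definition "z t i \<omega> = mix N (P t) (\<lambda>j. x t j \<omega>) i"
definition "n t i \<omega> = (\<Sum>j=1..N. P t i j *\<^sub>R \<xi> t i j \<omega>)"
text \<open>The perturbation of the consensus dynamics. It is taken relative to \<open>z\<close>
  rather than \<open>y\<close>, so that \<open>x\<close> follows the noise-free mixing plus
  \<open>e\<close> and the noise acts only through its effect on the mirror step.\<close>

definition "e t i \<omega> = x (Suc t) i \<omega> - z t i \<omega>"
definition "sgy t i \<omega> = sg t i (y t i \<omega>) \<omega>"

lemma doubly_stochastic_P: "doubly_stochastic N (P t)"
  using network by (simp add: network_assumption_def)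

lemmas P_nonneg = doubly_stochasticD(1)[OF doubly_stochastic_P]
lemmas P_row = doubly_stochasticD(2)[OF doubly_stochastic_P]

lemma \<Phi>_lipschitz: "norm (\<Phi>' u - \<Phi>' v) \<le> L * norm (u - v)"
  using \<Phi>(2) by (simp add: mirror_map_assumption_def)

lemma L_nonneg: "0 \<le> L"
proof -
  obtain b :: 'a where "b \<in> Basis" using nonempty_Basis by blast
  then have "norm (b - 0) = 1" by simp
  then show ?thesis
    using \<Phi>_lipschitz[of b 0] norm_ge_zero[of "\<Phi>' b - \<Phi>' 0"] by (simp only: mult_1_right)
qed

lemma \<sigma>_pos: "0 < \<sigma>" by (rule mirror_mapD(1)[OF \<Phi>(1)])

lemma Gf_nonneg: "0 \<le> Gf"
  using subgradient by (simp add: stochastic_subgradient_assumption_def)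

lemma \<nu>_nonneg: "0 \<le> \<nu>"
  using noise by (simp add: noise_assumption_def)

lemma convex_f: "i \<in> {1..N} \<Longrightarrow> convex_on UNIV (f i)"
  and convex_chi: "i \<in> {1..N} \<Longrightarrow> convex_on UNIV (chi i)"
  using convex by auto

lemma xstar_in: "xstar \<in> X" using xstar by (simp add: is_arg_min_def)

lemma prox:
  assumes "i \<in> {1..N}" "\<omega> \<in> space M"
  shows "is_arg_min (\<lambda>w. sgy t i \<omega> \<bullet> w + 1 / \<alpha> t * bregman \<Phi> \<Phi>' w (y t i \<omega>) + chi i w)
    (\<lambda>w. w \<in> X) (x (Suc t) i \<omega>)"
  using iteration assms unfolding dscmd_n_def sgy_def by blast

lemma x_in:
  assumes "i \<in> {1..N}" "\<omega> \<in> space M"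
  shows "x t i \<omega> \<in> X"
proof (cases t)
  case 0
  then show ?thesis using iteration assms by (simp add: dscmd_n_def)
next
  case (Suc s)
  then show ?thesis using prox[OF assms, of s] by (simp add: is_arg_min_def)
qed

lemma z_in:
  assumes "i \<in> {1..N}" "\<omega> \<in> space M"
  shows "z t i \<omega> \<in> X"
  unfolding z_def mix_def
  by (rule convex_sum) (use X(2) P_row[OF assms(1)] P_nonneg[OF assms(1)] x_in assms(2) in auto)

lemma y_eq: "y t i \<omega> = z t i \<omega> + r t *\<^sub>R n t i \<omega>"
  by (simp add: y noisy_mix_def z_def mix_def n_def scaleR_add_right sum.distrib scaleR_sum_right mult.commute)

lemma diam: "u \<in> X \<Longrightarrow> v \<in> X \<Longrightarrow> norm (u - v) \<le> R"
  unfolding R_def by (rule bregman_diam(3)[OF \<Phi>(1) X(3)])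

lemma R_nonneg: "0 \<le> R"
  using diam[OF xstar_in xstar_in] by simp

section \<open>Measurability and moments of the random quantities\<close>

lemma subalgebra_F: "subalgebra M (F t)"
  using history by (simp add: adapted_history_def)

lemma subalgebra_past: "subalgebra M (past M F t)"
proof (cases t)
  case 0
  then show ?thesis by (simp add: past_def subalgebra_def sigma_sets_empty_eq)
next
  case (Suc s)
  then show ?thesis using subalgebra_F by (simp add: past_def)
qed

lemma \<xi>_measurable:
  assumes "i \<in> {1..N}" "j \<in> {1..N}"
  shows "\<xi> t i j \<in> borel_measurable M"
proof -
  have "\<xi> t i j \<in> borel_measurable (F t)" using history assms by (simp add: adapted_history_def)
  then show ?thesis by (rule measurable_from_subalg[OF subalgebra_F])
qed

lemma x_measurable_past: "i \<in> {1..N} \<Longrightarrow> x t i \<in> borel_measurable (past M F t)"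
  using history by (simp add: adapted_history_def)

lemma x_measurable [measurable]: "i \<in> {1..N} \<Longrightarrow> x t i \<in> borel_measurable M"
  by (rule measurable_from_subalg[OF subalgebra_past x_measurable_past])

lemma sgy_measurable:
  assumes "i \<in> {1..N}"
  shows "sgy t i \<in> borel_measurable M"
proof -
  have "sgy t i \<in> borel_measurable (F t)"
    using history assms by (simp add: adapted_history_def sgy_def[abs_def])
  then show ?thesis by (rule measurable_from_subalg[OF subalgebra_F])
qed

text \<open>\<open>sigma\<close> yields the generated sigma-algebra only if the generating family
  consists of subsets of the space; this is the fact to be checked.\<close>

lemma
  shows space_past_noise: "space (past_and_noise M F N \<xi> t) = space M"
    and sets_past_noise: "sets (past_and_noise M F N \<xi> t) = sigma_sets (space M) (sets (past M F t) \<union>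
      {\<xi> t i j -` A \<inter> space M | i j A. i \<in> {1..N} \<and> j \<in> {1..N} \<and> A \<in> sets borel})"
proof -
  have "sets (past M F t) \<union> {\<xi> t i j -` A \<inter> space M | i j A. i \<in> {1..N} \<and> j \<in> {1..N} \<and> A \<in> sets borel} \<subseteq> Pow (space M)"
    using subalgebra_past[of t] sets.space_closed[of M] by (auto simp: subalgebra_def)
  from space_measure_of[OF this] sets_measure_of[OF this] show "space (past_and_noise M F N \<xi> t) = space M"
    "sets (past_and_noise M F N \<xi> t) = sigma_sets (space M) (sets (past M F t) \<union>
      {\<xi> t i j -` A \<inter> space M | i j A. i \<in> {1..N} \<and> j \<in> {1..N} \<and> A \<in> sets borel})"
    unfolding past_and_noise_def by blast+
qed

lemma subalgebra_past_noise: "subalgebra M (past_and_noise M F N \<xi> t)"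
proof -
  have "sigma_sets (space M) (sets (past M F t) \<union>
      {\<xi> t i j -` A \<inter> space M | i j A. i \<in> {1..N} \<and> j \<in> {1..N} \<and> A \<in> sets borel}) \<subseteq> sets M"
    using subalgebra_past[of t] \<xi>_measurable[of _ _ t]
    by (intro sets.sigma_sets_subset) (auto simp: subalgebra_def intro: measurable_sets)
  then show ?thesis by (simp add: subalgebra_def space_past_noise sets_past_noise)
qed

text \<open>Admits \<open>y t i \<omega> - xstar\<close> as the test vector when the conditional
  mean of the stochastic subgradient is used.\<close>

lemma y_measurable_past_noise:
  assumes i: "i \<in> {1..N}"
  shows "y t i \<in> borel_measurable (past_and_noise M F N \<xi> t)"
proof -
  have "subalgebra (past_and_noise M F N \<xi> t) (past M F t)"
    using subalgebra_past[of t] by (auto simp: subalgebra_def space_past_noise sets_past_noise)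
  then have [measurable]: "x t j \<in> borel_measurable (past_and_noise M F N \<xi> t)" if "j \<in> {1..N}" for j
    using measurable_from_subalg x_measurable_past that by blast
  have [measurable]: "\<xi> t i j \<in> borel_measurable (past_and_noise M F N \<xi> t)" if j: "j \<in> {1..N}" for j
  proof (rule measurableI)
    fix A :: "'a set" assume "A \<in> sets borel"
    then show "\<xi> t i j -` A \<inter> space (past_and_noise M F N \<xi> t) \<in> sets (past_and_noise M F N \<xi> t)"
      unfolding sets_past_noise space_past_noise using i j by (intro sigma_sets.Basic) blast
  qed simp
  show ?thesis unfolding y noisy_mix_def[abs_def]
    by (intro borel_measurable_sum borel_measurable_scaleR borel_measurable_add borel_measurable_const) simp_all
qed

lemma z_measurable [measurable]: "i \<in> {1..N} \<Longrightarrow> z t i \<in> borel_measurable M"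
  unfolding z_def[abs_def] mix_def by measurable

lemma e_measurable [measurable]: "i \<in> {1..N} \<Longrightarrow> e t i \<in> borel_measurable M"
  unfolding e_def[abs_def] by measurable

lemma integrable_continuous:
  fixes h :: "'a \<Rightarrow> real"
  assumes "continuous_on UNIV h" "U \<in> borel_measurable M" "\<And>\<omega>. \<omega> \<in> space M \<Longrightarrow> U \<omega> \<in> X"
  shows "integrable M (\<lambda>\<omega>. h (U \<omega>))"
proof -
  have "compact (h ` X)"
    using assms(1) X(3) by (intro compact_continuous_image) (auto intro: continuous_on_subset)
  then have "bounded (h ` X)" by (rule compact_imp_bounded)
  then obtain C where C: "\<And>u. u \<in> X \<Longrightarrow> norm (h u) \<le> C" by (auto simp: bounded_iff)
  show ?thesis
  proof (rule integrable_const_bound[where B = C])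
    show "(\<lambda>\<omega>. h (U \<omega>)) \<in> borel_measurable M"
      using assms(2) borel_measurable_continuous_onI[OF assms(1)] by (rule measurable_compose)
  qed (use C assms(3) in auto)
qed

lemma continuous_f: "i \<in> {1..N} \<Longrightarrow> continuous_on UNIV (f i)"
  and continuous_chi: "i \<in> {1..N} \<Longrightarrow> continuous_on UNIV (chi i)"
  using convex_f convex_chi convex_on_continuous[OF open_UNIV] by blast+

lemma continuous_bregman: "continuous_on UNIV (bregman \<Phi> \<Phi>' u)"
  unfolding bregman_def[abs_def] by (intro continuous_intros mirror_mapD(2,3)[OF \<Phi>(1)])

lemma noise_moment:
  assumes "i \<in> {1..N}" "j \<in> {1..N}"
  shows "square_integrable M (\<xi> t i j)" "expectation (\<lambda>\<omega>. (norm (\<xi> t i j \<omega>))\<^sup>2) \<le> \<nu>"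
    and "integrable M (\<lambda>\<omega>. norm (\<xi> t i j \<omega>))" "expectation (\<lambda>\<omega>. norm (\<xi> t i j \<omega>)) \<le> sqrt \<nu>"
proof -
  have "AE \<omega> in M. nn_cond_exp M (past M F t) (\<lambda>\<omega>. ennreal ((norm (\<xi> t i j \<omega>))\<^sup>2)) \<omega> \<le> ennreal \<nu>"
    using noise assms by (simp add: noise_assumption_def)
  from cond_second_moment[OF subalgebra_past \<xi>_measurable[OF assms] \<nu>_nonneg this]
  show sq: "square_integrable M (\<xi> t i j)" and m: "expectation (\<lambda>\<omega>. (norm (\<xi> t i j \<omega>))\<^sup>2) \<le> \<nu>" .
  from expectation_norm_le_sqrt[OF sq m]
  show "integrable M (\<lambda>\<omega>. norm (\<xi> t i j \<omega>))" "expectation (\<lambda>\<omega>. norm (\<xi> t i j \<omega>)) \<le> sqrt \<nu>" .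
qed

lemma sgy_cond:
  assumes "i \<in> {1..N}"
  shows "cond_mean_moment2 M (past_and_noise M F N \<xi> t) (sgy t i) (\<lambda>\<omega>. g i (y t i \<omega>)) (Gf\<^sup>2)"
  using subgradient assms unfolding sgy_def[abs_def] stochastic_subgradient_assumption_def by blast

lemma sgy_moment:
  assumes "i \<in> {1..N}"
  shows "square_integrable M (sgy t i)" "expectation (\<lambda>\<omega>. (norm (sgy t i \<omega>))\<^sup>2) \<le> Gf\<^sup>2"
    and "integrable M (\<lambda>\<omega>. norm (sgy t i \<omega>))" "expectation (\<lambda>\<omega>. norm (sgy t i \<omega>)) \<le> Gf"
proof -
  have "AE \<omega> in M. nn_cond_exp M (past_and_noise M F N \<xi> t) (\<lambda>\<omega>. ennreal ((norm (sgy t i \<omega>))\<^sup>2)) \<omega> \<le> ennreal (Gf\<^sup>2)"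
    using sgy_cond[OF assms] by (simp add: cond_mean_moment2_def)
  from cond_second_moment[OF subalgebra_past_noise sgy_measurable[OF assms] zero_le_power2 this]
  show sq: "square_integrable M (sgy t i)" and m: "expectation (\<lambda>\<omega>. (norm (sgy t i \<omega>))\<^sup>2) \<le> Gf\<^sup>2" .
  from expectation_norm_le_sqrt[OF sq m] Gf_nonneg
  show "integrable M (\<lambda>\<omega>. norm (sgy t i \<omega>))" "expectation (\<lambda>\<omega>. norm (sgy t i \<omega>)) \<le> Gf" by simp_all
qed

lemma n_moment:
  assumes "i \<in> {1..N}"
  shows "square_integrable M (n t i)" "integrable M (\<lambda>\<omega>. norm (n t i \<omega>))"
    and "expectation (\<lambda>\<omega>. norm (n t i \<omega>)) \<le> sqrt \<nu>"
proof -
  show sq: "square_integrable M (n t i)"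
    unfolding n_def[abs_def] using noise_moment(1)[OF assms]
    by (intro square_integrable_sum square_integrable_scaleR) auto
  show int: "integrable M (\<lambda>\<omega>. norm (n t i \<omega>))" by (rule expectation_norm_le_sqrt(1)[OF sq order_refl])
  have "expectation (\<lambda>\<omega>. norm (n t i \<omega>)) \<le> expectation (\<lambda>\<omega>. \<Sum>j=1..N. P t i j * norm (\<xi> t i j \<omega>))"
  proof (rule integral_mono[OF int])
    show "integrable M (\<lambda>\<omega>. \<Sum>j=1..N. P t i j * norm (\<xi> t i j \<omega>))"
      using noise_moment(3)[OF assms] by (intro Bochner_Integration.integrable_sum integrable_mult_right) auto
    show "norm (n t i \<omega>) \<le> (\<Sum>j=1..N. P t i j * norm (\<xi> t i j \<omega>))" for \<omega>
      unfolding n_def using P_nonneg[OF assms]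
      by (intro order_trans[OF norm_sum] sum_mono) simp
  qed
  also have "\<dots> = (\<Sum>j=1..N. P t i j * expectation (\<lambda>\<omega>. norm (\<xi> t i j \<omega>)))"
    using noise_moment(3)[OF assms] by (subst Bochner_Integration.integral_sum) auto
  also have "\<dots> \<le> (\<Sum>j=1..N. P t i j * sqrt \<nu>)"
    using noise_moment(4)[OF assms] P_nonneg[OF assms] by (intro sum_mono mult_left_mono) auto
  also have "\<dots> = sqrt \<nu>" using P_row[OF assms] by (simp flip: sum_distrib_right)
  finally show "expectation (\<lambda>\<omega>. norm (n t i \<omega>)) \<le> sqrt \<nu>" .
qed

section \<open>Lipschitz bounds starting from points of \<open>X\<close>\<close>

lemma g_subgradient: "i \<in> {1..N} \<Longrightarrow> u \<in> X \<Longrightarrow> g i u \<in> subdifferential (f i) u"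
  using subgradient by (simp add: stochastic_subgradient_assumption_def)

text \<open>The conditional mean is tested with the constant vector \<open>g i u\<close> itself: its
  squared norm is the expectation of an inner product with the stochastic subgradient, hence at most
  \<open>Gf * norm (g i u)\<close>.\<close>

lemma norm_g_le:
  assumes i: "i \<in> {1..N}" and u: "u \<in> X"
  shows "norm (g i u) \<le> Gf"
proof -
  have cm: "cond_mean_moment2 M (past M F 0) (sg 0 i u) (\<lambda>\<omega>. g i u) (Gf\<^sup>2)"
    using subgradient i u by (simp add: stochastic_subgradient_assumption_def)
  then have Z: "sg 0 i u \<in> borel_measurable M"
    "AE \<omega> in M. nn_cond_exp M (past M F 0) (\<lambda>\<omega>. ennreal ((norm (sg 0 i u \<omega>))\<^sup>2)) \<omega> \<le> ennreal (Gf\<^sup>2)"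
    by (simp_all add: cond_mean_moment2_def)
  note mom = cond_second_moment[OF subalgebra_past Z(1) zero_le_power2 Z(2)]
  note mom1 = expectation_norm_le_sqrt[OF mom]
  have U: "(\<lambda>_. g i u) \<in> borel_measurable (past M F 0)" "square_integrable M (\<lambda>_. g i u)"
    and W: "integrable M (\<lambda>_. (norm (g i u))\<^sup>2)" "AE \<omega> in M. (norm (g i u))\<^sup>2 \<le> g i u \<bullet> g i u"
    by (simp_all add: square_integrable_def power2_norm_eq_inner)
  note ge = cond_mean_inner_ge[OF subalgebra_past cm zero_le_power2 U W]
  have "(norm (g i u))\<^sup>2 \<le> expectation (\<lambda>\<omega>. sg 0 i u \<omega> \<bullet> g i u)" using ge(2) by (simp add: prob_space)
  also have "\<dots> \<le> expectation (\<lambda>\<omega>. norm (sg 0 i u \<omega>) * norm (g i u))"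
    using mom1(1) by (intro integral_mono ge(1) norm_cauchy_schwarz integrable_mult_left) auto
  also have "\<dots> = expectation (\<lambda>\<omega>. norm (sg 0 i u \<omega>)) * norm (g i u)" by simp
  also have "\<dots> \<le> Gf * norm (g i u)"
    using mom1(2) Gf_nonneg by (intro mult_right_mono) auto
  finally have "norm (g i u) * norm (g i u) \<le> Gf * norm (g i u)" by (simp add: power2_eq_square)
  then show ?thesis using Gf_nonneg by (cases "norm (g i u) = 0") auto
qed

text \<open>Only \<open>u\<close> has to lie in \<open>X\<close>; this allows \<open>v\<close> to be
  a noisy query point.\<close>

lemma f_diff_le:
  assumes "i \<in> {1..N}" "u \<in> X"
  shows "f i u - f i v \<le> Gf * norm (u - v)"
proof -
  have "f i v \<ge> f i u + g i u \<bullet> (v - u)"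
    using g_subgradient[OF assms] by (simp add: subdifferential_def)
  then have "f i u - f i v \<le> g i u \<bullet> (u - v)" by (simp add: inner_diff_right)
  also have "\<dots> \<le> norm (g i u) * norm (u - v)" by (rule norm_cauchy_schwarz)
  also have "\<dots> \<le> Gf * norm (u - v)" by (intro mult_right_mono norm_g_le assms norm_ge_zero)
  finally show ?thesis .
qed

lemma chi_diff_le:
  assumes "i \<in> {1..N}" "u \<in> X"
  shows "chi i u - chi i v \<le> Gchi * norm (u - v)"
  unfolding Gchi_def
  using max_subgrad_norm_lipschitz(1)[of i N chi X u v] assms convex_chi[OF assms(1)] X(3) by blast

lemma Gchi_nonneg: "0 \<le> Gchi"
  unfolding Gchi_def using N max_subgrad_norm_lipschitz(2)[of 1 N chi X xstar] convex_chi[of 1] X(3) xstar_in by simp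

lemma obj_diff_le:
  assumes "u \<in> X" "v \<in> X"
  shows "obj u - obj v \<le> real N * (Gf + Gchi) * R"
proof -
  have "obj u - obj v = (\<Sum>i=1..N. (f i u - f i v) + (chi i u - chi i v))"
    using obj by (simp add: sum_subtractf sum.distrib)
  also have "\<dots> \<le> (\<Sum>i=1..N. Gf * R + Gchi * R)"
  proof (rule sum_mono)
    fix i assume i: "i \<in> {1..N}"
    show "(f i u - f i v) + (chi i u - chi i v) \<le> Gf * R + Gchi * R"
      using f_diff_le[OF i assms(1), of v] chi_diff_le[OF i assms(1), of v]
        mult_left_mono[OF diam[OF assms] Gf_nonneg] mult_left_mono[OF diam[OF assms] Gchi_nonneg]
      by linarith
  qed
  finally show ?thesis by (simp add: algebra_simps)
qed

lemma displacement:
  assumes i: "i \<in> {1..N}"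
  shows "integrable M (\<lambda>\<omega>. norm (e t i \<omega>))"
    and "expectation (\<lambda>\<omega>. norm (e t i \<omega>)) \<le> (\<alpha> t * (Gf + Gchi) + L * r t * sqrt \<nu>) / \<sigma>"
proof -
  let ?b = "\<lambda>\<omega>. (\<alpha> t * (norm (sgy t i \<omega>) + Gchi) + L * (r t * norm (n t i \<omega>))) / \<sigma>"
  have le: "norm (e t i \<omega>) \<le> ?b \<omega>" if \<omega>: "\<omega> \<in> space M" for \<omega>
  proof -
    have "norm (y t i \<omega> - z t i \<omega>) = r t * norm (n t i \<omega>)"
      using r_nonneg[of t] by (simp add: y_eq)
    then show ?thesis
      using prox_displacement_le[OF \<Phi>(1) \<Phi>_lipschitz X(2) convex_chi[OF i] \<alpha>_pos prox[OF i \<omega>, of t] z_in[OF i \<omega>, of t] Gchi_nonneg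
          chi_diff_le[OF i z_in[OF i \<omega>, of t]]]
      by (simp add: e_def)
  qed
  have int: "integrable M ?b"
    using sgy_moment(3)[OF i] n_moment(2)[OF i]
    by (intro integrable_divide integrable_add integrable_mult_right) auto
  show inte: "integrable M (\<lambda>\<omega>. norm (e t i \<omega>))"
  proof (rule Bochner_Integration.integrable_bound[OF int])
    show "AE \<omega> in M. norm (norm (e t i \<omega>)) \<le> norm (?b \<omega>)"
    proof (rule AE_I2)
      fix \<omega> assume "\<omega> \<in> space M"
      from le[OF this] show "norm (norm (e t i \<omega>)) \<le> norm (?b \<omega>)"
        unfolding real_norm_def abs_norm_cancel by (rule order_trans[OF _ abs_ge_self])
    qed
  qed (use i in measurable)
  have "expectation (\<lambda>\<omega>. norm (e t i \<omega>)) \<le> expectation ?b"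
    by (intro integral_mono inte int le)
  also have "\<dots> = (\<alpha> t * (expectation (\<lambda>\<omega>. norm (sgy t i \<omega>)) + Gchi) + L * (r t * expectation (\<lambda>\<omega>. norm (n t i \<omega>)))) / \<sigma>"
    using sgy_moment(3)[OF i] n_moment(2)[OF i] by (simp add: prob_space)
  also have "\<dots> \<le> (\<alpha> t * (Gf + Gchi) + L * (r t * sqrt \<nu>)) / \<sigma>"
    using sgy_moment(4)[OF i] n_moment(3)[OF i] \<sigma>_pos L_nonneg \<alpha>_pos[of t] r_nonneg[of t]
    by (intro divide_right_mono add_mono mult_left_mono order_refl) (auto intro: less_imp_le)
  finally show "expectation (\<lambda>\<omega>. norm (e t i \<omega>)) \<le> (\<alpha> t * (Gf + Gchi) + L * r t * sqrt \<nu>) / \<sigma>"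
    by (simp add: mult.assoc)
qed

section \<open>Descent of the expected divergence\<close>

definition "V t i = expectation (\<lambda>\<omega>. bregman \<Phi> \<Phi>' xstar (x t i \<omega>))"

text \<open>Separate convexity is applied to the noisy summands before the noise is expanded. The
  base points of the expansion are then the iterates, which lie in \<open>X\<close>, and their
  distance to \<open>xstar\<close> is at most \<open>R\<close>.\<close>

lemma bregman_y_le:
  assumes i: "i \<in> {1..N}" and \<omega>: "\<omega> \<in> space M"
  shows "bregman \<Phi> \<Phi>' xstar (y t i \<omega>) \<le> (\<Sum>j=1..N. P t i j *
    (bregman \<Phi> \<Phi>' xstar (x t j \<omega>) + L * R * r t * norm (\<xi> t i j \<omega>) + L * (r t)\<^sup>2 * (norm (\<xi> t i j \<omega>))\<^sup>2))"
proof -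
  have mm: "(\<And>j. j \<in> {1..N} \<Longrightarrow> w j \<in> {0..1}) \<Longrightarrow> (\<Sum>j=1..N. w j) = 1 \<Longrightarrow>
      bregman \<Phi> \<Phi>' a (\<Sum>j=1..N. w j *\<^sub>R b j) \<le> (\<Sum>j=1..N. w j * bregman \<Phi> \<Phi>' a (b j))" for w a b
    using \<Phi>(2) by (simp add: mirror_map_assumption_def)
  have "P t i j \<in> {0..1}" if "j \<in> {1..N}" for j
    using P_nonneg[OF i, of _ t] P_row[OF i, of t] member_le_sum[of j "{1..N}" "P t i"] that by auto
  then have "bregman \<Phi> \<Phi>' xstar (\<Sum>j=1..N. P t i j *\<^sub>R (x t j \<omega> + r t *\<^sub>R \<xi> t i j \<omega>)) \<le>
      (\<Sum>j=1..N. P t i j * bregman \<Phi> \<Phi>' xstar (x t j \<omega> + r t *\<^sub>R \<xi> t i j \<omega>))"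
    by (rule mm[of "P t i" xstar "\<lambda>j. x t j \<omega> + r t *\<^sub>R \<xi> t i j \<omega>"]) (simp_all only: P_row[OF i])
  also have "\<dots> \<le> (\<Sum>j=1..N. P t i j *
    (bregman \<Phi> \<Phi>' xstar (x t j \<omega>) + L * R * r t * norm (\<xi> t i j \<omega>) + L * (r t)\<^sup>2 * (norm (\<xi> t i j \<omega>))\<^sup>2))"
  proof (intro sum_mono mult_left_mono)
    fix j assume j: "j \<in> {1..N}"
    let ?h = "r t *\<^sub>R \<xi> t i j \<omega>"
    have "bregman \<Phi> \<Phi>' xstar (x t j \<omega> + ?h) \<le>
        bregman \<Phi> \<Phi>' xstar (x t j \<omega>) + L * norm ?h * norm (xstar - x t j \<omega>) + L * (norm ?h)\<^sup>2"
      by (rule bregman_perturb_le[OF \<Phi>(1) \<Phi>_lipschitz])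
    moreover have "L * norm ?h * norm (xstar - x t j \<omega>) \<le> L * norm ?h * R"
      using diam[OF xstar_in x_in[OF j \<omega>]] L_nonneg by (intro mult_left_mono) auto
    ultimately show "bregman \<Phi> \<Phi>' xstar (x t j \<omega> + ?h) \<le> bregman \<Phi> \<Phi>' xstar (x t j \<omega>)
        + L * R * r t * norm (\<xi> t i j \<omega>) + L * (r t)\<^sup>2 * (norm (\<xi> t i j \<omega>))\<^sup>2"
      using r_nonneg[of t] by (simp add: power_mult_distrib mult_ac)
    show "0 \<le> P t i j" by (rule P_nonneg[OF i j])
  qed
  finally show ?thesis by (simp add: y noisy_mix_def)
qed

lemma integrable_bregman_x: "i \<in> {1..N} \<Longrightarrow> integrable M (\<lambda>\<omega>. bregman \<Phi> \<Phi>' xstar (x t i \<omega>))"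
  by (rule integrable_continuous[OF continuous_bregman x_measurable x_in])

lemma integrable_f_z: "i \<in> {1..N} \<Longrightarrow> integrable M (\<lambda>\<omega>. f i (z t i \<omega>))"
  by (rule integrable_continuous[OF continuous_f z_measurable z_in])

lemma integrable_chi_x: "i \<in> {1..N} \<Longrightarrow> integrable M (\<lambda>\<omega>. chi i (x t i \<omega>))"
  by (rule integrable_continuous[OF continuous_chi x_measurable x_in])

lemma square_integrable_y:
  assumes i: "i \<in> {1..N}"
  shows "square_integrable M (\<lambda>\<omega>. y t i \<omega> - xstar)"
proof -
  have "square_integrable M (\<lambda>\<omega>. z t i \<omega> - xstar)"
    using i diam[OF z_in[OF i] xstar_in] by (intro square_integrable_bounded[where C = R]) measurable
  from square_integrable_add[OF this square_integrable_scaleR[OF n_moment(1)[OF i], of "r t"]]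
  show ?thesis by (simp add: y_eq algebra_simps)
qed

lemma agent_step:
  assumes i: "i \<in> {1..N}"
  shows "\<alpha> t * (expectation (\<lambda>\<omega>. f i (z t i \<omega>)) + expectation (\<lambda>\<omega>. chi i (x (Suc t) i \<omega>)) - (f i xstar + chi i xstar)) \<le>
    (\<Sum>j=1..N. P t i j * V t j) - V (Suc t) i + L * R * r t * sqrt \<nu> + L * (r t)\<^sup>2 * \<nu>
    + (\<alpha> t)\<^sup>2 * Gf\<^sup>2 / (2 * \<sigma>) + \<alpha> t * (Gf * (r t * sqrt \<nu>))"
proof -
  \<comment> \<open>A measurable minorant of
    \<open>g i (y t i \<omega>) \<bullet> (y t i \<omega> - xstar)\<close>: the subgradient
    inequality at \<open>y\<close>, followed by the passage from \<open>f i\<close> at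
    \<open>y\<close> to \<open>f i\<close> at \<open>z\<close>, which costs \<open>Gf\<close> times
    the scaled noise.\<close>
  let ?W = "\<lambda>\<omega>. f i (z t i \<omega>) - Gf * (r t * norm (n t i \<omega>)) - f i xstar"
  have W: "integrable M ?W"
    using integrable_f_z[OF i] n_moment(2)[OF i] by auto
  have AE: "AE \<omega> in M. ?W \<omega> \<le> g i (y t i \<omega>) \<bullet> (y t i \<omega> - xstar)"
  proof -
    have "AE \<omega> in M. g i (y t i \<omega>) \<in> subdifferential (f i) (y t i \<omega>)"
      using subgradient i by (simp add: stochastic_subgradient_assumption_def)
    then show ?thesis using AE_space
    proof eventually_elim
      case (elim \<omega>)
      have "f i xstar \<ge> f i (y t i \<omega>) + g i (y t i \<omega>) \<bullet> (xstar - y t i \<omega>)"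
        using elim(1) by (simp add: subdifferential_def)
      moreover have "f i (z t i \<omega>) - f i (y t i \<omega>) \<le> Gf * norm (z t i \<omega> - y t i \<omega>)"
        by (rule f_diff_le[OF i z_in[OF i elim(2)]])
      moreover have "norm (z t i \<omega> - y t i \<omega>) = r t * norm (n t i \<omega>)"
        using r_nonneg[of t] by (simp add: y_eq)
      ultimately show ?case by (simp add: inner_diff_right)
    qed
  qed
  have Um: "(\<lambda>\<omega>. y t i \<omega> - xstar) \<in> borel_measurable (past_and_noise M F N \<xi> t)"
    using y_measurable_past_noise[OF i, of t] by simp
  note inner = cond_mean_inner_ge[OF subalgebra_past_noise sgy_cond[OF i] zero_le_power2 Um square_integrable_y[OF i] W AE]
  have "expectation (\<lambda>\<omega>. f i (z t i \<omega>)) - Gf * (r t * sqrt \<nu>) - f i xstar \<le> expectation ?W"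
    using integrable_f_z[OF i] n_moment(2,3)[OF i] Gf_nonneg r_nonneg[of t]
    by (simp add: prob_space mult_left_mono)
  with inner(2) have fz: "expectation (\<lambda>\<omega>. f i (z t i \<omega>)) - Gf * (r t * sqrt \<nu>) - f i xstar \<le>
      expectation (\<lambda>\<omega>. sgy t i \<omega> \<bullet> (y t i \<omega> - xstar))" by linarith
  let ?lhs = "\<lambda>\<omega>. \<alpha> t * (sgy t i \<omega> \<bullet> (y t i \<omega> - xstar) + chi i (x (Suc t) i \<omega>) - chi i xstar)"
  let ?T = "\<lambda>j \<omega>. bregman \<Phi> \<Phi>' xstar (x t j \<omega>) + L * R * r t * norm (\<xi> t i j \<omega>) + L * (r t)\<^sup>2 * (norm (\<xi> t i j \<omega>))\<^sup>2"
  let ?rhs = "\<lambda>\<omega>. (\<Sum>j=1..N. P t i j * ?T j \<omega>) - bregman \<Phi> \<Phi>' xstar (x (Suc t) i \<omega>)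
      + (\<alpha> t)\<^sup>2 * (norm (sgy t i \<omega>))\<^sup>2 / (2 * \<sigma>)"
  have noise_int: "integrable M (\<lambda>\<omega>. norm (\<xi> t i j \<omega>))" "integrable M (\<lambda>\<omega>. (norm (\<xi> t i j \<omega>))\<^sup>2)" if "j \<in> {1..N}" for j
    using noise_moment(1,3)[OF i that] by (simp_all add: square_integrable_def)
  have T_int: "integrable M (?T j)" if "j \<in> {1..N}" for j
    using integrable_bregman_x[OF that] noise_int[OF that] by auto
  have sum_int: "integrable M (\<lambda>\<omega>. \<Sum>j=1..N. P t i j * ?T j \<omega>)"
    using T_int by (intro Bochner_Integration.integrable_sum integrable_mult_right)
  have sgy_int: "integrable M (\<lambda>\<omega>. (norm (sgy t i \<omega>))\<^sup>2)"
    using sgy_moment(1)[OF i] by (simp add: square_integrable_def)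
  have lhs_eq: "expectation ?lhs = \<alpha> t * (expectation (\<lambda>\<omega>. sgy t i \<omega> \<bullet> (y t i \<omega> - xstar))
      + expectation (\<lambda>\<omega>. chi i (x (Suc t) i \<omega>)) - chi i xstar)"
    using inner(1) integrable_chi_x[OF i] by (simp add: prob_space)
  have "expectation ?lhs \<le> expectation ?rhs"
  proof (rule integral_mono)
    show "integrable M ?lhs" using inner(1) integrable_chi_x[OF i] by auto
    show "integrable M ?rhs" using sum_int integrable_bregman_x[OF i] sgy_int by auto
    show "?lhs \<omega> \<le> ?rhs \<omega>" if \<omega>: "\<omega> \<in> space M" for \<omega>
      using prox_descent[OF \<Phi>(1) \<Phi>_lipschitz X(2) convex_chi[OF i] \<alpha>_pos prox[OF i \<omega>] xstar_in, of t] bregman_y_le[OF i \<omega>, of t]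
      by linarith
  qed
  also have "expectation ?rhs = (\<Sum>j=1..N. P t i j * expectation (?T j)) - V (Suc t) i
      + (\<alpha> t)\<^sup>2 * expectation (\<lambda>\<omega>. (norm (sgy t i \<omega>))\<^sup>2) / (2 * \<sigma>)"
  proof -
    have "expectation (\<lambda>\<omega>. \<Sum>j=1..N. P t i j * ?T j \<omega>) = (\<Sum>j=1..N. P t i j * expectation (?T j))"
      using T_int by (subst Bochner_Integration.integral_sum) (simp_all del: integral_add Bochner_Integration.integral_add)
    then show ?thesis
      using sum_int integrable_bregman_x[OF i, of "Suc t"] sgy_int unfolding V_def
      by (simp del: Bochner_Integration.integral_sum)
  qed
  also have "(\<Sum>j=1..N. P t i j * expectation (?T j)) \<le>
      (\<Sum>j=1..N. P t i j * (V t j + (L * R * r t * sqrt \<nu> + L * (r t)\<^sup>2 * \<nu>)))"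
  proof (intro sum_mono mult_left_mono)
    fix j assume j: "j \<in> {1..N}"
    have "expectation (?T j) = V t j + L * R * r t * expectation (\<lambda>\<omega>. norm (\<xi> t i j \<omega>))
        + L * (r t)\<^sup>2 * expectation (\<lambda>\<omega>. (norm (\<xi> t i j \<omega>))\<^sup>2)"
      using integrable_bregman_x[OF j] noise_int[OF j] by (simp add: V_def)
    also have "\<dots> \<le> V t j + L * R * r t * sqrt \<nu> + L * (r t)\<^sup>2 * \<nu>"
      using noise_moment(2,4)[OF i j] L_nonneg R_nonneg r_nonneg[of t]
      by (intro add_mono mult_left_mono order_refl mult_nonneg_nonneg) auto
    finally show "expectation (?T j) \<le> V t j + (L * R * r t * sqrt \<nu> + L * (r t)\<^sup>2 * \<nu>)" by simp
    show "0 \<le> P t i j" by (rule P_nonneg[OF i j])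
  qed
  also have "(\<Sum>j=1..N. P t i j * (V t j + (L * R * r t * sqrt \<nu> + L * (r t)\<^sup>2 * \<nu>))) =
      (\<Sum>j=1..N. P t i j * V t j) + (L * R * r t * sqrt \<nu> + L * (r t)\<^sup>2 * \<nu>)"
    using P_row[OF i] by (simp add: distrib_left sum.distrib flip: sum_distrib_right)
  also have "(\<alpha> t)\<^sup>2 * expectation (\<lambda>\<omega>. (norm (sgy t i \<omega>))\<^sup>2) / (2 * \<sigma>) \<le> (\<alpha> t)\<^sup>2 * Gf\<^sup>2 / (2 * \<sigma>)"
    using sgy_moment(2)[OF i] \<sigma>_pos by (intro divide_right_mono mult_left_mono) auto
  finally have main: "expectation ?lhs \<le> (\<Sum>j=1..N. P t i j * V t j) + (L * R * r t * sqrt \<nu> + L * (r t)\<^sup>2 * \<nu>)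
      - V (Suc t) i + (\<alpha> t)\<^sup>2 * Gf\<^sup>2 / (2 * \<sigma>)" by simp
  have "\<alpha> t * (expectation (\<lambda>\<omega>. f i (z t i \<omega>)) - Gf * (r t * sqrt \<nu>) - f i xstar
      + expectation (\<lambda>\<omega>. chi i (x (Suc t) i \<omega>)) - chi i xstar) \<le> expectation ?lhs"
    unfolding lhs_eq using fz \<alpha>_pos[of t] by (intro mult_left_mono) auto
  with main show ?thesis by (simp add: algebra_simps)
qed

text \<open>The two parts are evaluated at different points because the mirror step linearizes
  \<open>f i\<close> around the mixed point but keeps \<open>chi i\<close> exactly, at the new
  iterate.\<close>

definition "step_value t = (\<Sum>i=1..N. expectation (\<lambda>\<omega>. f i (z t i \<omega>)) + expectation (\<lambda>\<omega>. chi i (x (Suc t) i \<omega>)))"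

definition "W t = (\<Sum>i=1..N. V t i)"

lemma W_bounds: "0 \<le> W t" "W t \<le> real N * (bregman_diam \<Phi> \<Phi>' X)\<^sup>2"
proof -
  have "0 \<le> V t i" for i
    unfolding V_def by (intro Bochner_Integration.integral_nonneg mirror_mapD(5)[OF \<Phi>(1)])
  then show "0 \<le> W t" unfolding W_def by (intro sum_nonneg)
  have "V t i \<le> (bregman_diam \<Phi> \<Phi>' X)\<^sup>2" if i: "i \<in> {1..N}" for i
  proof -
    have "V t i \<le> expectation (\<lambda>_. (bregman_diam \<Phi> \<Phi>' X)\<^sup>2)"
      unfolding V_def
      using integrable_bregman_x[OF i] bregman_diam(1)[OF \<Phi>(1) X(3) xstar_in x_in[OF i]]
      by (intro integral_mono) auto
    then show ?thesis by (simp add: prob_space)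
  qed
  then have "W t \<le> (\<Sum>i=1..N. (bregman_diam \<Phi> \<Phi>' X)\<^sup>2)" unfolding W_def by (rule sum_mono)
  then show "W t \<le> real N * (bregman_diam \<Phi> \<Phi>' X)\<^sup>2" by simp
qed

text \<open>Summed over the agents, the mixed divergences collapse to \<open>W t\<close> because the
  columns of \<open>P t\<close> sum to 1, so the estimate is ready for telescoping.\<close>

lemma total_step:
  "\<alpha> t * (step_value t - obj xstar) \<le> W t - W (Suc t)
    + real N * (L * R * r t * sqrt \<nu> + L * (r t)\<^sup>2 * \<nu> + (\<alpha> t)\<^sup>2 * Gf\<^sup>2 / (2 * \<sigma>) + \<alpha> t * (Gf * (r t * sqrt \<nu>)))"
proof -
  define c where "c = L * R * r t * sqrt \<nu> + L * (r t)\<^sup>2 * \<nu> + (\<alpha> t)\<^sup>2 * Gf\<^sup>2 / (2 * \<sigma>) + \<alpha> t * (Gf * (r t * sqrt \<nu>))"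
  have "\<alpha> t * (step_value t - obj xstar) = (\<Sum>i=1..N. \<alpha> t * (expectation (\<lambda>\<omega>. f i (z t i \<omega>))
      + expectation (\<lambda>\<omega>. chi i (x (Suc t) i \<omega>)) - (f i xstar + chi i xstar)))"
    unfolding step_value_def obj[rule_format] by (simp add: sum_subtractf flip: sum_distrib_left)
  also have "\<dots> \<le> (\<Sum>i=1..N. (\<Sum>j=1..N. P t i j * V t j) - V (Suc t) i + c)"
    using agent_step[of _ t] by (intro sum_mono) (simp add: c_def algebra_simps)
  also have "\<dots> = (\<Sum>i=1..N. \<Sum>j=1..N. P t i j * V t j) - W (Suc t) + real N * c"
    by (simp add: sum.distrib sum_subtractf W_def)
  also have "(\<Sum>i=1..N. \<Sum>j=1..N. P t i j * V t j) = W t"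
    using sum_doubly_stochastic[OF doubly_stochastic_P, of t "V t"] by (simp add: W_def)
  finally show ?thesis by (simp add: c_def)
qed

section \<open>Expected disagreement of the agents\<close>

lemma dispersion_measurable:
  assumes "\<And>i. i \<in> {1..N} \<Longrightarrow> u i \<in> borel_measurable M"
  shows "(\<lambda>\<omega>. dispersion N (\<lambda>i. u i \<omega> :: 'a)) \<in> borel_measurable M"
  unfolding dispersion_def average_def L2_set_def using assms by measurable

lemma integrable_dispersion_z: "integrable M (\<lambda>\<omega>. dispersion N (\<lambda>i. z t i \<omega>))"
proof (rule integrable_const_bound[where B = "real N * R"])
  show "AE \<omega> in M. norm (dispersion N (\<lambda>i. z t i \<omega>)) \<le> real N * R"
  proof (rule AE_I2)
    fix \<omega> assume \<omega>: "\<omega> \<in> space M"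
    have "dispersion N (\<lambda>i. z t i \<omega>) \<le> real N * R"
      by (rule dispersion_le_diameter) (intro diam z_in \<omega>; assumption)
    then show "norm (dispersion N (\<lambda>i. z t i \<omega>)) \<le> real N * R" by simp
  qed
qed (rule dispersion_measurable, rule z_measurable)

text \<open>The consensus estimate holds on every sample path and is integrated afterwards. Bounding
  the initial dispersion by \<open>real N * R\<close> instead of following it from time 0 makes a
  restart at any time \<open>a\<close> possible.\<close>

lemma expected_dispersion_sum:
  "(\<Sum>t\<in>{a..<b}. expectation (\<lambda>\<omega>. dispersion N (\<lambda>i. z t i \<omega>))) \<le>
    rate_omega N \<theta> / (1 - rate_gamma N B \<theta>) *
    (real N * R + (\<Sum>t\<in>{a..<b}. \<Sum>i=1..N. expectation (\<lambda>\<omega>. norm (e t i \<omega>))))"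
proof -
  define K where "K = rate_omega N \<theta> / (1 - rate_gamma N B \<theta>)"
  have "0 \<le> K" using rate_gamma_omega[OF network N] by (simp add: K_def)
  have "(\<Sum>t\<in>{a..<b}. expectation (\<lambda>\<omega>. dispersion N (\<lambda>i. z t i \<omega>))) =
      expectation (\<lambda>\<omega>. \<Sum>t\<in>{a..<b}. dispersion N (\<lambda>i. z t i \<omega>))"
    using integrable_dispersion_z by (intro Bochner_Integration.integral_sum[symmetric])
  also have "\<dots> \<le> expectation (\<lambda>\<omega>. K * (real N * R + (\<Sum>t\<in>{a..<b}. \<Sum>i=1..N. norm (e t i \<omega>))))"
  proof (rule integral_mono)
    show "integrable M (\<lambda>\<omega>. \<Sum>t\<in>{a..<b}. dispersion N (\<lambda>i. z t i \<omega>))"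
      using integrable_dispersion_z by (intro Bochner_Integration.integrable_sum)
    show "integrable M (\<lambda>\<omega>. K * (real N * R + (\<Sum>t\<in>{a..<b}. \<Sum>i=1..N. norm (e t i \<omega>))))"
      using displacement(1) by (intro integrable_mult_right Bochner_Integration.integrable_add Bochner_Integration.integrable_sum integrable_const)
    fix \<omega> assume \<omega>: "\<omega> \<in> space M"
    define v where "v t i = x t i \<omega>" for t i
    have step: "v (Suc t) = (\<lambda>i. mix N (P t) (v t) i + e t i \<omega>)" for t
      by (simp add: v_def[abs_def] e_def z_def fun_eq_iff)
    have "(\<Sum>t\<in>{a..<b}. dispersion N (\<lambda>i. z t i \<omega>)) \<le> (\<Sum>t\<in>{a..<b}. dispersion N (v t))"
      using dispersion_mix_le[OF doubly_stochastic_P] unfolding z_def v_def by (intro sum_mono)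
    also have "\<dots> \<le> K * (dispersion N (v a) + (\<Sum>t\<in>{a..<b}. dispersion N (\<lambda>i. e t i \<omega>)))"
      unfolding K_def by (rule sum_dispersion_perturbed_le[OF network N step])
    also have "\<dots> \<le> K * (real N * R + (\<Sum>t\<in>{a..<b}. \<Sum>i=1..N. norm (e t i \<omega>)))"
    proof (intro mult_left_mono add_mono sum_mono dispersion_le_sum_norm \<open>0 \<le> K\<close>)
      show "dispersion N (v a) \<le> real N * R"
        unfolding v_def by (rule dispersion_le_diameter) (intro diam x_in \<omega>; assumption)
    qed
    finally show "(\<Sum>t\<in>{a..<b}. dispersion N (\<lambda>i. z t i \<omega>)) \<le> K * (real N * R + (\<Sum>t\<in>{a..<b}. \<Sum>i=1..N. norm (e t i \<omega>)))" .
  qed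
  also have "\<dots> = K * (real N * R + (\<Sum>t\<in>{a..<b}. \<Sum>i=1..N. expectation (\<lambda>\<omega>. norm (e t i \<omega>))))"
  proof -
    have inner: "integrable M (\<lambda>\<omega>. \<Sum>i=1..N. norm (e t i \<omega>))" for t
      by (intro Bochner_Integration.integrable_sum displacement(1))
    have "expectation (\<lambda>\<omega>. \<Sum>t\<in>{a..<b}. \<Sum>i=1..N. norm (e t i \<omega>)) =
        (\<Sum>t\<in>{a..<b}. expectation (\<lambda>\<omega>. \<Sum>i=1..N. norm (e t i \<omega>)))"
      by (rule Bochner_Integration.integral_sum) (rule inner)
    also have "\<dots> = (\<Sum>t\<in>{a..<b}. \<Sum>i=1..N. expectation (\<lambda>\<omega>. norm (e t i \<omega>)))"
      by (intro sum.cong refl Bochner_Integration.integral_sum) (rule displacement(1))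
    finally have eq: "expectation (\<lambda>\<omega>. \<Sum>t\<in>{a..<b}. \<Sum>i=1..N. norm (e t i \<omega>)) =
      (\<Sum>t\<in>{a..<b}. \<Sum>i=1..N. expectation (\<lambda>\<omega>. norm (e t i \<omega>)))" .
    have "integrable M (\<lambda>\<omega>. \<Sum>t\<in>{a..<b}. \<Sum>i=1..N. norm (e t i \<omega>))"
      by (intro Bochner_Integration.integrable_sum displacement(1))
    then have "expectation (\<lambda>\<omega>. real N * R + (\<Sum>t\<in>{a..<b}. \<Sum>i=1..N. norm (e t i \<omega>))) =
        real N * R + expectation (\<lambda>\<omega>. \<Sum>t\<in>{a..<b}. \<Sum>i=1..N. norm (e t i \<omega>))"
      by (subst Bochner_Integration.integral_add) (simp_all add: prob_space)
    then show ?thesis unfolding integral_mult_right_zero eq by simp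
  qed
  finally show ?thesis by (simp add: K_def)
qed

lemma continuous_obj: "continuous_on UNIV obj"
proof -
  have "obj = (\<lambda>z. \<Sum>i=1..N. f i z + chi i z)" using obj by auto
  then show ?thesis by (auto intro!: continuous_intros continuous_f continuous_chi)
qed

text \<open>Agent \<open>l\<close> reaches the point \<open>z t i\<close> of agent \<open>i\<close>
  through its own displacement and \<open>z t l\<close>; the regularizer needs the displacement of
  \<open>i\<close> in addition. The factor \<open>real N - 1\<close> arises because \<open>l\<close>
  does not disagree with itself; with \<open>real N\<close> in its place, the comparison with
  \<open>C3\<close> would fail for two agents.\<close>

lemma consensus_gap:
  assumes l: "l \<in> {1..N}"
  shows "expectation (\<lambda>\<omega>. obj (x (Suc t) l \<omega>)) \<le> step_value t
    + 2 * (real N - 1) * (Gf + Gchi) * expectation (\<lambda>\<omega>. dispersion N (\<lambda>i. z t i \<omega>))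
    + 2 * real N * (Gf + Gchi) * ((\<alpha> t * (Gf + Gchi) + L * r t * sqrt \<nu>) / \<sigma>)"
proof -
  define G where "G = Gf + Gchi"
  define d where "d = (\<alpha> t * G + L * r t * sqrt \<nu>) / \<sigma>"
  have G: "0 \<le> G" "Gf \<le> G" "Gchi \<le> G" using Gf_nonneg Gchi_nonneg by (auto simp: G_def)
  let ?D = "\<lambda>\<omega>. dispersion N (\<lambda>i. z t i \<omega>)"
  let ?b = "\<lambda>\<omega>. (\<Sum>i=1..N. f i (z t i \<omega>) + chi i (x (Suc t) i \<omega>)) + (2 * (real N - 1) * G) * ?D \<omega>
    + real N * G * norm (e t l \<omega>) + Gchi * (\<Sum>i=1..N. norm (e t i \<omega>))"
  have obj_int: "integrable M (\<lambda>\<omega>. obj (x (Suc t) l \<omega>))"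
    by (rule integrable_continuous[OF continuous_obj x_measurable[OF l] x_in[OF l]])
  have ints: "integrable M (\<lambda>\<omega>. \<Sum>i=1..N. f i (z t i \<omega>) + chi i (x (Suc t) i \<omega>))"
      "integrable M (\<lambda>\<omega>. \<Sum>i=1..N. norm (e t i \<omega>))"
    using integrable_f_z integrable_chi_x displacement(1) by (auto intro!: Bochner_Integration.integrable_sum)
  have le: "obj (x (Suc t) l \<omega>) \<le> ?b \<omega>" if \<omega>: "\<omega> \<in> space M" for \<omega>
  proof -
    have "obj (x (Suc t) l \<omega>) - (\<Sum>i=1..N. f i (z t i \<omega>) + chi i (x (Suc t) i \<omega>)) =
        (\<Sum>i=1..N. (f i (x (Suc t) l \<omega>) - f i (z t i \<omega>)) + (chi i (x (Suc t) l \<omega>) - chi i (x (Suc t) i \<omega>)))"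
      unfolding obj[rule_format] sum_subtractf[symmetric] by (intro sum.cong) auto
    also have "\<dots> \<le> (\<Sum>i=1..N. G * norm (z t l \<omega> - z t i \<omega>) + G * norm (e t l \<omega>) + Gchi * norm (e t i \<omega>))"
    proof (rule sum_mono)
      fix i assume i: "i \<in> {1..N}"
      have "norm (x (Suc t) l \<omega> - z t i \<omega>) \<le> norm (e t l \<omega>) + norm (z t l \<omega> - z t i \<omega>)"
        using norm_triangle_ineq[of "e t l \<omega>" "z t l \<omega> - z t i \<omega>"] by (simp add: e_def)
      then have 1: "f i (x (Suc t) l \<omega>) - f i (z t i \<omega>) \<le> Gf * (norm (e t l \<omega>) + norm (z t l \<omega> - z t i \<omega>))"
        using f_diff_le[OF i x_in[OF l \<omega>], of "Suc t" "z t i \<omega>"] Gf_nonneg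
        by (meson mult_left_mono order_trans)
      have "norm (x (Suc t) l \<omega> - x (Suc t) i \<omega>) \<le> norm (e t l \<omega>) + norm (z t l \<omega> - z t i \<omega>) + norm (e t i \<omega>)"
        using norm_triangle_ineq4[of "e t l \<omega> + (z t l \<omega> - z t i \<omega>)" "e t i \<omega>"]
          norm_triangle_ineq[of "e t l \<omega>" "z t l \<omega> - z t i \<omega>"] by (simp add: e_def)
      then have 2: "chi i (x (Suc t) l \<omega>) - chi i (x (Suc t) i \<omega>) \<le>
          Gchi * (norm (e t l \<omega>) + norm (z t l \<omega> - z t i \<omega>) + norm (e t i \<omega>))"
        using chi_diff_le[OF i x_in[OF l \<omega>], of "Suc t" "x (Suc t) i \<omega>"] Gchi_nonneg
        by (meson mult_left_mono order_trans)
      from 1 2 show "(f i (x (Suc t) l \<omega>) - f i (z t i \<omega>)) + (chi i (x (Suc t) l \<omega>) - chi i (x (Suc t) i \<omega>)) \<le>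
          G * norm (z t l \<omega> - z t i \<omega>) + G * norm (e t l \<omega>) + Gchi * norm (e t i \<omega>)"
        by (simp add: G_def algebra_simps)
    qed
    also have "\<dots> = G * (\<Sum>i=1..N. norm (z t l \<omega> - z t i \<omega>)) + real N * G * norm (e t l \<omega>) + Gchi * (\<Sum>i=1..N. norm (e t i \<omega>))"
      by (simp add: sum.distrib sum_distrib_left)
    finally have total: "obj (x (Suc t) l \<omega>) - (\<Sum>i=1..N. f i (z t i \<omega>) + chi i (x (Suc t) i \<omega>)) \<le>
      G * (\<Sum>i=1..N. norm (z t l \<omega> - z t i \<omega>)) + real N * G * norm (e t l \<omega>) + Gchi * (\<Sum>i=1..N. norm (e t i \<omega>))" .
    have "(\<Sum>i=1..N. norm (z t l \<omega> - z t i \<omega>)) \<le> 2 * (real N - 1) * ?D \<omega>"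
    proof -
      have "(\<Sum>i=1..N. norm (z t l \<omega> - z t i \<omega>)) = (\<Sum>i\<in>{1..N} - {l}. norm (z t l \<omega> - z t i \<omega>))"
        using l by (intro sum.mono_neutral_right) auto
      also have "\<dots> \<le> (\<Sum>i\<in>{1..N} - {l}. 2 * ?D \<omega>)"
        using l by (intro sum_mono norm_diff_le_dispersion) auto
      also have "\<dots> = 2 * (real N - 1) * ?D \<omega>" using l N by (simp add: of_nat_diff)
      finally show ?thesis .
    qed
    then have "G * (\<Sum>i=1..N. norm (z t l \<omega> - z t i \<omega>)) \<le> G * (2 * (real N - 1) * ?D \<omega>)"
      using G(1) by (rule mult_left_mono)
    also have "\<dots> = (2 * (real N - 1) * G) * ?D \<omega>" by simp
    finally show ?thesis using total by linarith
  qed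
  have "expectation (\<lambda>\<omega>. obj (x (Suc t) l \<omega>)) \<le> expectation ?b"
    using ints displacement(1)[OF l] integrable_dispersion_z le
    by (intro integral_mono obj_int) auto
  also have "\<dots> = step_value t + 2 * (real N - 1) * G * expectation ?D + real N * G * expectation (\<lambda>\<omega>. norm (e t l \<omega>))
      + Gchi * (\<Sum>i=1..N. expectation (\<lambda>\<omega>. norm (e t i \<omega>)))"
    using ints displacement(1) l integrable_dispersion_z integrable_f_z integrable_chi_x
    by (simp add: step_value_def Bochner_Integration.integral_sum)
  also have "\<dots> \<le> step_value t + 2 * (real N - 1) * G * expectation ?D + real N * G * d + G * (\<Sum>i=1..N. d)"
    using displacement(2)[of _ t] l G N Gchi_nonneg
    by (intro add_mono mult_mono mult_left_mono sum_mono order_refl sum_nonneg Bochner_Integration.integral_nonneg)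
      (auto simp: d_def G_def)
  finally show ?thesis by (simp add: G_def d_def algebra_simps)
qed

end

section \<open>Stepsize sums\<close>

lemma sum_powr_le:
  fixes k :: real
  assumes "0 \<le> k" "k \<noteq> 1" "1 \<le> T"
  shows "(\<Sum>t<T. (real t + 1) powr (- k)) \<le> 1 + (real T powr (1 - k) - 1) / (1 - k)"
  using \<open>1 \<le> T\<close>
proof (induction T rule: dec_induct)
  case base
  then show ?case by simp
next
  case (step T)
  have deriv: "((\<lambda>u. u powr (1 - k) / (1 - k)) has_real_derivative u powr (- k)) (at u)" if "0 < u" for u
    using DERIV_cdivide[OF has_real_derivative_powr[OF that, of "1 - k"], of "1 - k"] \<open>k \<noteq> 1\<close> by simp
  obtain c where c: "real T < c" "c < real T + 1"
    "(real T + 1) powr (1 - k) / (1 - k) - real T powr (1 - k) / (1 - k) = (real T + 1 - real T) * c powr (- k)"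
    using MVT2[of "real T" "real T + 1" "\<lambda>u. u powr (1 - k) / (1 - k)" "\<lambda>u. u powr (- k)"] deriv step(1) by force
  have "(real T + 1) powr (- k) \<le> c powr (- k)"
    using c \<open>0 \<le> k\<close> step(1) by (intro powr_mono2') auto
  then show ?case
    using c(3) step(3) by (simp add: diff_divide_distrib add.commute)
qed

lemma sum_inverse_le:
  assumes "1 \<le> T"
  shows "(\<Sum>t<T. 1 / (real t + 1)) \<le> 1 + ln (real T)"
  using assms
proof (induction T rule: dec_induct)
  case (step T)
  have "ln (real T / (real T + 1)) \<le> real T / (real T + 1) - 1"
    using step(1) by (intro ln_le_minus_one) auto
  also have "\<dots> = - (1 / (real T + 1))" by (simp add: field_simps)
  finally have "1 / (real T + 1) \<le> ln (real T + 1) - ln (real T)"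
    using step(1) by (simp add: ln_div)
  then show ?case using step(3) by (simp add: add.commute)
qed simp

text \<open>Summation by parts for the increasing weights \<open>1 / \<alpha> t\<close>. Keeping
  \<open>w (Suc b)\<close> on the right makes the induction work, and the bound does not depend on
  the starting time \<open>a\<close>.\<close>

lemma sum_diff_weighted_le:
  fixes w \<beta> :: "nat \<Rightarrow> real"
  assumes "\<And>t. w t \<le> C" "\<And>t. 0 \<le> \<beta> t" "\<And>t. \<beta> t \<le> \<beta> (Suc t)"
  shows "(\<Sum>t\<in>{a..<Suc b}. (w t - w (Suc t)) * \<beta> t) \<le> (C - w (Suc b)) * \<beta> b"
proof (induction b)
  case 0
  have "(w 0 - w 1) * \<beta> 0 \<le> (C - w 1) * \<beta> 0" "0 \<le> (C - w 1) * \<beta> 0"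
    using assms by (auto intro!: mult_right_mono mult_nonneg_nonneg)
  then show ?case by (cases "a = 0") auto
next
  case (Suc b)
  show ?case
  proof (cases "a \<le> Suc b")
    case True
    have "(\<Sum>t\<in>{a..<Suc (Suc b)}. (w t - w (Suc t)) * \<beta> t) =
        (\<Sum>t\<in>{a..<Suc b}. (w t - w (Suc t)) * \<beta> t) + (w (Suc b) - w (Suc (Suc b))) * \<beta> (Suc b)"
      using True by simp
    also have "\<dots> \<le> (C - w (Suc b)) * \<beta> (Suc b) + (w (Suc b) - w (Suc (Suc b))) * \<beta> (Suc b)"
      using Suc mult_left_mono[OF assms(3)[of b], of "C - w (Suc b)"] assms(1)[of "Suc b"] by simp
    finally show ?thesis by (simp add: algebra_simps)
  next
    case False
    then show ?thesis using assms(1,2) by simp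
  qed
qed

text \<open>Put \<open>u = 2 * (Gf + Gc) * S / \<sigma>\<close>. As \<open>R \<le> u\<close>, the
  terms with \<open>K\<close> add up to at most \<open>4 * n * (n - 1) * (K * G * u)\<close>, while
  the right-hand side provides \<open>n ^ 3 * (K * G * u)\<close>. The difference of the
  coefficients is \<open>n * (n - 2) ^ 2\<close>.\<close>

lemma rate_C3_dominates:
  fixes n Gf Gc \<sigma> K S R :: real
  assumes "1 \<le> n" "0 \<le> Gf" "0 \<le> Gc" "0 < \<sigma>" "0 \<le> K" "0 \<le> S" "R \<le> 2 * (Gf + Gc) * S / \<sigma>"
  shows "2 * (n - 1) * (Gf + Gc) * (K * (n * R + n * (2 * (Gf + Gc) * S / \<sigma>)))
      + 2 * n * (Gf + Gc) * (2 * (Gf + Gc) * S / \<sigma>) + n * (S * Gf\<^sup>2 / (2 * \<sigma>)) \<le>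
    (((4 * n + 2 * n\<^sup>2 * K) * ((n + 1) * Gf + n * Gc) + n * Gc) * ((Gf + Gc) / \<sigma>) + n * Gf\<^sup>2 / (2 * \<sigma>)) * S"
proof -
  define G where "G = Gf + Gc"
  define u where "u = 2 * G * S / \<sigma>"
  have nn: "0 \<le> G" "0 \<le> u" using assms by (auto simp: G_def u_def)
  have "2 * (n - 1) * G * (K * (n * R + n * u)) \<le> 2 * (n - 1) * G * (K * (n * u + n * u))"
    using assms nn by (intro mult_left_mono add_mono) (auto simp: u_def G_def)
  also have "\<dots> = 4 * n * (n - 1) * (K * G * u)" by (simp add: algebra_simps)
  also have "\<dots> \<le> n ^ 3 * (K * G * u)"
  proof (rule mult_right_mono)
    have "0 \<le> n * (n - 2)\<^sup>2" using assms by simp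
    then show "4 * n * (n - 1) \<le> n ^ 3" by (simp add: power2_eq_square power3_eq_cube algebra_simps)
    show "0 \<le> K * G * u" using assms nn by simp
  qed
  finally have 1: "2 * (n - 1) * G * (K * (n * R + n * u)) \<le> n ^ 3 * (K * G * u)" .
  have 2: "2 * n * G * u \<le> 2 * n\<^sup>2 * (G * u)"
  proof -
    have "n * (G * u) \<le> n * n * (G * u)"
      using assms nn mult_left_mono[of 1 n n] by (intro mult_right_mono) auto
    then show ?thesis by (simp add: power2_eq_square mult.assoc)
  qed
  have "n * G \<le> (n + 1) * Gf + n * Gc" using assms by (simp add: G_def algebra_simps)
  then have "(4 * n + 2 * n\<^sup>2 * K) * (n * G) * (G / \<sigma> * S) \<le> (4 * n + 2 * n\<^sup>2 * K) * ((n + 1) * Gf + n * Gc) * (G / \<sigma> * S)"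
    using assms nn by (intro mult_right_mono mult_left_mono) auto
  moreover have "(4 * n + 2 * n\<^sup>2 * K) * (n * G) * (G / \<sigma> * S) = 2 * n\<^sup>2 * (G * u) + n ^ 3 * (K * G * u)"
    by (simp add: u_def power2_eq_square power3_eq_cube algebra_simps)
  moreover have "0 \<le> n * Gc * (G / \<sigma> * S)" using assms nn by simp
  ultimately have "2 * (n - 1) * G * (K * (n * R + n * u)) + 2 * n * G * u \<le>
      ((4 * n + 2 * n\<^sup>2 * K) * ((n + 1) * Gf + n * Gc) + n * Gc) * (G / \<sigma> * S)"
    unfolding distrib_right[of "(4 * n + 2 * n\<^sup>2 * K) * ((n + 1) * Gf + n * Gc)" "n * Gc"]
    using 1 2 by linarith
  moreover have "(b * (G / \<sigma>) + n * Gf\<^sup>2 / (2 * \<sigma>)) * S = b * (G / \<sigma> * S) + n * (S * Gf\<^sup>2 / (2 * \<sigma>))" for b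
    by (simp add: algebra_simps)
  ultimately show ?thesis
    unfolding G_def[symmetric] u_def[symmetric] by (simp only: add_right_mono)
qed

lemma sum_rate_le:
  fixes C k :: real
  assumes "0 \<le> C" "0 < k" "k < 1" "1 \<le> T"
  shows "C * (\<Sum>t<T. (real t + 1) powr (- k)) / real T \<le> 2 powr (1 - k) * C / (1 - k) * (1 / real T powr k)"
proof -
  have "(\<Sum>t<T. (real t + 1) powr (- k)) \<le> 1 + (real T powr (1 - k) - 1) / (1 - k)"
    using assms by (intro sum_powr_le) auto
  also have "\<dots> \<le> real T powr (1 - k) / (1 - k)" using assms by (simp add: field_simps)
  finally have "C * (\<Sum>t<T. (real t + 1) powr (- k)) / real T \<le> C * (real T powr (1 - k) / (1 - k)) / real T"
    using assms by (intro divide_right_mono mult_left_mono) auto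
  also have "\<dots> = 1 * (C / (1 - k) * (1 / real T powr k))"
    using assms by (simp add: powr_diff)
  \<comment> \<open>Comparison with the integral already gives the bound without the power of 2,
    which is at least 1.\<close>
  also have "\<dots> \<le> 2 powr (1 - k) * (C / (1 - k) * (1 / real T powr k))"
    using assms by (intro mult_right_mono ge_one_powr_ge_zero) auto
  finally show ?thesis by simp
qed

text \<open>For \<open>p < 1\<close> the power term alone suffices. For \<open>p > 1\<close> the sum
  stays below \<open>p / (p - 1)\<close>, which is at most \<open>(2 * p - 1) / (p - 1)\<close>, the
  coefficient of \<open>1 / T\<close>.\<close>

lemma sum_rate_any_le:
  fixes C p :: real
  assumes "0 \<le> C" "0 < p" "p \<noteq> 1" "1 \<le> T"
  shows "C * (\<Sum>t<T. (real t + 1) powr (- p)) / real T \<le>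
    \<bar>(1 - 2 * p) / (1 - p)\<bar> * C * (1 / real T) + C / \<bar>1 - p\<bar> * (1 / real T powr p)"
proof -
  have "1 + (real T powr (1 - p) - 1) / (1 - p) \<le> \<bar>(1 - 2 * p) / (1 - p)\<bar> + real T powr (1 - p) / \<bar>1 - p\<bar>"
  proof (cases "p < 1")
    case True
    have "1 + (real T powr (1 - p) - 1) / (1 - p) \<le> real T powr (1 - p) / (1 - p)"
      using True assms by (simp add: field_simps)
    moreover have "0 \<le> \<bar>(1 - 2 * p) / (1 - p)\<bar>" by simp
    moreover have "\<bar>1 - p\<bar> = 1 - p" using True by simp
    ultimately show ?thesis by linarith
  next
    case False
    then have p: "1 < p" using assms by simp
    have "1 + (real T powr (1 - p) - 1) / (1 - p) = p / (p - 1) - real T powr (1 - p) / (p - 1)"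
    proof -
      define q where "q = p - 1"
      have "p = 1 + q" "0 < q" using p by (simp_all add: q_def)
      then show ?thesis by (simp add: field_simps)
    qed
    also have "\<dots> \<le> (2 * p - 1) / (p - 1) + real T powr (1 - p) / (p - 1)"
    proof -
      have "p / (p - 1) \<le> (2 * p - 1) / (p - 1)" using p by (intro divide_right_mono) auto
      moreover have "0 \<le> real T powr (1 - p) / (p - 1)" using p by simp
      ultimately show ?thesis by linarith
    qed
    also have "\<dots> = \<bar>(1 - 2 * p) / (1 - p)\<bar> + real T powr (1 - p) / \<bar>1 - p\<bar>"
      using p by (simp add: abs_divide)
    finally show ?thesis .
  qed
  then have "(\<Sum>t<T. (real t + 1) powr (- p)) \<le> \<bar>(1 - 2 * p) / (1 - p)\<bar> + real T powr (1 - p) / \<bar>1 - p\<bar>"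
    using sum_powr_le[of p T] assms by linarith
  then have "C * (\<Sum>t<T. (real t + 1) powr (- p)) / real T \<le>
      C * (\<bar>(1 - 2 * p) / (1 - p)\<bar> + real T powr (1 - p) / \<bar>1 - p\<bar>) / real T"
    using assms by (intro divide_right_mono mult_left_mono) auto
  also have "\<dots> = \<bar>(1 - 2 * p) / (1 - p)\<bar> * C * (1 / real T) + C / \<bar>1 - p\<bar> * (1 / real T powr p)"
    using assms by (simp add: powr_diff add_divide_distrib distrib_left mult_ac)
  finally show ?thesis .
qed

section \<open>The rate\<close>

context dscmd
begin

text \<open>Decreasing stepsizes serve twice: in the summation by parts, and in bounding
  \<open>T\<close> times the last stepsize by the sum of all of them.\<close>

lemma expected_rate_bound:
  assumes l: "l \<in> {1..N}" and "1 \<le> T"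
    and \<alpha>_decr: "\<And>s t. s \<le> t \<Longrightarrow> \<alpha> t \<le> \<alpha> s"
    and ratio_decr: "\<And>s t. s \<le> t \<Longrightarrow> r t / \<alpha> t \<le> r s / \<alpha> s"
  shows "(\<Sum>t<T. expectation (\<lambda>\<omega>. obj (x (Suc t) l \<omega>)) - obj xstar) \<le>
    rate_C2 N (bregman_diam \<Phi> \<Phi>' X) / \<alpha> (T - 1)
    + rate_C3 N B \<theta> Gf Gchi \<sigma> * (\<Sum>t<T. \<alpha> t)
    + rate_C4 N B \<theta> Gf Gchi \<nu> * (\<Sum>t<T. r t)
    + rate_C5 N \<sigma> (bregman_diam \<Phi> \<Phi>' X) L \<nu> * (\<Sum>t<T. r t / \<alpha> t)
    + rate_C6 N L \<nu> * (\<Sum>t<T. (r t)\<^sup>2 / \<alpha> t)"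
proof -
  define n where "n = real N"
  define G where "G = Gf + Gchi"
  define S where "S = (\<Sum>t<T. \<alpha> t)"
  define K where "K = rate_omega N \<theta> / (1 - rate_gamma N B \<theta>)"
  define C2 where "C2 = n * (bregman_diam \<Phi> \<Phi>' X)\<^sup>2"
  define C3 where "C3 = ((4 * n + 2 * n\<^sup>2 * K) * ((n + 1) * Gf + n * Gchi) + n * Gchi) * (G / \<sigma>) + n * Gf\<^sup>2 / (2 * \<sigma>)"
  define C4 where "C4 = rate_C4 N B \<theta> Gf Gchi \<nu>"
  define C5 where "C5 = n * L * R * sqrt \<nu>"
  define C6 where "C6 = n * L * \<nu>"
  define a where "a t = expectation (\<lambda>\<omega>. obj (x (Suc t) l \<omega>)) - obj xstar" for t
  have n: "1 \<le> n" using N by (simp add: n_def)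
  have G: "0 \<le> G" using Gf_nonneg Gchi_nonneg by (simp add: G_def)
  have K: "0 \<le> K" using rate_gamma_omega[OF network N] by (simp add: K_def)
  have sq: "0 \<le> sqrt \<nu>" using \<nu>_nonneg by simp
  have C2: "0 \<le> C2" using n by (simp add: C2_def)
  have C3: "0 \<le> C3" using n G K Gf_nonneg Gchi_nonneg \<sigma>_pos by (simp add: C3_def)
  \<comment> \<open>The left-hand side is the coefficient of the noise that the descent step leaves
    in the function values; the last summand of \<open>C4\<close> already covers it.\<close>
  have C4: "n * Gf * sqrt \<nu> \<le> C4"
  proof -
    have "C4 = (4 * n + 2 * n\<^sup>2 * K) * ((n + 1) * Gf + n * Gchi) * n * sqrt \<nu> + G * n\<^sup>2 * sqrt \<nu>"
      by (simp add: C4_def rate_C4_def n_def K_def G_def)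
    moreover have "0 \<le> (4 * n + 2 * n\<^sup>2 * K) * ((n + 1) * Gf + n * Gchi) * n * sqrt \<nu>"
      using n K Gf_nonneg Gchi_nonneg sq by simp
    moreover have "n * Gf * sqrt \<nu> \<le> G * n\<^sup>2 * sqrt \<nu>"
    proof (rule mult_right_mono[OF _ sq])
      have "n * Gf \<le> n\<^sup>2 * G"
        using n Gf_nonneg Gchi_nonneg by (intro mult_mono) (auto simp: G_def power2_eq_square)
      then show "n * Gf \<le> G * n\<^sup>2" by (simp add: mult.commute)
    qed
    ultimately show ?thesis by linarith
  qed
  have C4': "0 \<le> C4" using order_trans[OF _ C4] n Gf_nonneg sq by simp
  have C5: "0 \<le> C5" using n L_nonneg R_nonneg sq by (simp add: C5_def)
  have C6: "0 \<le> C6" using n L_nonneg \<nu>_nonneg by (simp add: C6_def)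
  have ratio: "0 \<le> r t / \<alpha> t" "0 \<le> (r t)\<^sup>2 / \<alpha> t" for t
    using r_nonneg[of t] \<alpha>_pos[of t] by simp_all
  have S: "0 \<le> S" unfolding S_def using \<alpha>_pos by (intro sum_nonneg) (simp add: less_imp_le)
  have trivial: "a t \<le> n * G * R" for t
  proof -
    have "expectation (\<lambda>\<omega>. obj (x (Suc t) l \<omega>)) \<le> expectation (\<lambda>_. obj xstar + n * G * R)"
    proof (rule integral_mono)
      show "integrable M (\<lambda>\<omega>. obj (x (Suc t) l \<omega>))"
        by (rule integrable_continuous[OF continuous_obj x_measurable[OF l] x_in[OF l]])
      show "obj (x (Suc t) l \<omega>) \<le> obj xstar + n * G * R" if "\<omega> \<in> space M" for \<omega>
        using obj_diff_le[OF x_in[OF l that] xstar_in, of "Suc t"] by (simp add: n_def G_def)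
    qed simp
    then show ?thesis by (simp add: a_def prob_space)
  qed
  have rest: "0 \<le> C2 / \<alpha> (T - 1)" "0 \<le> C3 * S" "0 \<le> C4 * (\<Sum>t<T. r t)"
      "0 \<le> C5 * (\<Sum>t<T. r t / \<alpha> t)" "0 \<le> C6 * (\<Sum>t<T. (r t)\<^sup>2 / \<alpha> t)"
    using C2 C3 C4' C5 C6 S \<alpha>_pos[of "T - 1"] r_nonneg ratio by (auto intro!: mult_nonneg_nonneg sum_nonneg)
  have "(\<Sum>t<T. a t) \<le> C2 / \<alpha> (T - 1) + C3 * S + C4 * (\<Sum>t<T. r t) + C5 * (\<Sum>t<T. r t / \<alpha> t) + C6 * (\<Sum>t<T. (r t)\<^sup>2 / \<alpha> t)"
  proof (cases "real T * (n * G * R) \<le> C2 / \<alpha> (T - 1)")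
    case True
    have "(\<Sum>t<T. a t) \<le> (\<Sum>t<T. n * G * R)" by (intro sum_mono trivial)
    also have "\<dots> = real T * (n * G * R)" by simp
    finally show ?thesis using True rest by linarith
  next
    case False
    have T\<alpha>: "real T * \<alpha> (T - 1) \<le> S"
    proof -
      have "(\<Sum>t<T. \<alpha> (T - 1)) \<le> S" unfolding S_def by (intro sum_mono \<alpha>_decr) auto
      then show ?thesis by simp
    qed
    have D2: "C2 = n * (\<sigma> * R\<^sup>2 / 2)"
      using \<sigma>_pos by (simp add: C2_def R_def power_mult_distrib)
    \<comment> \<open>The failure of the trivial case, read as a bound on \<open>R\<close>: since
      \<open>C2 = n * \<sigma> * R ^ 2 / 2\<close>, cancelling \<open>n * R\<close> leaves
      \<open>\<sigma> * R / 2 < G * S\<close>.\<close>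
    have RS: "R \<le> 2 * G * S / \<sigma>"
    proof (cases "R = 0")
      case True
      then show ?thesis using G S \<sigma>_pos by simp
    next
      case R: False
      have "C2 < real T * (n * G * R) * \<alpha> (T - 1)"
        using False \<alpha>_pos[of "T - 1"] by (simp add: pos_le_divide_eq not_le pos_divide_less_eq)
      also have "\<dots> = (real T * \<alpha> (T - 1)) * (n * G * R)" by simp
      also have "\<dots> \<le> S * (n * G * R)"
        using T\<alpha> n G R_nonneg by (intro mult_right_mono) auto
      finally have "(n * R) * (\<sigma> * R / 2) < (n * R) * (G * S)" by (simp add: D2 power2_eq_square mult_ac)
      then have "\<sigma> * R / 2 < G * S" using n R R_nonneg by (simp add: mult_less_cancel_left_pos)
      then have "\<sigma> * R \<le> 2 * (G * S)" by linarith
      then have "R * \<sigma> \<le> 2 * G * S" by (simp add: mult_ac)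
      then show ?thesis using \<sigma>_pos by (simp only: pos_le_divide_eq)
    qed
    \<comment> \<open>The first time at which the stepsize outweighs the noise. The alternative
      \<open>T \<le> t\<close> guarantees that it exists and is at most \<open>T\<close>; if the
      noise dominates throughout, the late range is empty.\<close>
    define t0 where "t0 = (LEAST t. T \<le> t \<or> L * r t * sqrt \<nu> < \<alpha> t * G)"
    have t0: "T \<le> t0 \<or> L * r t0 * sqrt \<nu> < \<alpha> t0 * G" unfolding t0_def by (rule LeastI[of _ T]) simp
    have "t0 \<le> T" unfolding t0_def by (rule Least_le) simp
    have early: "a t \<le> C5 * (r t / \<alpha> t)" if "t < t0" for t
    proof -
      have "\<not> (T \<le> t \<or> L * r t * sqrt \<nu> < \<alpha> t * G)" using that unfolding t0_def by (rule not_less_Least)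
      then have "G \<le> L * r t * sqrt \<nu> / \<alpha> t" using \<alpha>_pos[of t] by (simp add: pos_le_divide_eq mult.commute)
      then have "n * R * G \<le> n * R * (L * r t * sqrt \<nu> / \<alpha> t)" using n R_nonneg by (intro mult_left_mono) auto
      then show ?thesis using trivial[of t] by (simp add: C5_def mult_ac)
    qed
    have late: "L * r t * sqrt \<nu> \<le> \<alpha> t * G" if t: "t \<in> {t0..<T}" for t
    proof -
      have "L * r t0 * sqrt \<nu> < \<alpha> t0 * G" using t0 t by auto
      then have "L * sqrt \<nu> * (r t0 / \<alpha> t0) \<le> G" using \<alpha>_pos[of t0] by (simp add: pos_divide_le_eq mult_ac)
      moreover have "L * sqrt \<nu> * (r t / \<alpha> t) \<le> L * sqrt \<nu> * (r t0 / \<alpha> t0)"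
        using t L_nonneg sq ratio_decr[of t0 t] by (intro mult_left_mono) auto
      ultimately have "L * sqrt \<nu> * (r t / \<alpha> t) \<le> G" by linarith
      then show ?thesis using \<alpha>_pos[of t] by (simp add: pos_divide_le_eq mult_ac)
    qed
    define d where "d t = (\<alpha> t * G + L * r t * sqrt \<nu>) / \<sigma>" for t
    have d: "d t \<le> 2 * G / \<sigma> * \<alpha> t" if "t \<in> {t0..<T}" for t
    proof -
      have "d t \<le> (\<alpha> t * G + \<alpha> t * G) / \<sigma>"
        unfolding d_def by (intro divide_right_mono add_left_mono late[OF that] less_imp_le[OF \<sigma>_pos])
      then show ?thesis by (simp add: mult_ac)
    qed
    have sub: "(\<Sum>t\<in>{t0..<T}. h t) \<le> (\<Sum>t<T. h t)" if "\<And>t. 0 \<le> h t" for h :: "nat \<Rightarrow> real"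
      using that by (intro sum_mono2) auto
    have dS: "(\<Sum>t\<in>{t0..<T}. d t) \<le> 2 * G * S / \<sigma>"
    proof -
      have "(\<Sum>t\<in>{t0..<T}. d t) \<le> 2 * G / \<sigma> * (\<Sum>t\<in>{t0..<T}. \<alpha> t)"
        unfolding sum_distrib_left by (intro sum_mono d)
      also have "\<dots> \<le> 2 * G / \<sigma> * S"
        unfolding S_def using G \<sigma>_pos \<alpha>_pos by (intro mult_left_mono sub) (auto intro: less_imp_le)
      finally show ?thesis by simp
    qed
    define disp where "disp t = expectation (\<lambda>\<omega>. dispersion N (\<lambda>i. z t i \<omega>))" for t
    have disp: "(\<Sum>t\<in>{t0..<T}. disp t) \<le> K * (n * R + n * (2 * G * S / \<sigma>))"
    proof -
      have "(\<Sum>t\<in>{t0..<T}. \<Sum>i=1..N. expectation (\<lambda>\<omega>. norm (e t i \<omega>))) \<le> (\<Sum>t\<in>{t0..<T}. \<Sum>i=1..N. d t)"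
        unfolding d_def G_def by (intro sum_mono displacement(2))
      also have "\<dots> = n * (\<Sum>t\<in>{t0..<T}. d t)" by (simp add: n_def sum_distrib_left)
      also have "\<dots> \<le> n * (2 * G * S / \<sigma>)" using dS n by (intro mult_left_mono) auto
      finally have "K * (n * R + (\<Sum>t\<in>{t0..<T}. \<Sum>i=1..N. expectation (\<lambda>\<omega>. norm (e t i \<omega>)))) \<le> K * (n * R + n * (2 * G * S / \<sigma>))"
        using K by (intro mult_left_mono add_left_mono)
      with expected_dispersion_sum[of t0 T] show ?thesis by (simp add: disp_def K_def n_def)
    qed
    have late_a: "a t \<le> (W t - W (Suc t)) * (1 / \<alpha> t) + C5 * (r t / \<alpha> t) + C6 * ((r t)\<^sup>2 / \<alpha> t)
        + n * (\<alpha> t * Gf\<^sup>2 / (2 * \<sigma>)) + n * Gf * sqrt \<nu> * r t + 2 * (n - 1) * G * disp t + 2 * n * G * d t" for t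
    proof -
      have "step_value t - obj xstar \<le> (W t - W (Suc t) + n * (L * R * r t * sqrt \<nu> + L * (r t)\<^sup>2 * \<nu>
          + (\<alpha> t)\<^sup>2 * Gf\<^sup>2 / (2 * \<sigma>) + \<alpha> t * (Gf * (r t * sqrt \<nu>)))) / \<alpha> t"
        using total_step[of t] \<alpha>_pos[of t] by (simp add: pos_le_divide_eq n_def mult.commute)
      also have "\<dots> = (W t - W (Suc t)) * (1 / \<alpha> t) + C5 * (r t / \<alpha> t) + C6 * ((r t)\<^sup>2 / \<alpha> t)
        + n * (\<alpha> t * Gf\<^sup>2 / (2 * \<sigma>)) + n * Gf * sqrt \<nu> * r t"
        using \<alpha>_pos[of t] by (simp add: C5_def C6_def add_divide_distrib distrib_left power2_eq_square mult_ac)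
      finally show ?thesis
        using consensus_gap[OF l, of t] by (simp add: a_def d_def disp_def G_def n_def)
    qed
    have "(\<Sum>t\<in>{t0..<T}. a t) \<le> (\<Sum>t\<in>{t0..<T}. (W t - W (Suc t)) * (1 / \<alpha> t) + C5 * (r t / \<alpha> t) + C6 * ((r t)\<^sup>2 / \<alpha> t)
        + n * (\<alpha> t * Gf\<^sup>2 / (2 * \<sigma>)) + n * Gf * sqrt \<nu> * r t + 2 * (n - 1) * G * disp t + 2 * n * G * d t)"
      by (intro sum_mono late_a)
    also have "\<dots> = (\<Sum>t\<in>{t0..<T}. (W t - W (Suc t)) * (1 / \<alpha> t)) + C5 * (\<Sum>t\<in>{t0..<T}. r t / \<alpha> t)
        + C6 * (\<Sum>t\<in>{t0..<T}. (r t)\<^sup>2 / \<alpha> t) + n * ((\<Sum>t\<in>{t0..<T}. \<alpha> t) * Gf\<^sup>2 / (2 * \<sigma>))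
        + n * Gf * sqrt \<nu> * (\<Sum>t\<in>{t0..<T}. r t) + 2 * (n - 1) * G * (\<Sum>t\<in>{t0..<T}. disp t) + 2 * n * G * (\<Sum>t\<in>{t0..<T}. d t)"
      by (simp only: sum.distrib sum_distrib_left sum_distrib_right sum_divide_distrib)
    finally have sum_late: "(\<Sum>t\<in>{t0..<T}. a t) \<le> (\<Sum>t\<in>{t0..<T}. (W t - W (Suc t)) * (1 / \<alpha> t)) + C5 * (\<Sum>t\<in>{t0..<T}. r t / \<alpha> t)
        + C6 * (\<Sum>t\<in>{t0..<T}. (r t)\<^sup>2 / \<alpha> t) + n * ((\<Sum>t\<in>{t0..<T}. \<alpha> t) * Gf\<^sup>2 / (2 * \<sigma>))
        + n * Gf * sqrt \<nu> * (\<Sum>t\<in>{t0..<T}. r t) + 2 * (n - 1) * G * (\<Sum>t\<in>{t0..<T}. disp t) + 2 * n * G * (\<Sum>t\<in>{t0..<T}. d t)" .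
    have telescope: "(\<Sum>t\<in>{t0..<T}. (W t - W (Suc t)) * (1 / \<alpha> t)) \<le> C2 / \<alpha> (T - 1)"
    proof -
      have "(\<Sum>t\<in>{t0..<Suc (T - 1)}. (W t - W (Suc t)) * (1 / \<alpha> t)) \<le> (C2 - W (Suc (T - 1))) * (1 / \<alpha> (T - 1))"
        by (rule sum_diff_weighted_le)
          (use W_bounds \<alpha>_pos \<alpha>_decr[of _ "Suc _"] in \<open>auto simp: C2_def n_def frac_le less_imp_le\<close>)
      also have "\<dots> \<le> C2 * (1 / \<alpha> (T - 1))"
        using W_bounds(1) \<alpha>_pos[of "T - 1"] by (intro mult_right_mono) (auto intro: less_imp_le)
      finally show ?thesis using \<open>1 \<le> T\<close> by simp
    qed
    have c6: "C6 * (\<Sum>t\<in>{t0..<T}. (r t)\<^sup>2 / \<alpha> t) \<le> C6 * (\<Sum>t<T. (r t)\<^sup>2 / \<alpha> t)"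
      using C6 ratio by (intro mult_left_mono sub)
    have c4: "n * Gf * sqrt \<nu> * (\<Sum>t\<in>{t0..<T}. r t) \<le> C4 * (\<Sum>t<T. r t)"
      using C4 C4' r_nonneg by (intro mult_mono sub sum_nonneg) auto
    have c3: "2 * (n - 1) * G * (\<Sum>t\<in>{t0..<T}. disp t) + 2 * n * G * (\<Sum>t\<in>{t0..<T}. d t)
        + n * ((\<Sum>t\<in>{t0..<T}. \<alpha> t) * Gf\<^sup>2 / (2 * \<sigma>)) \<le> C3 * S"
    proof -
      have "2 * (n - 1) * G * (\<Sum>t\<in>{t0..<T}. disp t) \<le> 2 * (n - 1) * G * (K * (n * R + n * (2 * G * S / \<sigma>)))"
        using disp n G by (intro mult_left_mono) auto
      moreover have "2 * n * G * (\<Sum>t\<in>{t0..<T}. d t) \<le> 2 * n * G * (2 * G * S / \<sigma>)"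
        using dS n G by (intro mult_left_mono) auto
      moreover have "n * ((\<Sum>t\<in>{t0..<T}. \<alpha> t) * Gf\<^sup>2 / (2 * \<sigma>)) \<le> n * (S * Gf\<^sup>2 / (2 * \<sigma>))"
        unfolding S_def using n \<sigma>_pos \<alpha>_pos
        by (intro mult_left_mono divide_right_mono mult_right_mono sub) (auto intro: less_imp_le)
      moreover have "2 * (n - 1) * G * (K * (n * R + n * (2 * G * S / \<sigma>))) + 2 * n * G * (2 * G * S / \<sigma>)
          + n * (S * Gf\<^sup>2 / (2 * \<sigma>)) \<le> C3 * S"
        using rate_C3_dominates[OF n Gf_nonneg Gchi_nonneg \<sigma>_pos K S RS[unfolded G_def]] unfolding C3_def G_def .
      ultimately show ?thesis by linarith
    qed
    have "(\<Sum>t<T. a t) = (\<Sum>t<t0. a t) + (\<Sum>t\<in>{t0..<T}. a t)"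
      using \<open>t0 \<le> T\<close> by (simp add: lessThan_atLeast0 sum.atLeastLessThan_concat)
    moreover have "(\<Sum>t<t0. a t) \<le> C5 * (\<Sum>t<t0. r t / \<alpha> t)"
      unfolding sum_distrib_left by (intro sum_mono early) auto
    moreover have "C5 * (\<Sum>t<t0. r t / \<alpha> t) + C5 * (\<Sum>t\<in>{t0..<T}. r t / \<alpha> t) = C5 * (\<Sum>t<T. r t / \<alpha> t)"
      using \<open>t0 \<le> T\<close> by (simp add: lessThan_atLeast0 sum.atLeastLessThan_concat flip: distrib_left)
    ultimately show ?thesis using sum_late telescope c6 c4 c3 by linarith
  qed
  moreover have "rate_C2 N (bregman_diam \<Phi> \<Phi>' X) = C2" by (simp add: rate_C2_def C2_def n_def)
  moreover have "rate_C3 N B \<theta> Gf Gchi \<sigma> = C3" by (simp add: rate_C3_def C3_def n_def K_def G_def)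
  moreover have "rate_C5 N \<sigma> (bregman_diam \<Phi> \<Phi>' X) L \<nu> = C5" by (simp add: rate_C5_def C5_def n_def R_def)
  moreover have "rate_C6 N L \<nu> = C6" by (simp add: rate_C6_def C6_def n_def)
  ultimately show ?thesis by (simp only: a_def S_def C4_def)
qed

text \<open>Jensen's inequality for the convex objective with uniform weights. The index shift
  reflects that the iterates 1 to \<open>T\<close> are the results of steps 0 to
  \<open>T - 1\<close>.\<close>

lemma expected_average_le:
  assumes l: "l \<in> {1..N}" and "1 \<le> T"
  shows "expectation (\<lambda>\<omega>. obj ((1 / real T) *\<^sub>R (\<Sum>t=1..T. x t l \<omega>))) - obj xstar \<le>
    (\<Sum>t<T. expectation (\<lambda>\<omega>. obj (x (Suc t) l \<omega>)) - obj xstar) / real T"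
proof -
  have conv: "convex_on UNIV obj"
  proof -
    have "obj = (\<lambda>z. \<Sum>i=1..N. f i z + chi i z)" using obj by auto
    moreover have "convex_on UNIV (\<lambda>z. \<Sum>i\<in>I. f i z + chi i z)" if "finite I" "I \<subseteq> {1..N}" for I
      using that
    proof (induction I)
      case empty
      then show ?case by (simp add: convex_on_const)
    next
      case (insert i I)
      have "convex_on UNIV (\<lambda>z. (f i z + chi i z) + (\<Sum>i\<in>I. f i z + chi i z))"
        using insert convex by (intro convex_on_add) auto
      then show ?case using insert by simp
    qed
    ultimately show ?thesis by simp
  qed
  have avg: "(1 / real T) *\<^sub>R (\<Sum>t=1..T. x t l \<omega>) = (\<Sum>t<T. (1 / real T) *\<^sub>R x (Suc t) l \<omega>)" for \<omega>
    unfolding scaleR_sum_right by (rule sum.reindex_bij_witness[of _ Suc "\<lambda>t. t - 1"]) auto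
  have in_X: "(\<Sum>t<T. (1 / real T) *\<^sub>R x (Suc t) l \<omega>) \<in> X" if "\<omega> \<in> space M" for \<omega>
    by (rule convex_sum) (use X(2) \<open>1 \<le> T\<close> x_in[OF l that] in auto)
  have int: "integrable M (\<lambda>\<omega>. obj (x t l \<omega>))" for t
    by (rule integrable_continuous[OF continuous_obj x_measurable[OF l] x_in[OF l]])
  have "expectation (\<lambda>\<omega>. obj ((1 / real T) *\<^sub>R (\<Sum>t=1..T. x t l \<omega>))) \<le>
      expectation (\<lambda>\<omega>. \<Sum>t<T. (1 / real T) * obj (x (Suc t) l \<omega>))"
    unfolding avg
  proof (rule integral_mono)
    show "integrable M (\<lambda>\<omega>. obj (\<Sum>t<T. (1 / real T) *\<^sub>R x (Suc t) l \<omega>))"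
      using l by (intro integrable_continuous[OF continuous_obj _ in_X]) measurable
    show "integrable M (\<lambda>\<omega>. \<Sum>t<T. (1 / real T) * obj (x (Suc t) l \<omega>))"
      by (intro Bochner_Integration.integrable_sum integrable_mult_right int)
    show "obj (\<Sum>t<T. (1 / real T) *\<^sub>R x (Suc t) l \<omega>) \<le> (\<Sum>t<T. (1 / real T) * obj (x (Suc t) l \<omega>))" for \<omega>
      using \<open>1 \<le> T\<close> by (intro convex_on_sum[OF _ _ conv]) (auto simp: lessThan_empty_iff)
  qed
  also have "\<dots> = (\<Sum>t<T. (1 / real T) * expectation (\<lambda>\<omega>. obj (x (Suc t) l \<omega>)))"
    by (subst Bochner_Integration.integral_sum) (simp_all add: int)
  also have "\<dots> = (\<Sum>t<T. expectation (\<lambda>\<omega>. obj (x (Suc t) l \<omega>))) / real T"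
    by (simp add: sum_divide_distrib)
  finally show ?thesis using \<open>1 \<le> T\<close> by (simp add: sum_subtractf diff_divide_distrib)
qed

lemma rate_constants_nonneg:
  "0 \<le> rate_C1 N B \<theta> Gf Gchi x0" "0 \<le> rate_C2 N d" "0 \<le> rate_C3 N B \<theta> Gf Gchi \<sigma>"
  "0 \<le> rate_C4 N B \<theta> Gf Gchi \<nu>" "0 \<le> rate_C5 N \<sigma> (bregman_diam \<Phi> \<Phi>' X) L \<nu>" "0 \<le> rate_C6 N L \<nu>"
proof -
  have "0 \<le> rate_omega N \<theta>" "0 < 1 - rate_gamma N B \<theta>" using rate_gamma_omega[OF network N] by simp_all
  moreover have "0 \<le> bregman_diam \<Phi> \<Phi>' X" by (rule bregman_diam(2)[OF \<Phi>(1) X(3) xstar_in xstar_in])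
  ultimately show "0 \<le> rate_C1 N B \<theta> Gf Gchi x0" "0 \<le> rate_C2 N d" "0 \<le> rate_C3 N B \<theta> Gf Gchi \<sigma>"
    "0 \<le> rate_C4 N B \<theta> Gf Gchi \<nu>" "0 \<le> rate_C5 N \<sigma> (bregman_diam \<Phi> \<Phi>' X) L \<nu>" "0 \<le> rate_C6 N L \<nu>"
    using Gf_nonneg Gchi_nonneg \<sigma>_pos L_nonneg \<nu>_nonneg
    by (simp_all add: rate_C1_def rate_C2_def rate_C3_def rate_C4_def rate_C5_def rate_C6_def sum_nonneg)
qed

end

theorem proposition1:
  fixes M :: "'w measure" and F :: "nat \<Rightarrow> 'w measure"
    and X :: "'a::euclidean_space set"
    and N B :: nat and \<theta> \<sigma> L \<nu> G\<^sub>f \<kappa>\<^sub>1 \<kappa>\<^sub>2 :: real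
    and f chi :: "nat \<Rightarrow> 'a \<Rightarrow> real"
    and \<Phi> :: "'a \<Rightarrow> real" and \<Phi>' :: "'a \<Rightarrow> 'a"
    and P :: "nat \<Rightarrow> nat \<Rightarrow> nat \<Rightarrow> real"
    and \<alpha> r :: "nat \<Rightarrow> real"
    and \<xi> :: "nat \<Rightarrow> nat \<Rightarrow> nat \<Rightarrow> 'w \<Rightarrow> 'a"
    and sg :: "nat \<Rightarrow> nat \<Rightarrow> 'a \<Rightarrow> 'w \<Rightarrow> 'a" and g :: "nat \<Rightarrow> 'a \<Rightarrow> 'a"
    and x0 :: "nat \<Rightarrow> 'a" and x y :: "nat \<Rightarrow> nat \<Rightarrow> 'w \<Rightarrow> 'a"
    and obj :: "'a \<Rightarrow> real" and xstar :: 'a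
    and xhat :: "nat \<Rightarrow> 'w \<Rightarrow> 'a" and l :: nat
    and G\<^sub>\<chi> D C1 C2 C3 C4 C5 C6 :: real
  assumes "prob_space M"
    and X: "X \<noteq> {}" "convex X" "compact X"
    and convex: "\<forall>i\<in>{1..N}. convex_on UNIV (f i) \<and> convex_on UNIV (chi i)"
    and obj: "\<forall>z. obj z = (\<Sum>i=1..N. f i z + chi i z)"
    and xstar: "is_arg_min obj (\<lambda>z. z \<in> X) xstar"
    and \<Phi>: "mirror_map \<Phi> \<Phi>' \<sigma>" "mirror_map_assumption N \<Phi> \<Phi>' L"
    and network: "network_assumption N P B \<theta>"
    and y: "y = noisy_mix N P r \<xi> x"
    and iteration: "dscmd_n M N X chi \<Phi> \<Phi>' \<alpha> sg x0 x y"
    and history: "adapted_history M F N \<xi> sg x y"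
    and subgradient: "stochastic_subgradient_assumption M F N X f \<xi> sg g y G\<^sub>f"
    and noise: "noise_assumption M F N \<xi> \<nu>"
    and \<alpha>: "\<forall>t. \<alpha> t = 1 / (real t + 1) powr \<kappa>\<^sub>1"
    and r: "\<forall>t. r t = 1 / (real t + 1) powr \<kappa>\<^sub>2"
    and \<kappa>: "0 < \<kappa>\<^sub>1" "\<kappa>\<^sub>1 < \<kappa>\<^sub>2" "\<kappa>\<^sub>2 \<le> 1" "2 * \<kappa>\<^sub>2 - \<kappa>\<^sub>1 \<noteq> 1"
    and l: "l \<in> {1..N}"
    and xhat: "\<forall>T \<omega>. xhat T \<omega> = (1 / real T) *\<^sub>R (\<Sum>t=1..T. x t l \<omega>)"
    and G\<^sub>\<chi>: "G\<^sub>\<chi> = max_subgrad_norm N X chi"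
    and D: "D = bregman_diam \<Phi> \<Phi>' X"
    and C1: "C1 = rate_C1 N B \<theta> G\<^sub>f G\<^sub>\<chi> x0"
    and C2: "C2 = rate_C2 N D"
    and C3: "C3 = rate_C3 N B \<theta> G\<^sub>f G\<^sub>\<chi> \<sigma>"
    and C4: "C4 = rate_C4 N B \<theta> G\<^sub>f G\<^sub>\<chi> \<nu>"
    and C5: "C5 = rate_C5 N \<sigma> D L \<nu>"
    and C6: "C6 = rate_C6 N L \<nu>"
  shows "(\<kappa>\<^sub>1 \<in> {0<..<1} \<and> \<kappa>\<^sub>2 \<in> {0<..<1} \<longrightarrow>
      (\<forall>T::nat. T \<ge> 1 \<longrightarrow>
        (\<integral>\<omega>. obj (xhat T \<omega>) \<partial>M) - obj xstar \<le>
          (C1 + \<bar>(1 - 2 * (2 * \<kappa>\<^sub>2 - \<kappa>\<^sub>1)) / (1 - (2 * \<kappa>\<^sub>2 - \<kappa>\<^sub>1))\<bar> * C6) * (1 / real T)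
          + 2 powr \<kappa>\<^sub>1 * C2 * (1 / real T powr (1 - \<kappa>\<^sub>1))
          + 2 powr (1 - \<kappa>\<^sub>1) * C3 / (1 - \<kappa>\<^sub>1) * (1 / real T powr \<kappa>\<^sub>1)
          + 2 powr (1 - \<kappa>\<^sub>2) * C4 / (1 - \<kappa>\<^sub>2) * (1 / real T powr \<kappa>\<^sub>2)
          + 2 powr (1 - (\<kappa>\<^sub>2 - \<kappa>\<^sub>1)) * C5 / (1 - (\<kappa>\<^sub>2 - \<kappa>\<^sub>1)) * (1 / real T powr (\<kappa>\<^sub>2 - \<kappa>\<^sub>1))
          + C6 / \<bar>1 - (2 * \<kappa>\<^sub>2 - \<kappa>\<^sub>1)\<bar> * (1 / real T powr (2 * \<kappa>\<^sub>2 - \<kappa>\<^sub>1))))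
    \<and> (\<kappa>\<^sub>1 \<in> {0<..<1} \<and> \<kappa>\<^sub>2 = 1 \<longrightarrow>
      (\<forall>T::nat. T \<ge> 3 \<longrightarrow>
        (\<integral>\<omega>. obj (xhat T \<omega>) \<partial>M) - obj xstar \<le>
          (C1 + (2 - \<kappa>\<^sub>1) / (1 - \<kappa>\<^sub>1) * C6) * (1 / real T)
          + (2 powr \<kappa>\<^sub>1 * C2 + 2 powr \<kappa>\<^sub>1 * C5 / \<kappa>\<^sub>1) * (1 / real T powr (1 - \<kappa>\<^sub>1))
          + 2 powr (1 - \<kappa>\<^sub>1) * C3 / (1 - \<kappa>\<^sub>1) * (1 / real T powr \<kappa>\<^sub>1)
          + 4 * C4 * (ln (real T) / real T)))"
proof -
  have "1 \<le> N" using l by simp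
  interpret dscmd M F X N B \<theta> \<sigma> L \<nu> G\<^sub>f f chi \<Phi> \<Phi>' P \<alpha> r \<xi> sg g x0 x y obj xstar
    by (rule dscmd.intro; (fact assms | fact \<open>1 \<le> N\<close> | simp add: \<alpha> r))
  have C: "C1 = rate_C1 N B \<theta> G\<^sub>f Gchi x0" "C3 = rate_C3 N B \<theta> G\<^sub>f Gchi \<sigma>" "C4 = rate_C4 N B \<theta> G\<^sub>f Gchi \<nu>"
    using C1 C3 C4 G\<^sub>\<chi> by (simp_all add: Gchi_def)
  have nonneg: "0 \<le> C1" "0 \<le> C2" "0 \<le> C3" "0 \<le> C4" "0 \<le> C5" "0 \<le> C6"
    unfolding C C2 C5 C6 D by (rule rate_constants_nonneg)+
  \<comment> \<open>The decay exponent of \<open>r ^ 2 / \<alpha>\<close>. As it differs from 1, the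
    sum belonging to \<open>C6\<close> is not harmonic and no logarithm arises from it.\<close>
  define p where "p = 2 * \<kappa>\<^sub>2 - \<kappa>\<^sub>1"
  have p: "0 < p" "p \<noteq> 1" using \<kappa> by (auto simp: p_def)
  have \<alpha>': "\<alpha> t = (real t + 1) powr (- \<kappa>\<^sub>1)" and r': "r t = (real t + 1) powr (- \<kappa>\<^sub>2)"
    and ratio: "r t / \<alpha> t = (real t + 1) powr (- (\<kappa>\<^sub>2 - \<kappa>\<^sub>1))"
    and ratio2: "(r t)\<^sup>2 / \<alpha> t = (real t + 1) powr (- p)" for t
  proof -
    show *: "\<alpha> t = (real t + 1) powr (- \<kappa>\<^sub>1)" "r t = (real t + 1) powr (- \<kappa>\<^sub>2)"
      using \<alpha> r by (simp_all add: powr_minus_divide)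
    show "r t / \<alpha> t = (real t + 1) powr (- (\<kappa>\<^sub>2 - \<kappa>\<^sub>1))" unfolding * by (simp flip: powr_diff)
    show "(r t)\<^sup>2 / \<alpha> t = (real t + 1) powr (- p)"
      unfolding * by (simp add: p_def power2_eq_square flip: powr_diff powr_add)
  qed
  have base: "(\<integral>\<omega>. obj (xhat T \<omega>) \<partial>M) - obj xstar \<le>
      2 powr \<kappa>\<^sub>1 * C2 * (1 / real T powr (1 - \<kappa>\<^sub>1))
      + C3 * (\<Sum>t<T. (real t + 1) powr (- \<kappa>\<^sub>1)) / real T
      + C4 * (\<Sum>t<T. (real t + 1) powr (- \<kappa>\<^sub>2)) / real T
      + C5 * (\<Sum>t<T. (real t + 1) powr (- (\<kappa>\<^sub>2 - \<kappa>\<^sub>1))) / real T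
      + C6 * (\<Sum>t<T. (real t + 1) powr (- p)) / real T" if T: "1 \<le> T" for T
  proof -
    have decr: "\<alpha> t \<le> \<alpha> s" "r t / \<alpha> t \<le> r s / \<alpha> s" if "s \<le> t" for s t
      using that \<kappa> unfolding ratio unfolding \<alpha>' by (auto intro!: powr_mono2')
    have "(\<integral>\<omega>. obj (xhat T \<omega>) \<partial>M) - obj xstar \<le>
        (\<Sum>t<T. expectation (\<lambda>\<omega>. obj (x (Suc t) l \<omega>)) - obj xstar) / real T"
      using expected_average_le[OF l T] xhat by simp
    also have "\<dots> \<le> (C2 / \<alpha> (T - 1) + C3 * (\<Sum>t<T. \<alpha> t) + C4 * (\<Sum>t<T. r t) + C5 * (\<Sum>t<T. r t / \<alpha> t)
        + C6 * (\<Sum>t<T. (r t)\<^sup>2 / \<alpha> t)) / real T"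
      unfolding C C2 C5 C6 D by (intro divide_right_mono expected_rate_bound[OF l T] decr) simp_all
    also have "\<dots> = C2 / \<alpha> (T - 1) / real T
      + C3 * (\<Sum>t<T. (real t + 1) powr (- \<kappa>\<^sub>1)) / real T
      + C4 * (\<Sum>t<T. (real t + 1) powr (- \<kappa>\<^sub>2)) / real T
      + C5 * (\<Sum>t<T. (real t + 1) powr (- (\<kappa>\<^sub>2 - \<kappa>\<^sub>1))) / real T
      + C6 * (\<Sum>t<T. (real t + 1) powr (- p)) / real T"
      unfolding ratio ratio2 by (simp only: \<alpha>' r' add_divide_distrib)
    also have "C2 / \<alpha> (T - 1) / real T \<le> 2 powr \<kappa>\<^sub>1 * C2 * (1 / real T powr (1 - \<kappa>\<^sub>1))"
    proof -
      have "C2 / \<alpha> (T - 1) / real T = 1 * (C2 * (1 / real T powr (1 - \<kappa>\<^sub>1)))"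
        using T by (simp add: \<alpha>' of_nat_diff powr_minus powr_diff divide_inverse)
      also have "\<dots> \<le> 2 powr \<kappa>\<^sub>1 * (C2 * (1 / real T powr (1 - \<kappa>\<^sub>1)))"
        using nonneg \<kappa> by (intro mult_right_mono ge_one_powr_ge_zero) auto
      finally show ?thesis by simp
    qed
    finally show ?thesis by simp
  qed
  have C6_sum: "C6 * (\<Sum>t<T. (real t + 1) powr (- p)) / real T \<le>
      \<bar>(1 - 2 * p) / (1 - p)\<bar> * C6 * (1 / real T) + C6 / \<bar>1 - p\<bar> * (1 / real T powr p)" if "1 \<le> T" for T
    by (rule sum_rate_any_le[OF nonneg(6) p that])
  show ?thesis
  proof (intro conjI impI allI)
    fix T :: nat assume \<kappa>': "\<kappa>\<^sub>1 \<in> {0<..<1} \<and> \<kappa>\<^sub>2 \<in> {0<..<1}" and T: "1 \<le> T"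
    have "C3 * (\<Sum>t<T. (real t + 1) powr (- \<kappa>\<^sub>1)) / real T \<le> 2 powr (1 - \<kappa>\<^sub>1) * C3 / (1 - \<kappa>\<^sub>1) * (1 / real T powr \<kappa>\<^sub>1)"
      "C4 * (\<Sum>t<T. (real t + 1) powr (- \<kappa>\<^sub>2)) / real T \<le> 2 powr (1 - \<kappa>\<^sub>2) * C4 / (1 - \<kappa>\<^sub>2) * (1 / real T powr \<kappa>\<^sub>2)"
      "C5 * (\<Sum>t<T. (real t + 1) powr (- (\<kappa>\<^sub>2 - \<kappa>\<^sub>1))) / real T \<le>
        2 powr (1 - (\<kappa>\<^sub>2 - \<kappa>\<^sub>1)) * C5 / (1 - (\<kappa>\<^sub>2 - \<kappa>\<^sub>1)) * (1 / real T powr (\<kappa>\<^sub>2 - \<kappa>\<^sub>1))"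
      using \<kappa> \<kappa>' nonneg T by (intro sum_rate_le; simp)+
    moreover have "0 \<le> C1 * (1 / real T)" using nonneg by simp
    ultimately show "(\<integral>\<omega>. obj (xhat T \<omega>) \<partial>M) - obj xstar \<le>
          (C1 + \<bar>(1 - 2 * (2 * \<kappa>\<^sub>2 - \<kappa>\<^sub>1)) / (1 - (2 * \<kappa>\<^sub>2 - \<kappa>\<^sub>1))\<bar> * C6) * (1 / real T)
          + 2 powr \<kappa>\<^sub>1 * C2 * (1 / real T powr (1 - \<kappa>\<^sub>1))
          + 2 powr (1 - \<kappa>\<^sub>1) * C3 / (1 - \<kappa>\<^sub>1) * (1 / real T powr \<kappa>\<^sub>1)
          + 2 powr (1 - \<kappa>\<^sub>2) * C4 / (1 - \<kappa>\<^sub>2) * (1 / real T powr \<kappa>\<^sub>2)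
          + 2 powr (1 - (\<kappa>\<^sub>2 - \<kappa>\<^sub>1)) * C5 / (1 - (\<kappa>\<^sub>2 - \<kappa>\<^sub>1)) * (1 / real T powr (\<kappa>\<^sub>2 - \<kappa>\<^sub>1))
          + C6 / \<bar>1 - (2 * \<kappa>\<^sub>2 - \<kappa>\<^sub>1)\<bar> * (1 / real T powr (2 * \<kappa>\<^sub>2 - \<kappa>\<^sub>1))"
      using base[OF T] C6_sum[OF T] unfolding p_def[symmetric] distrib_right by linarith
  next
    fix T :: nat assume \<kappa>': "\<kappa>\<^sub>1 \<in> {0<..<1} \<and> \<kappa>\<^sub>2 = 1" and T: "3 \<le> T"
    then have T1: "1 \<le> T" by simp
    have c3: "C3 * (\<Sum>t<T. (real t + 1) powr (- \<kappa>\<^sub>1)) / real T \<le> 2 powr (1 - \<kappa>\<^sub>1) * C3 / (1 - \<kappa>\<^sub>1) * (1 / real T powr \<kappa>\<^sub>1)"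
      using \<kappa> \<kappa>' nonneg T by (intro sum_rate_le) simp_all
    have c4: "C4 * (\<Sum>t<T. (real t + 1) powr (- \<kappa>\<^sub>2)) / real T \<le> 4 * C4 * (ln (real T) / real T)"
    proof -
      \<comment> \<open>From \<open>T = 3\<close> on \<open>ln T\<close> is at least 1, so the
        constant of the harmonic bound \<open>1 + ln T\<close> is absorbed.\<close>
      have "exp 1 \<le> real T" using exp_le T by linarith
      then have "1 \<le> ln (real T)" using T by (simp add: ln_ge_iff)
      moreover have "(\<Sum>t<T. (real t + 1) powr (- \<kappa>\<^sub>2)) = (\<Sum>t<T. 1 / (real t + 1))"
        using \<kappa>' by (intro sum.cong) (auto simp: powr_minus_divide)
      ultimately have "(\<Sum>t<T. (real t + 1) powr (- \<kappa>\<^sub>2)) \<le> 4 * ln (real T)"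
        using sum_inverse_le[OF T1] by linarith
      then have "C4 * (\<Sum>t<T. (real t + 1) powr (- \<kappa>\<^sub>2)) / real T \<le> C4 * (4 * ln (real T)) / real T"
        using nonneg by (intro divide_right_mono mult_left_mono) auto
      also have "\<dots> = 4 * C4 * (ln (real T) / real T)" by simp
      finally show ?thesis .
    qed
    \<comment> \<open>For \<open>\<kappa>\<^sub>2 = 1\<close> the exponent is
      \<open>1 - \<kappa>\<^sub>1\<close>, so this term decays like the one with \<open>C2\<close>,
      and the denominator \<open>1 - (\<kappa>\<^sub>2 - \<kappa>\<^sub>1)\<close> becomes
      \<open>\<kappa>\<^sub>1\<close>.\<close>
    have c5: "C5 * (\<Sum>t<T. (real t + 1) powr (- (\<kappa>\<^sub>2 - \<kappa>\<^sub>1))) / real T \<le>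
        2 powr \<kappa>\<^sub>1 * C5 / \<kappa>\<^sub>1 * (1 / real T powr (1 - \<kappa>\<^sub>1))"
      using sum_rate_le[of C5 "\<kappa>\<^sub>2 - \<kappa>\<^sub>1" T] \<kappa> \<kappa>' nonneg T by simp
    have c6: "C6 * (\<Sum>t<T. (real t + 1) powr (- p)) / real T \<le> (2 - \<kappa>\<^sub>1) / (1 - \<kappa>\<^sub>1) * C6 * (1 / real T)"
    proof -
      \<comment> \<open>Here the exponent exceeds 1, so the series converges and its sum is at most
        \<open>p / (p - 1)\<close>.\<close>
      have p': "p = 2 - \<kappa>\<^sub>1" "1 < p" using \<kappa>' by (simp_all add: p_def)
      have "(\<Sum>t<T. (real t + 1) powr (- p)) \<le> 1 + (real T powr (1 - p) - 1) / (1 - p)"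
        using p T1 by (intro sum_powr_le) auto
      also have "\<dots> \<le> 1 + 1 / (p - 1)"
      proof -
        have "(real T powr (1 - p) - 1) / (1 - p) = (1 - real T powr (1 - p)) / (p - 1)"
          by (metis minus_diff_eq minus_divide_divide)
        also have "\<dots> \<le> 1 / (p - 1)" using p' by (intro divide_right_mono) auto
        finally show ?thesis by simp
      qed
      also have "\<dots> = (2 - \<kappa>\<^sub>1) / (1 - \<kappa>\<^sub>1)" using \<kappa>' by (simp add: p'(1) field_simps)
      finally have "C6 * (\<Sum>t<T. (real t + 1) powr (- p)) / real T \<le> C6 * ((2 - \<kappa>\<^sub>1) / (1 - \<kappa>\<^sub>1)) / real T"
        using nonneg by (intro divide_right_mono mult_left_mono) auto
      then show ?thesis by (simp add: mult.commute)
    qed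
    have "0 \<le> C1 * (1 / real T)" using nonneg by simp
    then show "(\<integral>\<omega>. obj (xhat T \<omega>) \<partial>M) - obj xstar \<le>
          (C1 + (2 - \<kappa>\<^sub>1) / (1 - \<kappa>\<^sub>1) * C6) * (1 / real T)
          + (2 powr \<kappa>\<^sub>1 * C2 + 2 powr \<kappa>\<^sub>1 * C5 / \<kappa>\<^sub>1) * (1 / real T powr (1 - \<kappa>\<^sub>1))
          + 2 powr (1 - \<kappa>\<^sub>1) * C3 / (1 - \<kappa>\<^sub>1) * (1 / real T powr \<kappa>\<^sub>1)
          + 4 * C4 * (ln (real T) / real T)"
      using base[OF T1] c3 c4 c5 c6 unfolding distrib_right by linarith
  qed
qed

end
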